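(* Let $p>n$ and let $\mathcal{A}$ and $\mathcal{B}$ satisfy the structural assumptions described in the context with constants $0<a_0\le a_1<\infty$ and $0<b_1<\infty$. Suppose that $u$ is a solution of $-\nabla\cdot\mathcal{A}(x,u,\nabla u)+\mathcal{B}(x,u,\nabla u)=0$ in $G$. Then for every $0<r_1<r_2<r_3$ such that $\overline{B}_{r_3}\subset G$ there exists a constant $0<\lambda<1$, depending only on $p$, $n$, $a_0$, $a_1$, $b_1$, and on the ratios $r_1/r_2$, $r_1/r_3$, $r_2/r_3$, for which both $$\mathcal{M}(r_2)\le \lambda\,\mathcal{M}(r_1)+(1-\lambda)\,\mathcal{M}(r_3)\qquad\text{and}\qquad \mathfrak{m}(r_2)\ge \lambda\,\mathfrak{m}(r_1)+(1-\lambda)\,\mathfrak{m}(r_3)$$ hold. Moreover, $$\lambda=\exp\left(-C\,\Lambda\left(\frac{r_1}{r_2},\frac{r_1}{r_3},\frac{r_2}{r_3}\right)\right),$$ where $C>0$ is a constant depending only on $p$, $n$, $a_0$, $a_1$, $b_1$, and $$\Lambda\left(\frac{r_1}{r_2},\frac{r_1}{r_3},\frac{r_2}{r_3}\right)=\left(\log\frac{r_2+r_3}{2r_2}\right)^{-1/p}\left(\frac{r_2+r_3}{2}\right)^{1-n/p}\left\{\operatorname{Cap}_p(B_{(r_2+r_3)/2},B_{r_3})+\operatorname{Cap}_p(B_{r_1},B_{r_2})+r_1^{n-p}-r_3^{n-p}\right\}^{1/p}.$$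
   Context: Let $n\ge 2$ and let $G\subset\mathbb{R}^n$ be a domain, possibly unbounded, containing the origin. $B_r$ denotes the open ball of radius $r$ centered at the origin and $\overline{B}_r$ its closure. $\mathcal{A}:G\times\mathbb{R}\times\mathbb{R}^n\to\mathbb{R}^n$ and $\mathcal{B}:G\times\mathbb{R}\times\mathbb{R}^n\to\mathbb{R}$ satisfy the Carathéodory condition: they are measurable in $x\in G$ for every fixed $(t,h)\in\mathbb{R}\times\mathbb{R}^n$ and continuous in $(t,h)$ for almost every fixed $x$. Structural assumptions (with $p>n$): for all $(t,h)\in\mathbb{R}\times\mathbb{R}^n$ and almost every $x\in G$, $$\mathcal{A}(x,t,h)\cdot h\ge a_0|h|^p,\qquad |\mathcal{A}(x,t,h)|\le a_1|h|^{p-1},\qquad |\mathcal{B}(x,t,h)|\le g(x)|h|^{p-1},$$ where $g(x)=b_1$ if $|x|\le 1$ and $g(x)=b_1/|x|$ if $|x|>1$. A function $u\in W^{1,p}_{\rm loc}(G)$ is a solution of the equation in $G$ if for every relatively compact open $D\subset G$ and every $\eta\in W^{1,p}_0(D)$, $$\int_D\mathcal{A}(x,u,\nabla u)\cdot\nabla\eta\,dx+\int_D\mathcal{B}(x,u,\nabla u)\,\eta\,dx=0.$$ For $\overline{B}_r\subset G$, $\mathcal{M}(r)=\operatorname{ess\,sup}_{x\in B_r}u(x)$ and $\mathfrak{m}(r)=\operatorname{ess\,inf}_{x\in B_r}u(x)$. For $0<r<R$, $\operatorname{Cap}_p(B_r,B_R)$ is the variational $p$-capacity of the condenser $(B_r,B_R)$,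 i.e. the infimum of $\int_{B_R}|\nabla v|^p\,dx$ over $v\in C_0^\infty(B_R)$ with $v\ge 1$ on $B_r$; for $p>n$ it equals $c\left(R^{(p-n)/(p-1)}-r^{(p-n)/(p-1)}\right)^{1-p}$ with a constant $c>0$ depending only on $p$ and $n$. *)

theory Defs
  imports "HOL-Analysis.Analysis" "HOL-Probability.Essential_Supremum"
begin

text \<open>
  Functions on a subset of \<open>\<real>\<^sup>n\<close> are total functions on \<^typ>\<open>real^'n\<close> whose values outside the set
  are never used. Almost everywhere statements, measurability and integrals refer to Lebesgue
  measure, and \<open>|h|\<^sup>p\<close> is \<^term>\<open>norm h powr p\<close>.
\<close>


section \<open>Test functions\<close>

definition grad :: "(real^'n \<Rightarrow> real) \<Rightarrow> real^'n \<Rightarrow> real^'n" where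
  "grad f x = (\<chi> i. frechet_derivative f (at x) (axis i 1))"

text \<open>Functions of class \<open>C\<^sup>k\<close>, by iterating directional derivatives.\<close>

primrec times_cont_diff :: "nat \<Rightarrow> (real^'n \<Rightarrow> real) \<Rightarrow> bool" where
  "times_cont_diff 0 f \<longleftrightarrow> continuous_on UNIV f"
| "times_cont_diff (Suc k) f \<longleftrightarrow>
     (\<forall>x. f differentiable at x) \<and>
     (\<forall>v. times_cont_diff k (\<lambda>x. frechet_derivative f (at x) v))"

text \<open>The space \<open>C\<^sub>0\<^sup>\<infinity>(\<Omega>)\<close>; its elements are extended by zero to all of \<open>\<real>\<^sup>n\<close>.\<close>

definition test_functions :: "(real^'n) set \<Rightarrow> (real^'n \<Rightarrow> real) set" where
  "test_functions \<Omega> =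
     {\<phi>. (\<forall>k. times_cont_diff k \<phi>) \<and>
         compact (closure {x. \<phi> x \<noteq> 0}) \<and> closure {x. \<phi> x \<noteq> 0} \<subseteq> \<Omega>}"


section \<open>Lebesgue and Sobolev spaces\<close>

definition Lp_on :: "real \<Rightarrow> (real^'n) set \<Rightarrow> (real^'n \<Rightarrow> 'b::euclidean_space) \<Rightarrow> bool" where
  "Lp_on p S f \<longleftrightarrow>
     f \<in> borel_measurable (lebesgue_on S) \<and>
     integrable (lebesgue_on S) (\<lambda>x. norm (f x) powr p)"

definition Lp_loc_on :: "real \<Rightarrow> (real^'n) set \<Rightarrow> (real^'n \<Rightarrow> 'b::euclidean_space) \<Rightarrow> bool" where
  "Lp_loc_on p G f \<longleftrightarrow> (\<forall>K. compact K \<and> K \<subseteq> G \<longrightarrow> Lp_on p K f)"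

text \<open>\<open>Du\<close> is a representative of the distributional gradient of \<open>u\<close> in the open set \<open>G\<close>; it is
  determined up to a set of measure zero.\<close>

definition has_weak_gradient_on ::
    "(real^'n) set \<Rightarrow> (real^'n \<Rightarrow> real) \<Rightarrow> (real^'n \<Rightarrow> real^'n) \<Rightarrow> bool" where
  "has_weak_gradient_on G u Du \<longleftrightarrow>
     (\<forall>K. compact K \<and> K \<subseteq> G \<longrightarrow>
        u absolutely_integrable_on K \<and> Du absolutely_integrable_on K) \<and>
     (\<forall>\<phi>\<in>test_functions G.
        (\<integral>x. u x *\<^sub>R grad \<phi> x \<partial>lebesgue_on G) = - (\<integral>x. \<phi> x *\<^sub>R Du x \<partial>lebesgue_on G))"

text \<open>\<open>u \<in> W\<^sup>1\<^sup>,\<^sup>p(D)\<close> respectively \<open>u \<in> W\<^sup>1\<^sup>,\<^sup>p\<^sub>l\<^sub>o\<^sub>c(G)\<close>, with weak gradient \<open>Du\<close>.\<close>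

definition in_W1p :: "real \<Rightarrow> (real^'n) set \<Rightarrow> (real^'n \<Rightarrow> real) \<Rightarrow> (real^'n \<Rightarrow> real^'n) \<Rightarrow> bool" where
  "in_W1p p D u Du \<longleftrightarrow> Lp_on p D u \<and> has_weak_gradient_on D u Du \<and> Lp_on p D Du"

definition in_W1p_loc :: "real \<Rightarrow> (real^'n) set \<Rightarrow> (real^'n \<Rightarrow> real) \<Rightarrow> (real^'n \<Rightarrow> real^'n) \<Rightarrow> bool" where
  "in_W1p_loc p G u Du \<longleftrightarrow> Lp_loc_on p G u \<and> has_weak_gradient_on G u Du \<and> Lp_loc_on p G Du"

text \<open>\<open>W\<^sub>0\<^sup>1\<^sup>,\<^sup>p(D)\<close>, the closure of \<open>C\<^sub>0\<^sup>\<infinity>(D)\<close> in \<open>W\<^sup>1\<^sup>,\<^sup>p(D)\<close>.\<close>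

definition in_W1p_0 :: "real \<Rightarrow> (real^'n) set \<Rightarrow> (real^'n \<Rightarrow> real) \<Rightarrow> (real^'n \<Rightarrow> real^'n) \<Rightarrow> bool" where
  "in_W1p_0 p D u Du \<longleftrightarrow>
     in_W1p p D u Du \<and>
     (\<exists>\<phi>. (\<forall>k::nat. \<phi> k \<in> test_functions D) \<and>
        (\<lambda>k. \<integral>x. norm (\<phi> k x - u x) powr p \<partial>lebesgue_on D) \<longlonglongrightarrow> 0 \<and>
        (\<lambda>k. \<integral>x. norm (grad (\<phi> k) x - Du x) powr p \<partial>lebesgue_on D) \<longlonglongrightarrow> 0)"


section \<open>The equation\<close>

definition Caratheodory ::
    "(real^'n) set \<Rightarrow> (real^'n \<Rightarrow> real \<Rightarrow> real^'n \<Rightarrow> 'b::euclidean_space) \<Rightarrow> bool" where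
  "Caratheodory G F \<longleftrightarrow>
     (\<forall>t h. (\<lambda>x. F x t h) \<in> borel_measurable (lebesgue_on G)) \<and>
     (AE x in lebesgue_on G. continuous_on UNIV (\<lambda>(t, h). F x t h))"

definition lower_order_weight :: "real \<Rightarrow> real^'n \<Rightarrow> real" where
  "lower_order_weight b\<^sub>1 x = (if norm x \<le> 1 then b\<^sub>1 else b\<^sub>1 / norm x)"

definition structural_assumptions ::
    "real \<Rightarrow> real \<Rightarrow> real \<Rightarrow> real \<Rightarrow> (real^'n) set \<Rightarrow>
     (real^'n \<Rightarrow> real \<Rightarrow> real^'n \<Rightarrow> real^'n) \<Rightarrow> (real^'n \<Rightarrow> real \<Rightarrow> real^'n \<Rightarrow> real) \<Rightarrow> bool" where
  "structural_assumptions p a\<^sub>0 a\<^sub>1 b\<^sub>1 G A B \<longleftrightarrow>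
     Caratheodory G A \<and> Caratheodory G B \<and>
     (\<forall>t h. AE x in lebesgue_on G.
        A x t h \<bullet> h \<ge> a\<^sub>0 * norm h powr p \<and>
        norm (A x t h) \<le> a\<^sub>1 * norm h powr (p - 1) \<and>
        \<bar>B x t h\<bar> \<le> lower_order_weight b\<^sub>1 x * norm h powr (p - 1))"

text \<open>Weak solutions of \<open>-\<nabla>\<cdot>A(x,u,\<nabla>u) + B(x,u,\<nabla>u) = 0\<close> in \<open>G\<close>. Neither the choice of \<open>Du\<close> nor
  that of \<open>D\<eta>\<close> matters, since weak gradients are unique up to a set of measure zero.\<close>

definition weak_solution ::
    "real \<Rightarrow> (real^'n) set \<Rightarrow> (real^'n \<Rightarrow> real \<Rightarrow> real^'n \<Rightarrow> real^'n) \<Rightarrow>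
     (real^'n \<Rightarrow> real \<Rightarrow> real^'n \<Rightarrow> real) \<Rightarrow> (real^'n \<Rightarrow> real) \<Rightarrow> bool" where
  "weak_solution p G A B u \<longleftrightarrow>
     (\<exists>Du. in_W1p_loc p G u Du \<and>
        (\<forall>D \<eta> D\<eta>. open D \<and> compact (closure D) \<and> closure D \<subseteq> G \<and> in_W1p_0 p D \<eta> D\<eta> \<longrightarrow>
           (\<integral>x. A x (u x) (Du x) \<bullet> D\<eta> x \<partial>lebesgue_on D) +
           (\<integral>x. B x (u x) (Du x) * \<eta> x \<partial>lebesgue_on D) = 0))"


section \<open>Essential bounds on balls and capacity\<close>

definition essinf :: "'a measure \<Rightarrow> ('a \<Rightarrow> ereal) \<Rightarrow> ereal" where
  "essinf M f = - esssup M (\<lambda>x. - f x)"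

definition sup_on_ball :: "(real^'n \<Rightarrow> real) \<Rightarrow> real \<Rightarrow> ereal" where
  "sup_on_ball u r = esssup (lebesgue_on (ball 0 r)) (\<lambda>x. ereal (u x))"

definition inf_on_ball :: "(real^'n \<Rightarrow> real) \<Rightarrow> real \<Rightarrow> ereal" where
  "inf_on_ball u r = essinf (lebesgue_on (ball 0 r)) (\<lambda>x. ereal (u x))"

definition p_capacity :: "real \<Rightarrow> (real^'n) set \<Rightarrow> (real^'n) set \<Rightarrow> real" where
  "p_capacity p E \<Omega> =
     Inf {(\<integral>x. norm (grad v x) powr p \<partial>lebesgue_on \<Omega>) |v. v \<in> test_functions \<Omega> \<and> (\<forall>x\<in>E. v x \<ge> 1)}"

end

theory Submission
  imports Defs
begin

text \<open>
  Let \<open>v = M - u \<ge> 0\<close> with \<open>M\<close> the supremum of \<open>u\<close> on the largest ball (or \<open>v = u - m\<close> for the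
  infima). Testing the equation with \<open>\<zeta> (\<epsilon> + v)\<^sup>1\<^sup>-\<^sup>p\<close>, where \<open>\<zeta>\<close> is a bump function of a ball of radius
  \<open>2\<rho>\<close> at distance at least \<open>\<rho>\<close> from the origin, bounds the \<open>p\<close>-energy of \<open>ln (\<epsilon> + v)\<close> on the
  ball of radius \<open>\<rho>\<close> by a multiple of \<open>\<rho>\<^sup>n\<^sup>-\<^sup>p\<close>, because the weight of the lower order term is at
  most \<open>b\<^sub>1 / \<rho>\<close> there. As \<open>p > n\<close>, Morrey's estimate then bounds the oscillation of \<open>ln (\<epsilon> + v)\<close> by a
  constant. Following a ray from a point \<open>y\<close> with \<open>r\<^sub>1 \<le> |y| < r\<^sub>2\<close> to the ball of radius \<open>r\<^sub>1\<close>
  takes \<open>O(1 + ln T)\<close> such balls, where \<open>T = (r\<^sub>2 / r\<^sub>1) (r\<^sub>3 - r\<^sub>1) / (r\<^sub>3 - r\<^sub>2)\<close>, and \<open>1 + ln T\<close> is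
  bounded by a multiple of \<open>\<Lambda>\<close>; for this the term \<open>r\<^sub>1\<^sup>n\<^sup>-\<^sup>p - r\<^sub>3\<^sup>n\<^sup>-\<^sup>p\<close> in \<open>\<Lambda>\<close> suffices, and of the
  capacities only nonnegativity and homogeneity matter. All of this is done for the mollifications
  \<open>v\<^sub>k\<close> of \<open>v\<close>, which makes the test functions smooth, with errors that vanish as \<open>k\<close> grows.
\<close>

text \<open>The power 1 - p makes every term of the tested equation homogeneous of degree 0 in
  \<epsilon> + v, so only the logarithm survives and the size of u never enters. The obstacle is
  that the mollification v_k solves no equation: the coefficients stay evaluated along u and are
  coercive for the weak gradient \<open>F\<close> of v, while the test function built from v_k
  carries the gradient of v_k, which is the mollification of \<open>F\<close>. Exchanging the two
  costs a power of 1/\<epsilon> times an L^p error. Hence the nested choices: first \<epsilon>, then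
  a Young weight \<kappa>, then k large. The errors only have to fall below the natural size of the
  energy on the ball, so neither \<epsilon> nor u is left in the constants and \<epsilon> may tend
  to 0 at the very end. The three balls inequality is a rearrangement: if M(r3) - u is at least
  M(r3) - M(r1) on the smallest ball, it is at least \<lambda> (M(r3) - M(r1)) on the middle
  one.\<close>

definition smooth :: "(real^'n \<Rightarrow> real) \<Rightarrow> bool" where
  "smooth f \<longleftrightarrow> (\<forall>k. times_cont_diff k f)"

section \<open>Calculus of C^k and smooth functions\<close>

lemma times_cont_diff_Suc_D: "times_cont_diff (Suc k) f \<Longrightarrow> times_cont_diff k f"
proof (induction k arbitrary: f)
  case 0
  then show ?case
    by (auto intro!: differentiable_imp_continuous_on simp: differentiable_on_def
        intro: differentiable_at_withinI)
next
  case (Suc k)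
  then show ?case by (metis times_cont_diff.simps(2))
qed

lemma times_cont_diff_SucI:
  assumes "\<And>x. (f has_derivative f' x) (at x)" "\<And>v. times_cont_diff k (\<lambda>x. f' x v)"
  shows "times_cont_diff (Suc k) f"
proof -
  have "frechet_derivative f (at x) = f' x" for x
    using assms(1) frechet_derivative_at by metis
  then show ?thesis using assms by (auto simp: differentiable_def)
qed

lemma times_cont_diff_has_derivative:
  "times_cont_diff (Suc k) f \<Longrightarrow> (f has_derivative frechet_derivative f (at x)) (at x)"
  by (simp add: frechet_derivative_works)

lemma times_cont_diff_const: "times_cont_diff k (\<lambda>x. c)"
proof (induction k arbitrary: c)
  case (Suc k)
  then show ?case by (intro times_cont_diff_SucI[where f'="\<lambda>_ _. 0"]) auto
qed auto

lemma times_cont_diff_add: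
  "times_cont_diff k f \<Longrightarrow> times_cont_diff k g \<Longrightarrow> times_cont_diff k (\<lambda>x. f x + g x)"
proof (induction k arbitrary: f g)
  case (Suc k)
  show ?case
    by (rule times_cont_diff_SucI)
      (use Suc in \<open>auto intro!: derivative_eq_intros times_cont_diff_has_derivative\<close>)
qed (auto intro: continuous_intros)

lemma times_cont_diff_mult:
  "times_cont_diff k f \<Longrightarrow> times_cont_diff k g \<Longrightarrow> times_cont_diff k (\<lambda>x. f x * g x)"
proof (induction k arbitrary: f g)
  case (Suc k)
  show ?case
  proof (rule times_cont_diff_SucI)
    show "((\<lambda>x. f x * g x) has_derivative
        (\<lambda>h. f x * frechet_derivative g (at x) h + frechet_derivative f (at x) h * g x)) (at x)" for x
      by (rule has_derivative_mult[OF times_cont_diff_has_derivative[OF Suc.prems(1)]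
          times_cont_diff_has_derivative[OF Suc.prems(2)]])
    show "times_cont_diff k
        (\<lambda>x. f x * frechet_derivative g (at x) v + frechet_derivative f (at x) v * g x)" for v
    proof -
      have "times_cont_diff k f" "times_cont_diff k g"
        using Suc.prems times_cont_diff_Suc_D by blast+
      with Suc.prems show ?thesis by (intro times_cont_diff_add Suc.IH) auto
    qed
  qed
qed (auto intro: continuous_intros)

text \<open>Differentiation lowers the exponent, so the induction must leave \<open>a\<close> free;
  positivity of \<open>f\<close> keeps every real power differentiable. This makes the factor
  (\<epsilon> + v) powr (1 - p) of the test functions smooth.\<close>

lemma times_cont_diff_powr:
  assumes "\<And>x. f x > 0" "times_cont_diff k f"
  shows "times_cont_diff k (\<lambda>x. f x powr a)"
  using assms
proof (induction k arbitrary: a)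
  case (Suc k)
  have f: "(f has_derivative frechet_derivative f (at x)) (at x)" for x
    using Suc.prems times_cont_diff_has_derivative by blast
  show ?case
  proof (rule times_cont_diff_SucI)
    fix x
    show "((\<lambda>x. f x powr a) has_derivative
        (\<lambda>h. (a * f x powr (a - 1)) * frechet_derivative f (at x) h)) (at x)"
    proof -
      have "((\<lambda>y. y powr a) has_real_derivative (a * f x powr (a - 1))) (at (f x))"
        using Suc.prems(1)[of x] by (rule has_real_derivative_powr)
      from has_derivative_compose[OF f this[unfolded has_field_derivative_def]]
      show ?thesis by simp
    qed
    show "times_cont_diff k (\<lambda>x. a * f x powr (a - 1) * frechet_derivative f (at x) v)" for v
      using Suc by (intro times_cont_diff_mult times_cont_diff_const Suc.IH)
        (auto dest: times_cont_diff_Suc_D simp del: times_cont_diff.simps(2), auto)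
  qed
qed (auto intro!: continuous_intros simp: less_imp_neq[THEN not_sym])

lemma smoothI:
  assumes "\<And>x. (f has_derivative f' x) (at x)" "\<And>v. smooth (\<lambda>x. f' x v)"
  shows "smooth f"
  unfolding smooth_def
proof
  fix k show "times_cont_diff k f"
    using assms times_cont_diff_SucI times_cont_diff_Suc_D unfolding smooth_def by metis
qed

lemma smooth_const: "smooth (\<lambda>x. c)"
  and smooth_add: "smooth f \<Longrightarrow> smooth g \<Longrightarrow> smooth (\<lambda>x. f x + g x)"
  and smooth_mult: "smooth f \<Longrightarrow> smooth g \<Longrightarrow> smooth (\<lambda>x. f x * g x)"
  and smooth_powr: "smooth f \<Longrightarrow> (\<And>x. f x > 0) \<Longrightarrow> smooth (\<lambda>x. f x powr a)"
  by (auto simp: smooth_def times_cont_diff_const times_cont_diff_add times_cont_diff_mult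
      times_cont_diff_powr)

lemma smooth_bounded_linear: "bounded_linear f \<Longrightarrow> smooth f"
  by (rule smoothI[where f'="\<lambda>_. f"])
    (auto intro: bounded_linear_imp_has_derivative smooth_const)

lemma smooth_frechet_derivative: "smooth f \<Longrightarrow> smooth (\<lambda>x. frechet_derivative f (at x) v)"
  unfolding smooth_def by (metis times_cont_diff.simps(2))

text \<open>\<open>grad\<close> records only partial derivatives. The notion of C^1 used here
  includes total differentiability, so by linearity they determine the whole derivative.\<close>

lemma smooth_has_derivative:
  assumes "smooth f"
  shows "(f has_derivative (\<lambda>v. grad f x \<bullet> v)) (at x)"
proof -
  have 1: "(f has_derivative frechet_derivative f (at x)) (at x)"
    using assms times_cont_diff_has_derivative unfolding smooth_def by blast
  interpret bounded_linear "frechet_derivative f (at x)"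
    using 1 by (rule has_derivative_bounded_linear)
  have "frechet_derivative f (at x) v = grad f x \<bullet> v" for v
  proof -
    have "v = (\<Sum>i\<in>UNIV. v $ i *\<^sub>R axis i 1)"
      using basis_expansion[of v] by (simp add: scalar_mult_eq_scaleR)
    then have "frechet_derivative f (at x) v =
        frechet_derivative f (at x) (\<Sum>i\<in>UNIV. v $ i *\<^sub>R axis i 1)"
      by (rule arg_cong)
    also have "\<dots> = (\<Sum>i\<in>UNIV. v $ i * frechet_derivative f (at x) (axis i 1))"
      by (simp add: sum scale)
    finally have "frechet_derivative f (at x) v =
        (\<Sum>i\<in>UNIV. v $ i * frechet_derivative f (at x) (axis i 1))" .
    then show ?thesis by (simp add: grad_def inner_vec_def mult.commute)
  qed
  then show ?thesis using 1 by (metis (no_types, lifting) ext)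
qed

lemma grad_eqI:
  assumes "(f has_derivative (\<lambda>v. D \<bullet> v)) (at x)"
  shows "grad f x = D"
proof -
  have "frechet_derivative f (at x) = (\<lambda>v. D \<bullet> v)"
    using assms frechet_derivative_at by metis
  then show ?thesis by (simp add: grad_def vec_eq_iff inner_axis)
qed

lemma smooth_continuous_on: "smooth f \<Longrightarrow> continuous_on S f"
  using continuous_on_subset unfolding smooth_def by (metis subset_UNIV times_cont_diff.simps(1))

lemma smooth_grad_nth: "smooth f \<Longrightarrow> smooth (\<lambda>x. grad f x $ i)"
  by (simp add: grad_def smooth_frechet_derivative)

lemma smooth_continuous_on_grad: "smooth f \<Longrightarrow> continuous_on S (grad f)"
  by (subst continuous_on_componentwise)
    (auto intro!: smooth_continuous_on simp: Basis_vec_def inner_axis smooth_grad_nth)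

text \<open>A directional derivative of the composite is again a smooth function, c times a
  directional derivative of \<open>f\<close>, composed with the same affine map. Hence the induction
  over \<open>k\<close> with \<open>f\<close> arbitrary.\<close>

lemma smooth_affine_compose:
  fixes f :: "real^'n \<Rightarrow> real"
  assumes "smooth f" shows "smooth (\<lambda>x. f (a + c *\<^sub>R x))"
proof -
  have "times_cont_diff k (\<lambda>x. f (a + c *\<^sub>R x))" if "smooth f" for k and f :: "real^'n \<Rightarrow> real"
    using that
  proof (induction k arbitrary: f)
    case 0
    then show ?case
      by (auto intro!: continuous_on_compose2[OF smooth_continuous_on[OF 0, of UNIV]] continuous_intros)
  next
    case (Suc k)
    show ?case
    proof (rule times_cont_diff_SucI)
      show "((\<lambda>x. f (a + c *\<^sub>R x)) has_derivative (\<lambda>v. grad f (a + c *\<^sub>R x) \<bullet> (c *\<^sub>R v))) (at x)" for x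
        by (rule has_derivative_compose[OF _ smooth_has_derivative[OF Suc.prems]])
          (auto intro!: derivative_eq_intros)
      have "smooth (\<lambda>x. c * (grad f x \<bullet> v))" for v
      proof -
        have "grad f x \<bullet> v = frechet_derivative f (at x) v" for x
          using smooth_has_derivative[OF Suc.prems] frechet_derivative_at by metis
        then show ?thesis
          using Suc.prems by (simp add: smooth_mult smooth_const smooth_frechet_derivative)
      qed
      from Suc.IH[OF this] show "times_cont_diff k (\<lambda>x. grad f (a + c *\<^sub>R x) \<bullet> (c *\<^sub>R v))" for v
        by simp
    qed
  qed
  with assms show ?thesis by (auto simp: smooth_def)
qed

lemma grad_affine_compose:
  fixes f :: "real^'n \<Rightarrow> real"
  assumes "smooth f" shows "grad (\<lambda>x. f (a + c *\<^sub>R x)) x = c *\<^sub>R grad f (a + c *\<^sub>R x)"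
proof (rule grad_eqI)
  have "((\<lambda>x. f (a + c *\<^sub>R x)) has_derivative (\<lambda>v. grad f (a + c *\<^sub>R x) \<bullet> (c *\<^sub>R v))) (at x)"
    by (rule has_derivative_compose[OF _ smooth_has_derivative[OF assms]])
      (auto intro!: derivative_eq_intros)
  then show "((\<lambda>x. f (a + c *\<^sub>R x)) has_derivative (\<lambda>v. (c *\<^sub>R grad f (a + c *\<^sub>R x)) \<bullet> v)) (at x)"
    by simp
qed

lemma grad_eq_0_outside:
  assumes "open S" "x \<in> S" "\<And>y. y \<in> S \<Longrightarrow> f y = 0"
  shows "grad f x = 0"
proof (rule grad_eqI)
  have "((\<lambda>x. 0) has_derivative (\<lambda>v. 0 \<bullet> v)) (at x)" by simp
  then show "(f has_derivative (\<lambda>v. 0 \<bullet> v)) (at x)"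
    by (rule has_derivative_transform_within_open[OF _ assms(1,2)]) (use assms in auto)
qed

lemma test_functionsI:
  assumes "smooth f" "{x. f x \<noteq> 0} \<subseteq> K" "compact K" "K \<subseteq> S"
  shows "f \<in> test_functions S"
proof -
  have "closure {x. f x \<noteq> 0} \<subseteq> K"
    using assms(2,3) by (intro closure_minimal compact_imp_closed)
  moreover have "compact (closure {x. f x \<noteq> 0})"
    using bounded_subset[OF compact_imp_bounded[OF assms(3)] assms(2)] by (simp only: compact_closure)
  ultimately show ?thesis using assms(1,4) unfolding test_functions_def smooth_def by blast
qed

section \<open>Bump functions\<close>

text \<open>Index 0 is the classical flat function exp(-1/t). The powers of t in the denominator are
  included because the derivative of index \<open>j\<close> combines the indices
  \<open>j + 1\<close> and \<open>j + 2\<close>, so that the span of the family is closed under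
  differentiation.\<close>

definition exp_tail :: "nat \<Rightarrow> real \<Rightarrow> real" where
  "exp_tail j t = (if t > 0 then exp (- 1 / t) / t ^ j else 0)"

lemma exp_tail_nonneg: "exp_tail j t \<ge> 0"
  by (simp add: exp_tail_def)

text \<open>Take the m-th power of s \<le> exp s at s = 1/(m t) with m = j + 2. The spare factor
  \<open>t ^ 2\<close> forces the difference quotient at 0 to vanish.\<close>

lemma exp_tail_le: "exp_tail j t \<le> real ((j + 2) ^ (j + 2)) * t ^ 2"
proof (cases "t > 0")
  case True
  define m where "m = j + 2"
  have m: "m > 0" by (simp add: m_def)
  have "1 / (m * t) \<le> exp (1 / (m * t))"
    using exp_ge_add_one_self[of "1 / (m * t)"] by linarith
  then have "(1 / (m * t)) ^ m \<le> exp (1 / (m * t)) ^ m"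
    using True by (intro power_mono) auto
  also have "\<dots> = exp (1 / t)"
    using True m by (simp flip: exp_of_nat_mult)
  finally have "exp (- 1 / t) \<le> (m * t) ^ m"
    using True m by (simp add: exp_minus field_simps power_mult_distrib)
  also have "\<dots> = real (m ^ m) * t ^ 2 * t ^ j"
  proof -
    have "t ^ m = t ^ 2 * t ^ j" by (simp only: m_def power_add mult.commute)
    then show ?thesis by (simp add: power_mult_distrib)
  qed
  finally show ?thesis
    using True by (simp add: exp_tail_def m_def field_simps)
qed (simp add: exp_tail_def)

lemma exp_tail_has_derivative:
  "(exp_tail j has_real_derivative (exp_tail (j + 2) t - j * exp_tail (j + 1) t)) (at t)"
proof -
  consider "t > 0" | "t < 0" | "t = 0" by linarith
  then show ?thesis
  proof cases
    case 1
    have "((\<lambda>t. exp (- 1 / t) / t ^ j) has_real_derivative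
        (exp_tail (j + 2) t - j * exp_tail (j + 1) t)) (at t)"
    proof -
      have "((\<lambda>t. exp (- 1 / t) / t ^ j) has_real_derivative
          (exp (- 1 / t) * (1 / t\<^sup>2) * t ^ j - exp (- 1 / t) * (j * t ^ (j - 1))) / (t ^ j * t ^ j)) (at t)"
        using 1 by (intro DERIV_divide) (auto intro!: derivative_eq_intros simp: power2_eq_square)
      moreover have "real j * t ^ (j - 1) = real j * t ^ j / t"
        using 1 by (cases j) auto
      moreover have "(exp (- 1 / t) * (1 / t\<^sup>2) * t ^ j - exp (- 1 / t) * (j * t ^ j / t)) / (t ^ j * t ^ j) =
          exp_tail (j + 2) t - j * exp_tail (j + 1) t"
        using 1 by (simp add: exp_tail_def field_simps power2_eq_square)
      ultimately show ?thesis by simp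
    qed
    then show ?thesis
      by (rule has_field_derivative_transform_within_open[of _ _ _ "{0<..}"])
        (use 1 in \<open>auto simp: exp_tail_def\<close>)
  next
    case 2
    have "((\<lambda>t. 0) has_real_derivative 0) (at t)" by simp
    then have "(exp_tail j has_real_derivative 0) (at t)"
      by (rule has_field_derivative_transform_within_open[of _ _ _ "{..<0}"])
        (use 2 in \<open>auto simp: exp_tail_def\<close>)
    then show ?thesis using 2 by (simp add: exp_tail_def)
  next
    case 3
    have "((\<lambda>h. exp_tail j h / h) \<longlongrightarrow> 0) (at 0)"
    proof (rule Lim_null_comparison)
      show "\<forall>\<^sub>F h in at 0. norm (exp_tail j h / h) \<le> real ((j + 2) ^ (j + 2)) * \<bar>h\<bar>"
      proof (intro always_eventually allI)
        fix h show "norm (exp_tail j h / h) \<le> real ((j + 2) ^ (j + 2)) * \<bar>h\<bar>"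
        proof (cases "h = 0")
          case False
          have "norm (exp_tail j h / h) = exp_tail j h / \<bar>h\<bar>"
            by (simp add: exp_tail_nonneg)
          also have "\<dots> \<le> real ((j + 2) ^ (j + 2)) * \<bar>h\<bar>\<^sup>2 / \<bar>h\<bar>"
            using exp_tail_le[of j h] by (intro divide_right_mono) (simp_all only: power2_abs abs_ge_zero)
          also have "\<dots> = real ((j + 2) ^ (j + 2)) * \<bar>h\<bar>"
          proof -
            have "c * \<bar>h\<bar>\<^sup>2 / \<bar>h\<bar> = c * \<bar>h\<bar>" for c
              using False by (cases "h > 0") (auto simp: power2_eq_square)
            then show ?thesis .
          qed
          finally show ?thesis .
        qed simp
      qed
      show "((\<lambda>h. real ((j + 2) ^ (j + 2)) * \<bar>h\<bar>) \<longlongrightarrow> 0) (at 0)"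
        by (auto intro!: tendsto_eq_intros)
    qed
    then show ?thesis using 3 by (simp add: DERIV_def exp_tail_def)
  qed
qed

lemma times_cont_diff_exp_tail:
  assumes "smooth f" shows "times_cont_diff k (\<lambda>x. exp_tail j (f x))"
proof (induction k arbitrary: j)
  case 0
  have "continuous_on UNIV (exp_tail j)"
    by (auto intro!: continuous_at_imp_continuous_on DERIV_isCont[OF exp_tail_has_derivative])
  then show ?case
    using continuous_on_compose2[OF _ smooth_continuous_on[OF assms, of UNIV]] by auto
next
  case (Suc k)
  show ?case
  proof (rule times_cont_diff_SucI)
    show "((\<lambda>x. exp_tail j (f x)) has_derivative
        (\<lambda>v. (exp_tail (j + 2) (f x) + (- real j) * exp_tail (j + 1) (f x))
          * frechet_derivative f (at x) v)) (at x)" for x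
    proof -
      have "(f has_derivative frechet_derivative f (at x)) (at x)"
        using assms times_cont_diff_has_derivative unfolding smooth_def by blast
      from has_derivative_compose[OF this
          exp_tail_has_derivative[of j "f x", unfolded has_field_derivative_def]]
      show ?thesis by simp
    qed
    show "times_cont_diff k (\<lambda>x. (exp_tail (j + 2) (f x) + (- real j) * exp_tail (j + 1) (f x))
          * frechet_derivative f (at x) v)" for v
      using smooth_frechet_derivative[OF assms, of v]
      by (intro times_cont_diff_mult times_cont_diff_add times_cont_diff_const Suc.IH)
        (simp add: smooth_def)
  qed
qed

text \<open>For r > 0 the argument of \<open>exp_tail\<close> is positive exactly on the ball of
  radius \<open>2 * r\<close> and at least 3 on the ball of radius \<open>r\<close>; the resulting
  lower bound exp(-1/3) reappears in \<open>energy_const\<close>.\<close>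

definition bump :: "real^'n \<Rightarrow> real \<Rightarrow> real^'n \<Rightarrow> real" where
  "bump a r x = exp_tail 0 (4 - (norm (x - a) / r)\<^sup>2)"

lemma smooth_bump: "smooth (bump a r)"
proof -
  have *: "smooth (\<lambda>x::real^'n. x \<bullet> x)"
  proof (rule smoothI)
    show "((\<lambda>x. x \<bullet> x) has_derivative (\<lambda>v. 2 * (x \<bullet> v))) (at x)" for x :: "real^'n"
      by (auto intro!: derivative_eq_intros simp: inner_commute)
    show "smooth (\<lambda>x::real^'n. 2 * (x \<bullet> v))" for v
      by (intro smooth_mult smooth_const smooth_bounded_linear bounded_linear_inner_left)
  qed
  have "smooth (\<lambda>x. 4 + (-1) * ((- (1/r) *\<^sub>R a + (1/r) *\<^sub>R x) \<bullet> (- (1/r) *\<^sub>R a + (1/r) *\<^sub>R x)))"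
    using smooth_affine_compose[OF *] by (intro smooth_add smooth_const smooth_mult) 
  then have "smooth (\<lambda>x. 4 - (norm (x - a) / r)\<^sup>2)"
  proof (rule back_subst[of smooth], intro ext)
    fix x
    have "(- (1/r) *\<^sub>R a + (1/r) *\<^sub>R x) = (1/r) *\<^sub>R (x - a)"
      by (simp add: algebra_simps)
    then show "4 + (-1) * ((- (1/r) *\<^sub>R a + (1/r) *\<^sub>R x) \<bullet> (- (1/r) *\<^sub>R a + (1/r) *\<^sub>R x)) =
        4 - (norm (x - a) / r)\<^sup>2"
      by (simp add: power_divide dot_square_norm power2_eq_square)
  qed
  then show ?thesis
    unfolding bump_def smooth_def[of "\<lambda>x. exp_tail _ _"] using times_cont_diff_exp_tail
    by (simp add: smooth_def bump_def[abs_def] times_cont_diff_exp_tail)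
qed

lemma grad_bump:
  "grad (bump a r) x = (- 2 * exp_tail 2 (4 - (norm (x - a) / r)\<^sup>2) / r\<^sup>2) *\<^sub>R (x - a)"
proof (rule grad_eqI)
  have *: "((\<lambda>x. 4 - (norm (x - a) / r)\<^sup>2) has_derivative (\<lambda>v. - 2 / r\<^sup>2 * ((x - a) \<bullet> v))) (at x)"
  proof -
    have "((\<lambda>x. 4 - inverse (r\<^sup>2) * ((x - a) \<bullet> (x - a))) has_derivative
        (\<lambda>v. - 2 / r\<^sup>2 * ((x - a) \<bullet> v))) (at x)"
      by (auto intro!: derivative_eq_intros simp: inner_commute divide_inverse)
    then show ?thesis
      by (simp add: power_divide power2_norm_eq_inner divide_inverse mult.commute power_mult_distrib
          power_inverse)
  qed
  \<comment> \<open>In index 0 the term with the factor \<open>j\<close> drops out, so only index 2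
    survives.\<close>
  have "(exp_tail 0 has_derivative (\<lambda>h. exp_tail 2 y * h)) (at y)" for y
    using exp_tail_has_derivative[of 0 y] by (simp add: has_field_derivative_def numeral_2_eq_2)
  from has_derivative_compose[OF * this]
  show "(bump a r has_derivative
      (\<lambda>v. ((- 2 * exp_tail 2 (4 - (norm (x - a) / r)\<^sup>2) / r\<^sup>2) *\<^sub>R (x - a)) \<bullet> v)) (at x)"
    by (simp add: bump_def[abs_def] mult_ac)
qed

lemma bump_nonneg: "bump a r x \<ge> 0"
  by (simp add: bump_def exp_tail_nonneg)

lemma bump_le_1: "bump a r x \<le> 1"
  by (simp add: bump_def exp_tail_def)

lemma bump_eq_0: "r > 0 \<Longrightarrow> 2 * r \<le> norm (x - a) \<Longrightarrow> bump a r x = 0"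
proof -
  assume "r > 0" "2 * r \<le> norm (x - a)"
  then have "2 \<le> norm (x - a) / r" by (simp add: field_simps)
  then have "2\<^sup>2 \<le> (norm (x - a) / r)\<^sup>2" by (intro power_mono) auto
  then show ?thesis by (simp add: bump_def exp_tail_def)
qed

text \<open>\<open>s\<close> is left free: \<open>s = 1\<close> serves the energy estimate, while
  values close to 2 are required for competitors of condensers with nearly equal radii.\<close>

lemma bump_ge:
  assumes "r > 0" "norm (x - a) \<le> s * r" "0 \<le> s" "s < 2"
  shows "exp (- 1 / (4 - s\<^sup>2)) \<le> bump a r x"
proof -
  have "(norm (x - a) / r)\<^sup>2 \<le> s\<^sup>2"
    using assms by (intro power_mono) (auto simp: field_simps)
  moreover have "s\<^sup>2 < 2\<^sup>2" using assms by (intro power_strict_mono) auto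
  ultimately have *: "0 < 4 - s\<^sup>2" "4 - s\<^sup>2 \<le> 4 - (norm (x - a) / r)\<^sup>2" by auto
  then have "1 / (4 - (norm (x - a) / r)\<^sup>2) \<le> 1 / (4 - s\<^sup>2)" by (intro divide_left_mono) auto
  with * show ?thesis by (simp add: bump_def exp_tail_def)
qed

lemma bump_in_test_functions:
  assumes "r > 0" "cball a (2 * r) \<subseteq> S"
  shows "bump a r \<in> test_functions S"
proof (rule test_functionsI[OF smooth_bump _ compact_cball assms(2)])
  show "{x. bump a r x \<noteq> 0} \<subseteq> cball a (2 * r)"
    using bump_eq_0[OF assms(1)] by (force simp: dist_norm norm_minus_commute)
qed

text \<open>A fraction 1/p of the exponent of exp(-1/t) pays for the factor 1/t^2: with s = 1/(p t),
  the bound s^2 \<le> 2 exp s gives 1/t^2 \<le> 2 p^2 exp(1/(p t)). What remains is exp(-1/t) to the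
  power (p - 1)/p.\<close>

lemma exp_tail_2_le:
  assumes "p > 1" "t > 0"
  shows "exp_tail 2 t \<le> 2 * p\<^sup>2 * exp_tail 0 t powr ((p - 1) / p)"
proof -
  have "1 + 1 / (p * t) + (1 / (p * t))\<^sup>2 / 2 \<le> exp (1 / (p * t))"
    by (rule exp_lower_Taylor_quadratic) (use assms in auto)
  moreover have "1 / (p * t) > 0" using assms by simp
  ultimately have "(1 / (p * t))\<^sup>2 \<le> 2 * exp (1 / (p * t))"
    by linarith
  then have "1 / t\<^sup>2 \<le> 2 * p\<^sup>2 * exp (1 / (p * t))"
    using assms by (simp add: field_simps power_mult_distrib)
  then have "exp (- 1 / t) * (1 / t\<^sup>2) \<le> exp (- 1 / t) * (2 * p\<^sup>2 * exp (1 / (p * t)))"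
    by (rule mult_left_mono) simp
  also have "\<dots> = 2 * p\<^sup>2 * exp ((p - 1) / p * (- 1 / t))"
  proof -
    have "- 1 / t + 1 / (p * t) = (p - 1) / p * (- 1 / t)"
      using assms by (simp add: field_simps)
    then show ?thesis by (simp flip: exp_add)
  qed
  finally show ?thesis
    using assms by (simp add: exp_tail_def powr_def)
qed

text \<open>
  The exponent \<open>(p - 1) / p\<close> is what allows Young's inequality to absorb the gradient of the cutoff
  function in the energy estimate.
\<close>

lemma norm_grad_bump_le:
  assumes "p > 1" "r > 0"
  shows "norm (grad (bump a r) x) \<le> 8 * p\<^sup>2 / r * bump a r x powr ((p - 1) / p)"
proof (cases "norm (x - a) < 2 * r")
  case True
  then have "norm (x - a) / r < 2" using assms by (simp add: field_simps)
  then have "(norm (x - a) / r)\<^sup>2 < 2\<^sup>2" by (intro power_strict_mono) (use assms in auto)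
  then have "4 - (norm (x - a) / r)\<^sup>2 > 0" by simp
  from exp_tail_2_le[OF assms(1) this]
  have 1: "exp_tail 2 (4 - (norm (x - a) / r)\<^sup>2) \<le> 2 * p\<^sup>2 * bump a r x powr ((p - 1) / p)"
    by (simp add: bump_def)
  have "norm (grad (bump a r) x) = 2 / r\<^sup>2 * norm (x - a) * exp_tail 2 (4 - (norm (x - a) / r)\<^sup>2)"
    using assms exp_tail_nonneg[of 2] by (simp add: grad_bump abs_mult)
  also have "\<dots> \<le> 2 / r\<^sup>2 * (2 * r) * (2 * p\<^sup>2 * bump a r x powr ((p - 1) / p))"
    using True 1 assms by (intro mult_mono) (auto simp: exp_tail_nonneg)
  also have "\<dots> = 8 * p\<^sup>2 / r * bump a r x powr ((p - 1) / p)"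
    using assms by (simp add: power2_eq_square)
  finally show ?thesis .
next
  case False
  then have "2 \<le> norm (x - a) / r" using assms by (simp add: field_simps)
  then have "2\<^sup>2 \<le> (norm (x - a) / r)\<^sup>2" by (intro power_mono) auto
  then have "grad (bump a r) x = 0"
    by (simp add: grad_bump exp_tail_def)
  then show ?thesis using assms by simp
qed

section \<open>Integration\<close>

lemma nn_integral_lborel_affine:
  fixes f :: "'a::euclidean_space \<Rightarrow> ennreal"
  assumes [measurable]: "f \<in> borel_measurable borel" and "c \<noteq> 0"
  shows "(\<integral>\<^sup>+x. f x \<partial>lborel) = ennreal (\<bar>c\<bar> ^ DIM('a)) * (\<integral>\<^sup>+x. f (t + c *\<^sub>R x) \<partial>lborel)"
  by (subst lborel_affine[OF \<open>c \<noteq> 0\<close>, of t])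
    (simp add: nn_integral_density nn_integral_distr nn_integral_cmult)

lemma integral_lborel_affine:
  fixes f :: "'a::euclidean_space \<Rightarrow> 'b::{banach, second_countable_topology}"
  assumes [measurable]: "f \<in> borel_measurable borel" and "c \<noteq> 0"
  shows "(\<integral>x. f x \<partial>lborel) = \<bar>c\<bar> ^ DIM('a) *\<^sub>R (\<integral>x. f (t + c *\<^sub>R x) \<partial>lborel)"
  by (subst lborel_affine[OF \<open>c \<noteq> 0\<close>, of t])
    (simp add: integral_density integral_distr)

lemma integral_lborel_reflect:
  fixes f :: "'a::euclidean_space \<Rightarrow> 'b::{banach, second_countable_topology}"
  assumes "f \<in> borel_measurable borel"
  shows "(\<integral>y. f (x - y) \<partial>lborel) = (\<integral>y. f y \<partial>lborel)"
  using integral_lborel_affine[OF assms, of "-1" x] by simp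

lemma integrable_continuous_vanishing:
  fixes g :: "'a::euclidean_space \<Rightarrow> 'b::euclidean_space"
  assumes "continuous_on UNIV g" "\<And>z. norm z > r \<Longrightarrow> g z = 0"
  shows "integrable lborel g"
proof -
  have "integrable lborel (\<lambda>x. indicator (cball 0 r) x *\<^sub>R g x)"
    by (rule borel_integrable_compact) (auto intro: continuous_on_subset[OF assms(1)])
  also have "(\<lambda>x. indicator (cball 0 r) x *\<^sub>R g x) = g"
    using assms(2) by (auto simp: indicator_def fun_eq_iff not_le)
  finally show ?thesis .
qed

lemma continuous_vanishing_bounded:
  fixes g :: "'a::euclidean_space \<Rightarrow> 'b::euclidean_space"
  assumes "continuous_on UNIV g" "\<And>z. norm z > r \<Longrightarrow> g z = 0"
  obtains B where "B > 0" "\<And>z. norm (g z) \<le> B"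
proof -
  have "compact (g ` cball 0 r)"
    using assms(1) continuous_on_subset by (intro compact_continuous_image) auto
  then obtain B where B: "B > 0" "\<forall>y\<in>g ` cball 0 r. norm y \<le> B"
    using compact_imp_bounded bounded_pos by blast
  have "norm (g z) \<le> B" for z
    by (cases "norm z \<le> r") (use B assms(2) in auto)
  with B(1) show thesis by (rule that)
qed

text \<open>Two points at distance below 1 either both lie in the ball of radius
  \<open>r + 1\<close>, where compactness applies, or both lie outside radius \<open>r\<close>,
  where \<open>g\<close> vanishes.\<close>

lemma continuous_vanishing_uniformly_continuous:
  fixes g :: "'a::euclidean_space \<Rightarrow> 'b::euclidean_space"
  assumes "continuous_on UNIV g" "\<And>z. norm z > r \<Longrightarrow> g z = 0"
  shows "uniformly_continuous_on UNIV g"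
  unfolding uniformly_continuous_on_def
proof (intro allI impI)
  fix e :: real assume "e > 0"
  have "uniformly_continuous_on (cball 0 (r + 1)) g"
    using assms(1) continuous_on_subset by (intro compact_uniformly_continuous) auto
  then obtain d where d: "d > 0" "\<And>x y. x \<in> cball 0 (r + 1) \<Longrightarrow> y \<in> cball 0 (r + 1) \<Longrightarrow>
      dist y x < d \<Longrightarrow> dist (g y) (g x) < e"
    using \<open>e > 0\<close> unfolding uniformly_continuous_on_def by metis
  have "dist (g y) (g x) < e" if "dist y x < min d 1" for x y
  proof (cases "norm x \<le> r \<or> norm y \<le> r")
    case True
    have "\<bar>norm x - norm y\<bar> < 1"
      using that norm_triangle_ineq3[of x y] by (simp add: dist_norm norm_minus_commute)
    with True d(2)[of x y] that show ?thesis by auto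
  next
    case False
    then show ?thesis using assms(2) \<open>e > 0\<close> by auto
  qed
  then show "\<exists>d>0. \<forall>x\<in>UNIV. \<forall>x'\<in>UNIV. dist x' x < d \<longrightarrow> dist (g x') (g x) < e"
    using d(1) by (intro exI[of _ "min d 1"]) auto
qed

lemma grad_vanishing:
  assumes "\<And>z. norm z > r \<Longrightarrow> f z = 0" "norm z > r"
  shows "grad f z = 0"
proof (rule grad_eq_0_outside)
  show "open {z::real^'n. norm z > r}"
    by (intro open_Collect_less continuous_intros)
qed (use assms in auto)

section \<open>Convolution\<close>

text \<open>Values of \<open>f\<close> may be vectors, so that a function and its weak gradient are
  averaged by one operator. The smooth kernel is the first argument; all derivatives will fall on
  it.\<close>

definition conv :: "(real^'n \<Rightarrow> real) \<Rightarrow> (real^'n \<Rightarrow> 'b::euclidean_space) \<Rightarrow> real^'n \<Rightarrow> 'b" where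
  "conv \<phi> f x = (\<integral>y. \<phi> (x - y) *\<^sub>R f y \<partial>lborel)"

lemma integrable_scaleR_bounded:
  fixes f :: "'a \<Rightarrow> 'b::euclidean_space"
  assumes "integrable M f" "k \<in> borel_measurable M" "\<And>x. \<bar>k x\<bar> \<le> B"
  shows "integrable M (\<lambda>x. k x *\<^sub>R f x)"
proof (rule Bochner_Integration.integrable_bound)
  show "integrable M (\<lambda>x. B * norm (f x))" using assms(1) by simp
  have "B \<ge> 0" using assms(3) abs_ge_zero order_trans by metis
  then show "AE x in M. norm (k x *\<^sub>R f x) \<le> norm (B * norm (f x))"
    using assms(3) by (auto intro!: mult_right_mono)
qed (use assms in auto)

lemma integrable_conv_kernel:
  fixes f :: "real^'n \<Rightarrow> 'b::euclidean_space"
  assumes "integrable lborel f" "continuous_on UNIV \<phi>" "\<And>z. norm z > r \<Longrightarrow> \<phi> z = 0"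
  shows "integrable lborel (\<lambda>y. \<phi> (x - y) *\<^sub>R f y)"
proof -
  obtain B where "\<And>z. norm (\<phi> z) \<le> B"
    using continuous_vanishing_bounded[OF assms(2,3)] by blast
  moreover have "\<phi> \<in> borel_measurable borel"
    using assms(2) by (rule borel_measurable_continuous_onI)
  ultimately show ?thesis
    using assms(1) by (intro integrable_scaleR_bounded[of _ _ _ B]) auto
qed

text \<open>\<open>f\<close> is merely integrable, so the kernel has to be differentiated. Uniform
  continuity of \<open>grad \<phi>\<close> makes the first order remainder of \<open>\<phi>\<close>
  at most \<open>e' * norm h\<close> at all base points simultaneously, and this bound is integrated
  against the absolute value of \<open>f\<close>.\<close>

lemma conv_has_derivative:
  fixes f :: "real^'n \<Rightarrow> real"
  assumes f: "integrable lborel f" and \<phi>: "smooth \<phi>" "\<And>z. norm z > r \<Longrightarrow> \<phi> z = 0"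
  shows "(conv \<phi> f has_derivative (\<lambda>v. conv (\<lambda>z. grad \<phi> z \<bullet> v) f x)) (at x)"
proof -
  have gv: "grad \<phi> z = 0" if "norm z > r" for z
    using grad_vanishing[of r \<phi> z] \<phi>(2) that by blast
  note cg = smooth_continuous_on_grad[OF \<phi>(1), of UNIV]
  have int_g: "integrable lborel (\<lambda>y. (grad \<phi> (x - y) \<bullet> v) *\<^sub>R f y)" for v
    by (rule integrable_conv_kernel[OF f, of "\<lambda>z. grad \<phi> z \<bullet> v" r])
      (auto intro!: continuous_intros cg simp: gv)
  have int_\<phi>: "integrable lborel (\<lambda>y. \<phi> (z - y) *\<^sub>R f y)" for z
    by (rule integrable_conv_kernel[OF f smooth_continuous_on[OF \<phi>(1)] \<phi>(2)])
  obtain B where B: "B > 0" "\<And>z. norm (grad \<phi> z) \<le> B"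
    using continuous_vanishing_bounded[OF cg gv] by blast
  define J where "J = (\<integral>y. \<bar>f y\<bar> \<partial>lborel)"
  have J: "J \<ge> 0" by (simp add: J_def)
  show ?thesis
    unfolding has_derivative_at_alt
  proof (intro conjI allI impI)
    show "bounded_linear (\<lambda>v. conv (\<lambda>z. grad \<phi> z \<bullet> v) f x)"
    proof (rule bounded_linear_intro)
      show "conv (\<lambda>z. grad \<phi> z \<bullet> (v + w)) f x =
          conv (\<lambda>z. grad \<phi> z \<bullet> v) f x + conv (\<lambda>z. grad \<phi> z \<bullet> w) f x" for v w
        unfolding conv_def using int_g
        by (subst Bochner_Integration.integral_add[symmetric]) (auto simp: algebra_simps)
      show "conv (\<lambda>z. grad \<phi> z \<bullet> (c *\<^sub>R v)) f x = c *\<^sub>R conv (\<lambda>z. grad \<phi> z \<bullet> v) f x" for c v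
        unfolding conv_def by (subst integral_scaleR_right[symmetric]) (auto simp: algebra_simps)
      show "norm (conv (\<lambda>z. grad \<phi> z \<bullet> v) f x) \<le> norm v * (B * J)" for v
      proof -
        have "norm (conv (\<lambda>z. grad \<phi> z \<bullet> v) f x) \<le> (\<integral>y. B * norm v * \<bar>f y\<bar> \<partial>lborel)"
          unfolding conv_def
        proof (rule Bochner_Integration.integral_norm_bound_integral)
          show "norm ((grad \<phi> (x - y) \<bullet> v) *\<^sub>R f y) \<le> B * norm v * \<bar>f y\<bar>" for y
            using order_trans[OF Cauchy_Schwarz_ineq2 mult_right_mono[OF B(2) norm_ge_zero]]
            by (simp only: real_scaleR_def real_norm_def abs_mult) (intro mult_right_mono, auto)
        qed (use f int_g in auto)
        then show ?thesis by (simp add: J_def mult_ac)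
      qed
    qed
    fix e :: real assume "e > 0"
    \<comment> \<open>\<open>J\<close> is the L^1 norm of \<open>f\<close>; the added 1 covers the
      case J = 0.\<close>
    define e' where "e' = e / (J + 1)"
    have e': "e' > 0" "e' * J \<le> e" using J \<open>e > 0\<close> by (auto simp: e'_def field_simps)
    obtain d where d: "d > 0" "\<And>a b. dist b a < d \<Longrightarrow> dist (grad \<phi> b) (grad \<phi> a) < e'"
      using continuous_vanishing_uniformly_continuous[OF cg gv] \<open>e' > 0\<close>
      unfolding uniformly_continuous_on_def by (metis UNIV_I)
    \<comment> \<open>Mean value inequality for \<open>\<phi>\<close> minus its linear part at
      \<open>a\<close>, whose gradient is bounded by \<open>e'\<close> on the ball of radius
      \<open>d\<close>.\<close>
    have key: "\<bar>\<phi> (a + h) - \<phi> a - grad \<phi> a \<bullet> h\<bar> \<le> e' * norm h" if "norm h < d" for a h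
    proof -
      have "norm ((\<phi> (a + h) - grad \<phi> a \<bullet> (a + h)) - (\<phi> a - grad \<phi> a \<bullet> a)) \<le> e' * norm ((a + h) - a)"
      proof (rule differentiable_bound[where S = "ball a d" and f = "\<lambda>z. \<phi> z - grad \<phi> a \<bullet> z"
            and f' = "\<lambda>z v. (grad \<phi> z - grad \<phi> a) \<bullet> v"])
        show "((\<lambda>z. \<phi> z - grad \<phi> a \<bullet> z) has_derivative (\<lambda>v. (grad \<phi> z - grad \<phi> a) \<bullet> v))
            (at z within ball a d)" for z
          by (auto intro!: derivative_eq_intros has_derivative_at_withinI[OF smooth_has_derivative[OF \<phi>(1)]]
              simp: algebra_simps)
        show "onorm (\<lambda>v. (grad \<phi> z - grad \<phi> a) \<bullet> v) \<le> e'" if "z \<in> ball a d" for z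
        proof (rule onorm_le)
          fix v
          have "norm (grad \<phi> z - grad \<phi> a) \<le> e'"
            using d(2)[of z a] that by (simp add: dist_commute[of z a]) (simp add: dist_norm)
          then show "norm ((grad \<phi> z - grad \<phi> a) \<bullet> v) \<le> e' * norm v"
            using order_trans[OF Cauchy_Schwarz_ineq2 mult_right_mono[OF _ norm_ge_zero]] by fastforce
        qed
        show "a + h \<in> ball a d" "a \<in> ball a d" using that d(1) by (auto simp: dist_norm)
      qed auto
      then show ?thesis by (simp add: algebra_simps)
    qed
    show "\<exists>d>0. \<forall>y. norm (y - x) < d \<longrightarrow>
        norm (conv \<phi> f y - conv \<phi> f x - conv (\<lambda>z. grad \<phi> z \<bullet> (y - x)) f x) \<le> e * norm (y - x)"
    proof (intro exI[of _ d] conjI allI impI)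
      fix y assume y: "norm (y - x) < d"
      have "conv \<phi> f y - conv \<phi> f x - conv (\<lambda>z. grad \<phi> z \<bullet> (y - x)) f x =
          (\<integral>z. (\<phi> (y - z) *\<^sub>R f z - \<phi> (x - z) *\<^sub>R f z) - (grad \<phi> (x - z) \<bullet> (y - x)) *\<^sub>R f z \<partial>lborel)"
        unfolding conv_def using int_\<phi> int_g
        by (subst Bochner_Integration.integral_diff) auto
      also have "norm \<dots> \<le> (\<integral>z. e' * norm (y - x) * \<bar>f z\<bar> \<partial>lborel)"
      proof (rule Bochner_Integration.integral_norm_bound_integral)
        fix z
        have "\<bar>\<phi> (y - z) - \<phi> (x - z) - grad \<phi> (x - z) \<bullet> (y - x)\<bar> * \<bar>f z\<bar> \<le> e' * norm (y - x) * \<bar>f z\<bar>"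
          using key[OF y, of "x - z"] by (intro mult_right_mono) (auto simp: algebra_simps)
        then show "norm (\<phi> (y - z) *\<^sub>R f z - \<phi> (x - z) *\<^sub>R f z - (grad \<phi> (x - z) \<bullet> (y - x)) *\<^sub>R f z)
            \<le> e' * norm (y - x) * \<bar>f z\<bar>"
          by (simp add: algebra_simps flip: abs_mult)
      qed (use f int_g int_\<phi> in auto)
      also have "\<dots> = e' * J * norm (y - x)" by (simp add: J_def)
      also have "\<dots> \<le> e * norm (y - x)" using e'(2) by (rule mult_right_mono) simp
      finally show "norm (conv \<phi> f y - conv \<phi> f x - conv (\<lambda>z. grad \<phi> z \<bullet> (y - x)) f x) \<le> e * norm (y - x)" .
    qed (rule d(1))
  qed
qed

lemma smooth_grad_inner: "smooth f \<Longrightarrow> smooth (\<lambda>x. grad f x \<bullet> v)"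
proof -
  assume f: "smooth f"
  have "grad f x \<bullet> v = frechet_derivative f (at x) v" for x
    using smooth_has_derivative[OF f] frechet_derivative_at by metis
  then show ?thesis using smooth_frechet_derivative[OF f] by simp
qed

text \<open>The derivative of a convolution is the convolution with a differentiated kernel of the
  same support radius, so the induction runs over all kernels with \<open>f\<close> fixed.\<close>

lemma smooth_conv:
  fixes f :: "real^'n \<Rightarrow> real"
  assumes f: "integrable lborel f" and \<phi>: "smooth \<phi>" "\<And>z. norm z > r \<Longrightarrow> \<phi> z = 0"
  shows "smooth (conv \<phi> f)"
proof -
  have "times_cont_diff k (conv \<phi> f)" if "smooth \<phi>" "\<And>z. norm z > r \<Longrightarrow> \<phi> z = 0" for k \<phi>
    using that
  proof (induction k arbitrary: \<phi>)
    case 0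
    have "continuous_on UNIV (conv \<phi> f)"
      by (auto intro!: continuous_at_imp_continuous_on has_derivative_continuous[OF conv_has_derivative[OF f 0]])
    then show ?case by simp
  next
    case (Suc k)
    show ?case
    proof (rule times_cont_diff_SucI[OF conv_has_derivative[OF f Suc.prems]])
      show "times_cont_diff k (\<lambda>x. conv (\<lambda>z. grad \<phi> z \<bullet> v) f x)" for v
        using Suc.IH[OF smooth_grad_inner[OF Suc.prems(1)]] grad_vanishing[of r \<phi>] Suc.prems(2) by simp
    qed
  qed
  then show ?thesis using \<phi> by (simp add: smooth_def)
qed

lemma grad_conv:
  fixes f :: "real^'n \<Rightarrow> real"
  assumes f: "integrable lborel f" and \<phi>: "smooth \<phi>" "\<And>z. norm z > r \<Longrightarrow> \<phi> z = 0"
  shows "grad (conv \<phi> f) x = (\<integral>y. f y *\<^sub>R grad \<phi> (x - y) \<partial>lborel)"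
proof (rule grad_eqI)
  have gv: "grad \<phi> z = 0" if "norm z > r" for z
    using grad_vanishing[of r \<phi> z] \<phi>(2) that by blast
  note cg = smooth_continuous_on_grad[OF \<phi>(1), of UNIV]
  obtain B where B: "B > 0" "\<And>z. norm (grad \<phi> z) \<le> B"
    using continuous_vanishing_bounded[OF cg gv] by blast
  have "integrable lborel (\<lambda>y. f y *\<^sub>R grad \<phi> (x - y))"
  proof (rule Bochner_Integration.integrable_bound)
    show "integrable lborel (\<lambda>y. B * \<bar>f y\<bar>)" using f by simp
    have "grad \<phi> \<in> borel_measurable borel" using cg by (rule borel_measurable_continuous_onI)
    then show "(\<lambda>y. f y *\<^sub>R grad \<phi> (x - y)) \<in> borel_measurable lborel" using f by auto
    show "AE y in lborel. norm (f y *\<^sub>R grad \<phi> (x - y)) \<le> norm (B * \<bar>f y\<bar>)"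
    proof (intro always_eventually allI)
      fix y
      have "norm (f y *\<^sub>R grad \<phi> (x - y)) \<le> \<bar>f y\<bar> * B"
        using B(2) by (simp add: mult_left_mono)
      then show "norm (f y *\<^sub>R grad \<phi> (x - y)) \<le> norm (B * \<bar>f y\<bar>)"
        using B(1) by (simp add: abs_mult mult.commute)
    qed
  qed
  then have "conv (\<lambda>z. grad \<phi> z \<bullet> v) f x = (\<integral>y. f y *\<^sub>R grad \<phi> (x - y) \<partial>lborel) \<bullet> v" for v
    unfolding conv_def by (subst integral_inner_left[symmetric]) (auto simp: mult.commute)
  then show "(conv \<phi> f has_derivative (\<lambda>v. (\<integral>y. f y *\<^sub>R grad \<phi> (x - y) \<partial>lborel) \<bullet> v)) (at x)"
    using conv_has_derivative[of f \<phi> r x] assms by simp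
qed

text \<open>
  The convolution of \<open>\<phi>\<close> with the indicator of a large ball is constant near \<open>0\<close>, and its gradient
  at \<open>0\<close> is the integral of the gradient of \<open>\<phi>\<close>.
\<close>

lemma integral_grad_eq_0:
  fixes \<phi> :: "real^'n \<Rightarrow> real"
  assumes \<phi>: "smooth \<phi>" "\<And>z. norm z > r \<Longrightarrow> \<phi> z = 0"
  shows "(\<integral>x. grad \<phi> x \<partial>lborel) = 0"
proof -
  define f :: "real^'n \<Rightarrow> real" where "f = indicator (cball 0 (\<bar>r\<bar> + 1))"
  have f: "integrable lborel f"
    unfolding f_def by (intro integrable_real_indicator emeasure_lborel_cball_finite) auto
  have gv: "grad \<phi> z = 0" if "norm z > r" for z
    using grad_vanishing[of r \<phi> z] \<phi>(2) that by blast
  have bm: "\<phi> \<in> borel_measurable borel" "grad \<phi> \<in> borel_measurable borel"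
    using \<phi>(1) smooth_continuous_on smooth_continuous_on_grad
    by (auto intro!: borel_measurable_continuous_onI)
  have "conv \<phi> f x = (\<integral>y. \<phi> y \<partial>lborel)" if "norm x < 1" for x
  proof -
    have "conv \<phi> f x = (\<integral>y. \<phi> (x - y) \<partial>lborel)"
      unfolding conv_def
    proof (rule Bochner_Integration.integral_cong[OF refl])
      fix y show "\<phi> (x - y) *\<^sub>R f y = \<phi> (x - y)"
      proof (cases "norm y \<le> \<bar>r\<bar> + 1")
        case False
        have "norm (x - y) \<ge> norm y - norm x" by (metis norm_minus_commute norm_triangle_ineq2)
        with False that have "norm (x - y) > r" by linarith
        then show ?thesis using \<phi>(2) by simp
      qed (simp add: f_def)
    qed
    then show ?thesis using integral_lborel_reflect[OF bm(1)] by metis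
  qed
  then have "grad (\<lambda>x. conv \<phi> f x - (\<integral>y. \<phi> y \<partial>lborel)) 0 = 0"
    by (intro grad_eq_0_outside[of "ball 0 1"]) auto
  moreover have "grad (\<lambda>x. conv \<phi> f x - (\<integral>y. \<phi> y \<partial>lborel)) 0 = grad (conv \<phi> f) 0"
    using smooth_has_derivative[OF smooth_conv[of f \<phi> r], of 0] f \<phi>
    by (intro grad_eqI) (auto intro!: derivative_eq_intros)
  ultimately have "0 = (\<integral>y. f y *\<^sub>R grad \<phi> (0 - y) \<partial>lborel)"
    using grad_conv[of f \<phi> r 0] f \<phi> by simp
  also have "\<dots> = (\<integral>y. grad \<phi> (0 - y) \<partial>lborel)"
  proof (rule Bochner_Integration.integral_cong[OF refl])
    fix y show "f y *\<^sub>R grad \<phi> (0 - y) = grad \<phi> (0 - y)"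
      by (cases "norm y \<le> \<bar>r\<bar> + 1") (auto simp: f_def gv)
  qed
  also have "\<dots> = (\<integral>y. grad \<phi> y \<partial>lborel)" using integral_lborel_reflect[OF bm(2)] .
  finally show ?thesis by simp
qed

section \<open>Integration by parts against test functions\<close>

lemma grad_mult:
  "smooth f \<Longrightarrow> smooth g \<Longrightarrow> grad (\<lambda>x. f x * g x) x = f x *\<^sub>R grad g x + g x *\<^sub>R grad f x"
  using has_derivative_mult[OF smooth_has_derivative smooth_has_derivative]
  by (intro grad_eqI) (auto simp: algebra_simps)

lemma test_functions_smooth: "\<phi> \<in> test_functions S \<Longrightarrow> smooth \<phi>"
  by (simp add: test_functions_def smooth_def)

lemma test_functions_vanishing:
  assumes "\<phi> \<in> test_functions S"
  obtains r where "r > 0" "\<And>z. norm z > r \<Longrightarrow> \<phi> z = 0"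
proof -
  have "bounded {x. \<phi> x \<noteq> 0}"
    using assms bounded_subset[OF compact_imp_bounded closure_subset]
    by (auto simp: test_functions_def)
  then obtain r where "r > 0" "\<forall>x\<in>{x. \<phi> x \<noteq> 0}. norm x \<le> r" using bounded_pos by metis
  then show thesis using that[of r] leD by blast
qed

lemma test_functions_0_outside:
  assumes "\<phi> \<in> test_functions S" "x \<notin> S"
  shows "\<phi> x = 0" "grad \<phi> x = 0"
proof -
  let ?K = "closure {x. \<phi> x \<noteq> 0}"
  have x: "x \<notin> ?K" using assms by (auto simp: test_functions_def)
  then show "\<phi> x = 0" using closure_subset[of "{x. \<phi> x \<noteq> 0}"] by blast
  show "grad \<phi> x = 0"
  proof (rule grad_eq_0_outside[of "- ?K"])
    fix y assume "y \<in> - ?K"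
    then show "\<phi> y = 0" using closure_subset[of "{x. \<phi> x \<noteq> 0}"] by blast
  qed (use x in auto)
qed

text \<open>The product of \<open>f\<close> and \<open>\<phi>\<close> has bounded support, so its
  gradient integrates to 0. For a test function \<open>f\<close> this says that the classical
  gradient is a weak one.\<close>

lemma integration_by_parts:
  assumes "smooth f" "\<phi> \<in> test_functions S"
  shows "(\<integral>x. f x *\<^sub>R grad \<phi> x \<partial>lborel) = - (\<integral>x. \<phi> x *\<^sub>R grad f x \<partial>lborel)"
proof -
  note \<phi> = test_functions_smooth[OF assms(2)]
  obtain r where r: "\<And>z. norm z > r \<Longrightarrow> \<phi> z = 0"
    using test_functions_vanishing[OF assms(2)] by blast
  note c = smooth_continuous_on[OF assms(1), of UNIV] smooth_continuous_on_grad[OF assms(1), of UNIV]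
    smooth_continuous_on[OF \<phi>, of UNIV] smooth_continuous_on_grad[OF \<phi>, of UNIV]
  have i: "integrable lborel (\<lambda>x. f x *\<^sub>R grad \<phi> x)" "integrable lborel (\<lambda>x. \<phi> x *\<^sub>R grad f x)"
    by (rule integrable_continuous_vanishing[of _ r], intro continuous_on_scaleR c,
        use r grad_vanishing[of r \<phi>] in simp)+
  have "(\<integral>x. grad (\<lambda>x. f x * \<phi> x) x \<partial>lborel) = 0"
    by (rule integral_grad_eq_0[of _ r], rule smooth_mult[OF assms(1) \<phi>]) (simp add: r)
  then have "(\<integral>x. f x *\<^sub>R grad \<phi> x + \<phi> x *\<^sub>R grad f x \<partial>lborel) = 0"
    by (simp add: grad_mult[OF assms(1) \<phi>])
  then have "(\<integral>x. f x *\<^sub>R grad \<phi> x \<partial>lborel) + (\<integral>x. \<phi> x *\<^sub>R grad f x \<partial>lborel) = 0"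
    by (subst (asm) Bochner_Integration.integral_add[OF i])
  then show ?thesis by (rule eq_neg_iff_add_eq_0[THEN iffD2])
qed

section \<open>Mollification\<close>

text \<open>A predicate rather than a rescaled fixed kernel: convergence rests on smoothness, sign,
  unit mass and a shrinking support radius alone, so an independent kernel may be taken for each
  radius.\<close>

definition mollifier :: "real \<Rightarrow> (real^'n \<Rightarrow> real) \<Rightarrow> bool" where
  "mollifier r \<phi> \<longleftrightarrow> smooth \<phi> \<and> (\<forall>z. \<phi> z \<ge> 0) \<and> (\<forall>z. norm z \<ge> r \<longrightarrow> \<phi> z = 0) \<and>
     (\<integral>z. \<phi> z \<partial>lborel) = 1"

lemma mollifierD:
  assumes "mollifier r \<phi>"
  shows "smooth \<phi>" "\<phi> z \<ge> 0" "norm z \<ge> r \<Longrightarrow> \<phi> z = 0" "(\<integral>z. \<phi> z \<partial>lborel) = 1"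
    "continuous_on UNIV \<phi>" "\<phi> \<in> borel_measurable borel" "integrable lborel \<phi>"
proof -
  show *: "smooth \<phi>" "\<phi> z \<ge> 0" "norm z \<ge> r \<Longrightarrow> \<phi> z = 0" "(\<integral>z. \<phi> z \<partial>lborel) = 1" for z
    using assms by (auto simp: mollifier_def)
  show c: "continuous_on UNIV \<phi>" using smooth_continuous_on[OF *(1)] .
  then show "\<phi> \<in> borel_measurable borel" by (rule borel_measurable_continuous_onI)
  show "integrable lborel \<phi>"
    using *(3) by (intro integrable_continuous_vanishing[OF c, of r]) auto
qed

text \<open>A bump of parameter \<open>r / 2\<close> vanishes outside radius \<open>r\<close> and is
  at least exp(-1/3) on the ball of half that radius, so its integral is positive and can be
  normalized.\<close>

lemma mollifier_exists:
  assumes "r > 0" obtains \<phi> :: "real^'n \<Rightarrow> real" where "mollifier r \<phi>"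
proof -
  define b :: "real^'n \<Rightarrow> real" where "b = bump 0 (r / 2)"
  define J where "J = (\<integral>z. b z \<partial>lborel)"
  have b0: "b z = 0" if "norm z \<ge> r" for z
    using bump_eq_0[of "r / 2" z 0] that assms by (simp add: b_def)
  have sb: "smooth b" by (simp add: b_def smooth_bump)
  have ib: "integrable lborel b"
    using b0 by (intro integrable_continuous_vanishing[OF smooth_continuous_on[OF sb], of r]) auto
  have "exp (- 1 / 3) * indicator (ball 0 (r / 2)) z \<le> b z" for z
    using bump_ge[of "r / 2" z 0 1] bump_nonneg[of 0 "r / 2" z] assms
    by (auto simp: b_def indicator_def)
  then have "(\<integral>z. exp (- 1 / 3) * indicator (ball (0::real^'n) (r / 2)) z \<partial>lborel) \<le> J"
    unfolding J_def using ib emeasure_lborel_ball_finite[of "0::real^'n" "r / 2"]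
    by (intro Bochner_Integration.integral_mono integrable_mult_right integrable_real_indicator) auto
  moreover have "(\<integral>z. exp (- 1 / 3) * (indicator (ball (0::real^'n) (r / 2)) z :: real) \<partial>lborel) > 0"
    using assms by simp
  ultimately have J: "J > 0" by linarith
  show thesis
  proof (rule that)
    show "mollifier r (\<lambda>z. (1 / J) * b z)"
      unfolding mollifier_def
    proof (intro conjI allI impI)
      show "smooth (\<lambda>z. 1 / J * b z)" by (intro smooth_mult smooth_const sb)
      show "1 / J * b z \<ge> 0" for z using J by (simp add: b_def bump_nonneg)
      show "(\<integral>z. 1 / J * b z \<partial>lborel) = 1" using J by (simp flip: J_def)
    qed (simp add: b0)
  qed
qed

lemma integrable_mollifier_conv:
  fixes f :: "real^'n \<Rightarrow> 'b::euclidean_space"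
  assumes "integrable lborel f" "mollifier r \<phi>"
  shows "integrable lborel (\<lambda>y. \<phi> (x - y) *\<^sub>R f y)"
  using mollifierD[OF assms(2)]
  by (intro integrable_conv_kernel[OF assms(1), of _ r]) auto

lemma smooth_mollifier_conv:
  assumes "integrable lborel f" "mollifier r \<phi>" shows "smooth (conv \<phi> f)"
  using mollifierD[OF assms(2)] by (intro smooth_conv[OF assms(1), of _ r]) auto

lemma integral_mollifier_reflect:
  assumes "mollifier r \<phi>"
  shows "(\<integral>y. \<phi> (x - y) \<partial>lborel) = 1" "integrable lborel (\<lambda>y. \<phi> (x - y))"
proof -
  show 1: "(\<integral>y. \<phi> (x - y) \<partial>lborel) = 1"
    using integral_lborel_reflect[OF mollifierD(6)[OF assms]] mollifierD(4)[OF assms] by simp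
  \<comment> \<open>A non-integrable function would have Bochner integral 0, not 1.\<close>
  show "integrable lborel (\<lambda>y. \<phi> (x - y))"
    using 1 not_integrable_integral_eq[of lborel "\<lambda>y. \<phi> (x - y)"] by fastforce
qed

text \<open>The convolution at \<open>x\<close> is a weighted mean of the values of \<open>f\<close>
  in \<open>ball x r\<close>, so an almost everywhere bound there becomes a bound at the single
  point \<open>x\<close>.\<close>

lemma conv_ge:
  fixes f :: "real^'n \<Rightarrow> real"
  assumes "integrable lborel f" "mollifier r \<phi>" "AE y in lborel. y \<in> ball x r \<longrightarrow> \<mu> \<le> f y"
  shows "\<mu> \<le> conv \<phi> f x"
proof -
  have "(\<integral>y. \<phi> (x - y) * \<mu> \<partial>lborel) \<le> conv \<phi> f x"
    unfolding conv_def real_scaleR_def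
  proof (rule integral_mono_AE)
    show "AE y in lborel. \<phi> (x - y) * \<mu> \<le> \<phi> (x - y) * f y"
      using assms(3)
    proof eventually_elim
      case (elim y)
      then show ?case
        using mollifierD(2)[OF assms(2), of "x - y"] mollifierD(3)[OF assms(2), of "x - y"]
        by (cases "norm (x - y) < r") (auto simp: dist_norm intro: mult_left_mono)
    qed
  qed (use integrable_mollifier_conv[OF assms(1,2), of x] integral_mollifier_reflect[OF assms(2), of x] in auto)
  then show ?thesis using integral_mollifier_reflect[OF assms(2), of x] by simp
qed

text \<open>The reflected kernel centred at \<open>x\<close> is an admissible test function, and the
  reflection reverses the sign of its gradient, which cancels the minus sign in the definition of
  the weak gradient. The condition on \<open>cball x r\<close> keeps its support inside
  \<open>S\<close>.\<close>

lemma grad_mollifier_conv: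
  fixes V :: "real^'n \<Rightarrow> real" and F :: "real^'n \<Rightarrow> real^'n"
  assumes V: "integrable lborel V" and \<phi>: "mollifier r \<phi>" and x: "cball x r \<subseteq> S"
    and weak: "\<And>\<psi>. \<psi> \<in> test_functions S \<Longrightarrow>
      (\<integral>y. V y *\<^sub>R grad \<psi> y \<partial>lborel) = - (\<integral>y. \<psi> y *\<^sub>R F y \<partial>lborel)"
  shows "grad (conv \<phi> V) x = conv \<phi> F x"
proof -
  note m = mollifierD[OF \<phi>]
  define \<psi> where "\<psi> y = \<phi> (x + (- 1) *\<^sub>R y)" for y
  have "{y. \<psi> y \<noteq> 0} \<subseteq> cball x r"
    using m(3) by (force simp: \<psi>_def dist_norm)
  moreover have "smooth \<psi>" unfolding \<psi>_def by (rule smooth_affine_compose[OF m(1)])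
  ultimately have "\<psi> \<in> test_functions S"
    using x by (intro test_functionsI[of \<psi> "cball x r"]) auto
  moreover have "grad \<psi> y = - grad \<phi> (x - y)" for y
    unfolding \<psi>_def by (subst grad_affine_compose[OF m(1)]) simp
  ultimately have "(\<integral>y. V y *\<^sub>R grad \<phi> (x - y) \<partial>lborel) = (\<integral>y. \<psi> y *\<^sub>R F y \<partial>lborel)"
    using weak[of \<psi>] by simp
  then show ?thesis
    using grad_conv[of V \<phi> r x] V m by (simp add: conv_def \<psi>_def)
qed

text \<open>The graph of t^p lies above its tangent at \<open>c\<close>. With \<open>c\<close> the
  mean for a probability density, integrating this inequality yields Jensen's.\<close>

lemma powr_weighted_le:
  fixes y c p :: real
  assumes "p \<ge> 1" "y \<ge> 0" "c \<ge> 0"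
  shows "c powr (p - 1) * y \<le> (1 / p) * y powr p + (1 - 1 / p) * c powr p"
proof (cases "y = 0 \<or> c = 0")
  case False
  then have "(y powr p) powr (1 / p) * (c powr p) powr (1 - 1 / p)
      \<le> (1 / p) * y powr p + (1 - 1 / p) * c powr p"
    using assms by (intro Youngs_inequality_0) auto
  moreover have "p * (1 - 1 / p) = p - 1" using assms by (simp add: field_simps)
  ultimately show ?thesis using assms False by (simp add: powr_powr mult.commute)
qed (use assms in auto)

text \<open>This is Jensen's inequality for the probability density \<open>\<phi> (x - \<cdot>)\<close>.\<close>

lemma powr_norm_conv_le:
  fixes f :: "real^'n \<Rightarrow> 'b::euclidean_space"
  assumes p: "p \<ge> 1" and f: "integrable lborel f" and \<phi>: "mollifier r \<phi>"
  shows "ennreal (norm (conv \<phi> f x) powr p) \<le> (\<integral>\<^sup>+y. ennreal (\<phi> (x - y) * norm (f y) powr p) \<partial>lborel)"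
proof (cases "(\<integral>\<^sup>+y. ennreal (\<phi> (x - y) * norm (f y) powr p) \<partial>lborel) = top")
  case False
  note m = mollifierD[OF \<phi>]
  have [measurable]: "\<phi> \<in> borel_measurable borel" "f \<in> borel_measurable borel"
    using m(6) f by auto
  have int_p: "integrable lborel (\<lambda>y. \<phi> (x - y) * norm (f y) powr p)"
    using False m(2) by (intro integrableI_bounded) (auto simp: less_top)
  have int_1: "integrable lborel (\<lambda>y. \<phi> (x - y) * norm (f y))"
    using integrable_norm[OF integrable_mollifier_conv[OF f \<phi>, of x]] m(2) by simp
  define c where "c = (\<integral>y. \<phi> (x - y) * norm (f y) \<partial>lborel)"
  define I where "I = (\<integral>y. \<phi> (x - y) * norm (f y) powr p \<partial>lborel)"
  have c0: "c \<ge> 0" unfolding c_def using m(2) by (intro integral_nonneg_AE) auto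
  have "norm (conv \<phi> f x) \<le> c"
    unfolding conv_def c_def
    using integral_norm_bound[of lborel "\<lambda>y. \<phi> (x - y) *\<^sub>R f y"] m(2) by simp
  then have "norm (conv \<phi> f x) powr p \<le> c powr p" using p by (intro powr_mono2) auto
  also have "c powr p \<le> I"
  proof -
    have "(\<integral>y. \<phi> (x - y) * (c powr (p - 1) * norm (f y)) \<partial>lborel) \<le>
        (\<integral>y. \<phi> (x - y) * ((1 / p) * norm (f y) powr p + (1 - 1 / p) * c powr p) \<partial>lborel)"
    proof (rule Bochner_Integration.integral_mono)
      show "integrable lborel (\<lambda>y. \<phi> (x - y) * (c powr (p - 1) * norm (f y)))"
        using integrable_mult_left[OF int_1, of "c powr (p - 1)"] by (simp add: mult_ac)
      have "integrable lborel (\<lambda>y. (1 / p) * (\<phi> (x - y) * norm (f y) powr p) +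
          ((1 - 1 / p) * c powr p) * \<phi> (x - y))"
        using int_p integral_mollifier_reflect(2)[OF \<phi>, of x]
        by (intro Bochner_Integration.integrable_add integrable_mult_right) auto
      then show "integrable lborel
          (\<lambda>y. \<phi> (x - y) * ((1 / p) * norm (f y) powr p + (1 - 1 / p) * c powr p))"
        by (simp add: algebra_simps)
      show "\<phi> (x - y) * (c powr (p - 1) * norm (f y))
          \<le> \<phi> (x - y) * ((1 / p) * norm (f y) powr p + (1 - 1 / p) * c powr p)" for y
        using m(2) p c0 by (intro mult_left_mono powr_weighted_le) auto
    qed
    also have "(\<integral>y. \<phi> (x - y) * (c powr (p - 1) * norm (f y)) \<partial>lborel) = c powr (p - 1) * c"
      unfolding c_def[symmetric]
      by (subst mult.left_commute, subst integral_mult_right_zero) (simp add: c_def)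
    also have "c powr (p - 1) * c = c powr p"
      using c0 p by (cases "c = 0") (auto simp: powr_diff)
    also have "(\<integral>y. \<phi> (x - y) * ((1 / p) * norm (f y) powr p + (1 - 1 / p) * c powr p) \<partial>lborel) =
        (\<integral>y. (1 / p) * (\<phi> (x - y) * norm (f y) powr p) + ((1 - 1 / p) * c powr p) * \<phi> (x - y) \<partial>lborel)"
      by (intro Bochner_Integration.integral_cong) (auto simp: algebra_simps)
    also have "\<dots> = (1 / p) * I + (1 - 1 / p) * c powr p"
      using int_p integral_mollifier_reflect[OF \<phi>, of x]
      by (subst Bochner_Integration.integral_add) (auto simp: I_def)
    finally have "c powr p * (1 / p) \<le> I * (1 / p)" by (simp add: algebra_simps)
    then show ?thesis using p by (simp add: divide_right_mono field_simps)
  qed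
  finally have "ennreal (norm (conv \<phi> f x) powr p) \<le> ennreal I" by (rule ennreal_leI)
  also have "\<dots> = (\<integral>\<^sup>+y. ennreal (\<phi> (x - y) * norm (f y) powr p) \<partial>lborel)"
    unfolding I_def using int_p m(2) by (intro nn_integral_eq_integral[symmetric]) auto
  finally show ?thesis .
qed simp

lemma borel_measurable_conv:
  fixes f :: "real^'n \<Rightarrow> 'b::euclidean_space"
  assumes [measurable]: "\<phi> \<in> borel_measurable borel" "f \<in> borel_measurable borel"
  shows "conv \<phi> f \<in> borel_measurable borel"
  unfolding conv_def by measurable

text \<open>Integrate the pointwise Jensen bound and exchange the integrals; translates of
  \<open>\<phi>\<close> have unit mass. Mollification is thus a contraction of L^p, so approximating
  before mollifying costs no more than approximating itself.\<close>

lemma nn_integral_powr_norm_conv_le: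
  fixes f :: "real^'n \<Rightarrow> 'b::euclidean_space"
  assumes p: "p \<ge> 1" and f: "integrable lborel f" and \<phi>: "mollifier r \<phi>"
  shows "(\<integral>\<^sup>+x. ennreal (norm (conv \<phi> f x) powr p) \<partial>lborel) \<le>
    (\<integral>\<^sup>+y. ennreal (norm (f y) powr p) \<partial>lborel)"
proof -
  note m = mollifierD[OF \<phi>]
  have [measurable]: "\<phi> \<in> borel_measurable borel" "f \<in> borel_measurable borel"
    using m(6) f by auto
  have "(\<integral>\<^sup>+x. ennreal (norm (conv \<phi> f x) powr p) \<partial>lborel) \<le>
      (\<integral>\<^sup>+x. \<integral>\<^sup>+y. ennreal (\<phi> (x - y) * norm (f y) powr p) \<partial>lborel \<partial>lborel)"
    by (intro nn_integral_mono powr_norm_conv_le[OF p f \<phi>])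
  also have "\<dots> = (\<integral>\<^sup>+y. \<integral>\<^sup>+x. ennreal (\<phi> (x - y) * norm (f y) powr p) \<partial>lborel \<partial>lborel)"
    by (rule lborel_pair.Fubini') measurable
  also have "\<dots> = (\<integral>\<^sup>+y. ennreal (norm (f y) powr p) \<partial>lborel)"
  proof (rule nn_integral_cong)
    fix y :: "real^'n"
    have "(\<integral>\<^sup>+x. ennreal (\<phi> (x - y)) \<partial>lborel) = (\<integral>\<^sup>+x. ennreal (\<phi> x) \<partial>lborel)"
      using nn_integral_lborel_affine[of "\<lambda>x. ennreal (\<phi> x)" 1 "- y"] by simp
    also have "\<dots> = 1"
      using m by (subst nn_integral_eq_integral) auto
    finally show "(\<integral>\<^sup>+x. ennreal (\<phi> (x - y) * norm (f y) powr p) \<partial>lborel) = ennreal (norm (f y) powr p)"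
      using m(2) by (simp add: ennreal_mult nn_integral_multc)
  qed
  finally show ?thesis .
qed

section \<open>Continuous approximation in L^p and convergence of mollifications\<close>

lemma powr_add_le:
  fixes a b p :: real
  assumes "a \<ge> 0" "b \<ge> 0" "p \<ge> 0"
  shows "(a + b) powr p \<le> 2 powr p * (a powr p + b powr p)"
proof -
  have "(a + b) powr p \<le> (2 * max a b) powr p" using assms by (intro powr_mono2) auto
  also have "\<dots> = 2 powr p * (max a b) powr p" using assms by (simp add: powr_mult)
  also have "\<dots> \<le> 2 powr p * (a powr p + b powr p)"
    by (intro mult_left_mono) (auto simp: max_def)
  finally show ?thesis .
qed

lemma nn_integral_powr_norm_diff_le:
  fixes f g h :: "'a \<Rightarrow> 'b::euclidean_space"
  assumes [measurable]: "f \<in> borel_measurable M" "g \<in> borel_measurable M" "h \<in> borel_measurable M"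
    and "p \<ge> 0"
  shows "(\<integral>\<^sup>+x. ennreal (norm (f x - h x) powr p) \<partial>M) \<le> ennreal (2 powr p) *
    ((\<integral>\<^sup>+x. ennreal (norm (f x - g x) powr p) \<partial>M) + (\<integral>\<^sup>+x. ennreal (norm (g x - h x) powr p) \<partial>M))"
proof -
  have "ennreal (norm (f x - h x) powr p) \<le>
      ennreal (2 powr p) * (ennreal (norm (f x - g x) powr p) + ennreal (norm (g x - h x) powr p))" for x
  proof -
    have "norm (f x - h x) \<le> norm (f x - g x) + norm (g x - h x)"
      using norm_triangle_ineq[of "f x - g x" "g x - h x"] by simp
    then have "norm (f x - h x) powr p \<le> (norm (f x - g x) + norm (g x - h x)) powr p"
      using assms(4) by (intro powr_mono2) auto
    also have "\<dots> \<le> 2 powr p * (norm (f x - g x) powr p + norm (g x - h x) powr p)"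
      using assms(4) by (intro powr_add_le) auto
    finally show ?thesis by (simp add: ennreal_leI flip: ennreal_plus ennreal_mult')
  qed
  then have "(\<integral>\<^sup>+x. ennreal (norm (f x - h x) powr p) \<partial>M) \<le>
    (\<integral>\<^sup>+x. ennreal (2 powr p) * (ennreal (norm (f x - g x) powr p) + ennreal (norm (g x - h x) powr p)) \<partial>M)"
    by (rule nn_integral_mono)
  then show ?thesis by (simp add: nn_integral_cmult nn_integral_add)
qed

lemma Lp_approx_bounded:
  fixes F :: "real^'n \<Rightarrow> 'b::euclidean_space"
  assumes [measurable]: "F \<in> borel_measurable borel" and p: "p > 0"
    and fin: "(\<integral>\<^sup>+x. ennreal (norm (F x) powr p) \<partial>lborel) < top" and "e > 0"
  obtains N :: nat where
    "(\<integral>\<^sup>+x. ennreal (norm (F x - (if norm (F x) \<le> real N then F x else 0)) powr p) \<partial>lborel) < ennreal e"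
proof -
  define H where "H N x = (if norm (F x) \<le> real N then F x else 0)" for N x
  have [measurable]: "H N \<in> borel_measurable borel" for N unfolding H_def by measurable
  have "(\<lambda>N. \<integral>\<^sup>+x. ennreal (norm (F x - H N x) powr p) \<partial>lborel) \<longlonglongrightarrow> (\<integral>\<^sup>+x. 0 \<partial>(lborel::(real^'n) measure))"
  proof (rule nn_integral_dominated_convergence[where w="\<lambda>x. ennreal (norm (F x) powr p)"])
    show "AE x in lborel. ennreal (norm (F x - H N x) powr p) \<le> ennreal (norm (F x) powr p)" for N
      by (auto simp: H_def)
    show "AE x in lborel. (\<lambda>N. ennreal (norm (F x - H N x) powr p)) \<longlonglongrightarrow> 0"
    proof (intro always_eventually allI)
      fix x
      have "\<forall>\<^sub>F N in sequentially. norm (F x) \<le> real N"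
        using filterlim_real_sequentially by (simp add: filterlim_at_top)
      then have "\<forall>\<^sub>F N in sequentially. ennreal (norm (F x - H N x) powr p) = 0"
        by eventually_elim (simp add: H_def)
      then show "(\<lambda>N. ennreal (norm (F x - H N x) powr p)) \<longlonglongrightarrow> 0"
        by (rule tendsto_eventually)
    qed
  qed (use fin in auto)
  then have "\<forall>\<^sub>F N in sequentially. (\<integral>\<^sup>+x. ennreal (norm (F x - H N x) powr p) \<partial>lborel) < ennreal e"
    by (rule order_tendstoD(2)) (use \<open>e > 0\<close> in simp)
  then obtain N where "(\<integral>\<^sup>+x. ennreal (norm (F x - H N x) powr p) \<partial>lborel) < ennreal e"
    using eventually_happens'[OF sequentially_bot] by blast
  then show thesis unfolding H_def by (rule that)
qed

text \<open>Lebesgue measurability provides continuous \<open>g n\<close> converging almost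
  everywhere, but without control of size or support. Both are restored by continuous operations
  that leave \<open>H\<close> unchanged, after which dominated convergence applies.\<close>

lemma bounded_approx_continuous:
  fixes H :: "real^'n \<Rightarrow> 'b::euclidean_space"
  assumes [measurable]: "H \<in> borel_measurable borel" and p: "p > 0" and N: "N > 0" "\<And>x. norm (H x) \<le> N"
    and van: "\<And>x. norm x > R \<Longrightarrow> H x = 0" and "e > 0"
  obtains G where "continuous_on UNIV G" "\<And>x. norm x > R + 1 \<Longrightarrow> G x = 0"
    "(\<integral>\<^sup>+x. ennreal (norm (H x - G x) powr p) \<partial>lborel) < ennreal e"
proof -
  have "H measurable_on UNIV"
    by (rule lebesgue_measurable_imp_measurable_on)
      (auto intro!: measurable_completion simp: measurable_lborel1)
  then obtain Z and g :: "nat \<Rightarrow> real^'n \<Rightarrow> 'b" where Z: "negligible Z"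
    and g: "\<forall>n. continuous_on UNIV (g n)"
    and lim: "\<forall>x. x \<notin> Z \<longrightarrow> (\<lambda>n. g n x) \<longlonglongrightarrow> (if x \<in> UNIV then H x else 0)"
    unfolding measurable_on_def by blast
  \<comment> \<open>\<open>c\<close> is the radial retraction onto the ball of radius
    \<open>N\<close>; \<open>cut\<close> is 1 on the ball of radius \<open>R\<close> and vanishes
    outside radius \<open>R + 1\<close>.\<close>
  define c where "c y = (N / max N (norm y)) *\<^sub>R y" for y :: 'b
  define cut where "cut x = max 0 (min 1 (R + 1 - norm x))" for x :: "real^'n"
  define G where "G n x = cut x *\<^sub>R c (g n x)" for n x
  have maxN: "max N t \<noteq> 0" for t using N(1) by (simp add: max_def)
  have cc: "continuous_on UNIV c" unfolding c_def
    by (intro continuous_intros) (use maxN in auto)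
  have cont_cut: "continuous_on UNIV cut" unfolding cut_def by (intro continuous_intros)
  have cG: "continuous_on UNIV (G n)" for n
    unfolding G_def by (intro continuous_on_scaleR cont_cut continuous_on_compose2[OF cc g[rule_format]]) auto
  have [measurable]: "G n \<in> borel_measurable borel" for n
    using cG by (rule borel_measurable_continuous_onI)
  have nc: "norm (c y) \<le> N" for y
    using N(1) by (auto simp: c_def field_simps max_def)
  have cH: "c (H x) = H x" for x using N by (simp add: c_def max_absorb1)
  have cut01: "0 \<le> cut x" "cut x \<le> 1" for x by (auto simp: cut_def)
  have cutH: "cut x *\<^sub>R H x = H x" for x
    by (cases "norm x > R") (auto simp: van cut_def)
  have vG: "G n x = 0" if "norm x > R + 1" for n x using that by (simp add: G_def cut_def)
  have nG: "norm (G n x) \<le> N" for n x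
  proof -
    have "norm (G n x) \<le> 1 * N" unfolding G_def norm_scaleR using cut01 nc by (intro mult_mono) auto
    then show ?thesis by simp
  qed
  have "(\<lambda>n. \<integral>\<^sup>+x. ennreal (norm (H x - G n x) powr p) \<partial>lborel) \<longlonglongrightarrow> (\<integral>\<^sup>+x. 0 \<partial>(lborel::(real^'n) measure))"
  proof (rule nn_integral_dominated_convergence[where
        w="\<lambda>x. ennreal ((2 * N) powr p) * indicator (cball 0 (\<bar>R\<bar> + 1)) x"])
    show "AE x in lborel. ennreal (norm (H x - G n x) powr p) \<le>
        ennreal ((2 * N) powr p) * indicator (cball 0 (\<bar>R\<bar> + 1)) x" for n
    proof (intro always_eventually allI)
      fix x
      have "norm (H x - G n x) \<le> 2 * N"
        using norm_triangle_ineq4[of "H x" "G n x"] N(2)[of x] nG[of n x] by linarith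
      then have "norm (H x - G n x) powr p \<le> (2 * N) powr p" using p by (intro powr_mono2) auto
      then show "ennreal (norm (H x - G n x) powr p) \<le>
        ennreal ((2 * N) powr p) * indicator (cball 0 (\<bar>R\<bar> + 1)) x"
        using van[of x] vG[of x n] by (cases "norm x \<le> \<bar>R\<bar> + 1") (auto intro: ennreal_leI)
    qed
    show "(\<integral>\<^sup>+x. ennreal ((2 * N) powr p) * indicator (cball 0 (\<bar>R\<bar> + 1)) x \<partial>(lborel::(real^'n) measure)) < \<infinity>"
      using emeasure_lborel_cball_finite[of "0::real^'n" "\<bar>R\<bar> + 1"]
      by (simp add: nn_integral_cmult_indicator ennreal_mult_less_top)
    have "AE x in lborel. x \<notin> Z"
      using Z AE_not_in[of Z lebesgue] by (simp add: negligible_iff_null_sets AE_completion_iff)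
    then show "AE x in lborel. (\<lambda>n. ennreal (norm (H x - G n x) powr p)) \<longlonglongrightarrow> 0"
    proof eventually_elim
      case (elim x)
      have "(\<lambda>n. c (g n x)) \<longlonglongrightarrow> c (H x)"
        using lim elim by (intro continuous_on_tendsto_compose[OF cc]) auto
      then have "(\<lambda>n. G n x) \<longlonglongrightarrow> cut x *\<^sub>R c (H x)"
        unfolding G_def by (intro tendsto_intros)
      then have "(\<lambda>n. G n x) \<longlonglongrightarrow> H x" by (simp add: cH cutH)
      then have "(\<lambda>n. norm (H x - G n x)) \<longlonglongrightarrow> 0"
        using tendsto_norm_zero[OF LIM_zero, of "\<lambda>n. G n x" "H x"] by (simp only: norm_minus_commute)
      then have "(\<lambda>n. norm (H x - G n x) powr p) \<longlonglongrightarrow> 0"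
        using p by (intro tendsto_zero_powrI[where b=p]) auto
      from tendsto_ennrealI[OF this] show ?case by simp
    qed
    have mH: "H \<in> borel_measurable lborel" and mG: "G n \<in> borel_measurable lborel" for n
      using assms(1) borel_measurable_continuous_onI[OF cG] by simp_all
    show "(\<lambda>x. ennreal (norm (H x - G n x) powr p)) \<in> borel_measurable lborel" for n
      using mH mG[of n] by (intro measurable_compose[OF _ measurable_ennreal] powr_real_measurable
          measurable_compose[OF _ borel_measurable_norm] borel_measurable_diff borel_measurable_const)
    show "(\<lambda>x. ennreal ((2 * N) powr p) * indicator (cball 0 (\<bar>R\<bar> + 1)) x)
        \<in> borel_measurable lborel"
      by (intro borel_measurable_times_ennreal borel_measurable_const borel_measurable_indicator) simp
  qed simp
  then have "\<forall>\<^sub>F n in sequentially. (\<integral>\<^sup>+x. ennreal (norm (H x - G n x) powr p) \<partial>lborel) < ennreal e"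
    by (rule order_tendstoD(2)) (use \<open>e > 0\<close> in simp)
  then obtain n where "(\<integral>\<^sup>+x. ennreal (norm (H x - G n x) powr p) \<partial>lborel) < ennreal e"
    using eventually_happens'[OF sequentially_bot] by blast
  then show thesis using that[of "G n"] cG vG by blast
qed

lemma Lp_approx_continuous:
  fixes F :: "real^'n \<Rightarrow> 'b::euclidean_space"
  assumes [measurable]: "F \<in> borel_measurable borel" and p: "p > 0"
    and fin: "(\<integral>\<^sup>+x. ennreal (norm (F x) powr p) \<partial>lborel) < top"
    and van: "\<And>x. norm x > R \<Longrightarrow> F x = 0" and "e > 0"
  obtains G where "continuous_on UNIV G" "\<And>x. norm x > R + 1 \<Longrightarrow> G x = 0"
    "(\<integral>\<^sup>+x. ennreal (norm (F x - G x) powr p) \<partial>lborel) < ennreal e"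
proof -
  define d where "d = e / (2 * 2 powr p)"
  have d: "d > 0" "2 powr p * (d + d) = e" using \<open>e > 0\<close> by (auto simp: d_def)
  obtain N :: nat where N:
    "(\<integral>\<^sup>+x. ennreal (norm (F x - (if norm (F x) \<le> real N then F x else 0)) powr p) \<partial>lborel) < ennreal d"
    using Lp_approx_bounded[OF assms(1) p fin d(1)] by blast
  define H where "H x = (if norm (F x) \<le> real N then F x else 0)" for x
  have [measurable]: "H \<in> borel_measurable borel" unfolding H_def by measurable
  obtain G where G: "continuous_on UNIV G" "\<And>x. norm x > R + 1 \<Longrightarrow> G x = 0"
    "(\<integral>\<^sup>+x. ennreal (norm (H x - G x) powr p) \<partial>lborel) < ennreal d"
    by (rule bounded_approx_continuous[of H p "real N + 1" R d]) (use p d(1) van in \<open>auto simp: H_def\<close>)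
  have [measurable]: "G \<in> borel_measurable borel"
    using G(1) by (rule borel_measurable_continuous_onI)
  have "(\<integral>\<^sup>+x. ennreal (norm (F x - G x) powr p) \<partial>lborel) \<le> ennreal (2 powr p) *
      ((\<integral>\<^sup>+x. ennreal (norm (F x - H x) powr p) \<partial>lborel) + (\<integral>\<^sup>+x. ennreal (norm (H x - G x) powr p) \<partial>lborel))"
    by (rule nn_integral_powr_norm_diff_le) (use p in auto)
  also have "\<dots> < ennreal (2 powr p) * (ennreal d + ennreal d)"
    using N G(3) unfolding H_def[symmetric]
    by (intro ennreal_mult_strict_left_mono add_strict_mono) auto
  also have "\<dots> = ennreal (2 powr p * (d + d))"
    using d(1) by (simp only: ennreal_mult ennreal_plus powr_ge_zero add_nonneg_nonneg less_imp_le)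
  also have "\<dots> = ennreal e" by (simp only: d(2))
  finally show thesis using G by (intro that[of G])
qed

text \<open>On the bounded support, |F| \<le> 1 + |F|^p.\<close>

lemma integrable_of_powr_vanishing:
  fixes F :: "real^'n \<Rightarrow> 'b::euclidean_space"
  assumes [measurable]: "F \<in> borel_measurable borel" and p: "p \<ge> 1"
    and fin: "(\<integral>\<^sup>+x. ennreal (norm (F x) powr p) \<partial>lborel) < top"
    and van: "\<And>x. norm x > R \<Longrightarrow> F x = 0"
  shows "integrable lborel F"
proof (rule integrableI_bounded)
  have "(\<integral>\<^sup>+x. ennreal (norm (F x)) \<partial>lborel) \<le>
      (\<integral>\<^sup>+x. indicator (cball 0 R) x + ennreal (norm (F x) powr p) \<partial>lborel)"
  proof (rule nn_integral_mono)
    fix x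
    show "ennreal (norm (F x)) \<le> indicator (cball 0 R) x + ennreal (norm (F x) powr p)"
    proof (cases "norm (F x) \<le> 1")
      case True
      then show ?thesis using van[of x]
        by (cases "norm x \<le> R") (auto intro!: add_increasing2)
    next
      case False
      then have "norm (F x) powr 1 \<le> norm (F x) powr p" using p by (intro powr_mono) auto
      then show ?thesis using False by (auto intro!: add_increasing ennreal_leI)
    qed
  qed
  also have "\<dots> < \<infinity>"
    using fin emeasure_lborel_cball_finite[of "0::real^'n" R]
    by (subst nn_integral_add) (auto intro!: borel_measurable_indicator)
  finally show "(\<integral>\<^sup>+x. ennreal (norm (F x)) \<partial>lborel) < \<infinity>" .
qed auto

lemma conv_continuous_close:
  fixes G :: "real^'n \<Rightarrow> 'b::euclidean_space"
  assumes G: "integrable lborel G" and \<phi>: "mollifier r \<phi>"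
    and close: "\<And>x y. dist y x < r \<Longrightarrow> norm (G y - G x) \<le> d"
  shows "norm (conv \<phi> G x - G x) \<le> d"
proof -
  note m = mollifierD[OF \<phi>] and refl = integral_mollifier_reflect[OF \<phi>, of x]
  have "conv \<phi> G x - G x = (\<integral>y. \<phi> (x - y) *\<^sub>R G y - \<phi> (x - y) *\<^sub>R G x \<partial>lborel)"
    unfolding conv_def using refl integrable_mollifier_conv[OF G \<phi>, of x]
    by (subst Bochner_Integration.integral_diff) auto
  also have "norm \<dots> \<le> (\<integral>y. \<phi> (x - y) * d \<partial>lborel)"
  proof (rule Bochner_Integration.integral_norm_bound_integral)
    fix y
    have "norm (\<phi> (x - y) *\<^sub>R (G y - G x)) \<le> \<phi> (x - y) * d"
      using m(2)[of "x - y"] m(3)[of "x - y"] close[of y x]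
      by (cases "norm (x - y) < r") (auto simp: dist_norm norm_minus_commute intro!: mult_left_mono)
    then show "norm (\<phi> (x - y) *\<^sub>R G y - \<phi> (x - y) *\<^sub>R G x) \<le> \<phi> (x - y) * d"
      by (simp add: algebra_simps)
  qed (use refl integrable_mollifier_conv[OF G \<phi>, of x] in auto)
  also have "\<dots> = d" using refl by simp
  finally show ?thesis .
qed

text \<open>Three-term splitting through a continuous \<open>G\<close> with bounded support: the
  outer differences are controlled by the contraction property and the choice of \<open>G\<close>,
  the middle one by uniform continuity of \<open>G\<close> on a bounded set.\<close>

lemma conv_Lp_tendsto:
  fixes F :: "real^'n \<Rightarrow> 'b::euclidean_space"
  assumes [measurable]: "F \<in> borel_measurable borel" and p: "p \<ge> 1"
    and fin: "(\<integral>\<^sup>+x. ennreal (norm (F x) powr p) \<partial>lborel) < top"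
    and van: "\<And>x. norm x > R \<Longrightarrow> F x = 0"
    and \<phi>: "\<And>k. mollifier (r k) (\<phi> k)" and r: "r \<longlonglongrightarrow> 0"
  shows "(\<lambda>k. \<integral>\<^sup>+x. ennreal (norm (conv (\<phi> k) F x - F x) powr p) \<partial>lborel) \<longlonglongrightarrow> 0"
proof (rule tendsto_zero_ennreal)
  fix e :: real assume "e > 0"
  have F: "integrable lborel F" using integrable_of_powr_vanishing[OF assms(1) p fin van] .
  define c where "c = (2::real) powr p"
  have c: "c > 0" by (simp add: c_def)
  \<comment> \<open>Two applications of the triangle inequality for p-th powers, each with factor
    \<open>c\<close>, produce \<open>c * (d + c * (d + d))\<close>, which has to equal
    \<open>e\<close>.\<close>
  define d where "d = e / (c * (1 + c * 2))"
  have "d > 0" using \<open>e > 0\<close> c by (simp add: d_def)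
  have de: "c * (d + c * (d + d)) = e"
  proof -
    have "c * (d + c * (d + d)) = d * (c * (1 + c * 2))" by (simp add: algebra_simps)
    also have "\<dots> = e" using c unfolding d_def by (intro nonzero_eq_divide_eq[THEN iffD1] refl) (auto simp: add_pos_pos less_imp_neq[THEN not_sym])
    finally show ?thesis .
  qed
  obtain G where G: "continuous_on UNIV G" "\<And>x. norm x > R + 1 \<Longrightarrow> G x = 0"
    "(\<integral>\<^sup>+x. ennreal (norm (F x - G x) powr p) \<partial>lborel) < ennreal d"
    by (rule Lp_approx_continuous[OF assms(1) _ fin van \<open>d > 0\<close>]) (use p in auto)
  have [measurable]: "G \<in> borel_measurable borel" using G(1) by (rule borel_measurable_continuous_onI)
  have iG: "integrable lborel G" using G by (intro integrable_continuous_vanishing[of G "R + 1"]) auto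
  \<comment> \<open>For radii below 1 the middle difference lives on the ball of radius
    \<open>\<bar>R\<bar> + 2\<close>. The added 1 makes \<open>A\<close> positive and the final
    comparison with \<open>d\<close> strict.\<close>
  define A where "A = measure lborel (cball (0::real^'n) (\<bar>R\<bar> + 2)) + 1"
  have A: "A > 0" by (simp add: A_def add_nonneg_pos)
  define \<eta> where "\<eta> = (d / A) powr (1 / p)"
  have \<eta>: "\<eta> > 0" "\<eta> powr p = d / A" using A \<open>d > 0\<close> p by (auto simp: \<eta>_def powr_powr)
  obtain s where s: "s > 0" "\<And>x y. dist y x < s \<Longrightarrow> dist (G y) (G x) < \<eta>"
    using continuous_vanishing_uniformly_continuous[of G "R + 1"] G \<open>\<eta> > 0\<close>
    unfolding uniformly_continuous_on_def by (metis UNIV_I)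
  have "\<forall>\<^sub>F k in sequentially. r k < min s 1"
    using r s(1) by (intro order_tendstoD(2)) auto
  then show "\<forall>\<^sub>F k in sequentially.
      (\<integral>\<^sup>+x. ennreal (norm (conv (\<phi> k) F x - F x) powr p) \<partial>lborel) < ennreal e"
  proof eventually_elim
    case (elim k)
    note m = mollifierD[OF \<phi>[of k]]
    have [measurable]: "conv (\<phi> k) F \<in> borel_measurable borel" "conv (\<phi> k) G \<in> borel_measurable borel"
      using m(6) by (auto intro!: borel_measurable_conv)
    have 1: "(\<integral>\<^sup>+x. ennreal (norm (conv (\<phi> k) F x - conv (\<phi> k) G x) powr p) \<partial>lborel) < ennreal d"
    proof -
      have "conv (\<phi> k) F x - conv (\<phi> k) G x = conv (\<phi> k) (\<lambda>x. F x - G x) x" for x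
        unfolding conv_def using integrable_mollifier_conv[OF F \<phi>] integrable_mollifier_conv[OF iG \<phi>]
        by (subst Bochner_Integration.integral_diff[symmetric]) (auto simp: algebra_simps)
      moreover have "(\<integral>\<^sup>+x. ennreal (norm (conv (\<phi> k) (\<lambda>x. F x - G x) x) powr p) \<partial>lborel) \<le>
          (\<integral>\<^sup>+x. ennreal (norm (F x - G x) powr p) \<partial>lborel)"
        using F iG by (intro nn_integral_powr_norm_conv_le[OF p _ \<phi>]) auto
      ultimately show ?thesis using G(3) by simp
    qed
    have 2: "(\<integral>\<^sup>+x. ennreal (norm (conv (\<phi> k) G x - G x) powr p) \<partial>lborel) < ennreal d"
    proof -
      have "(\<integral>\<^sup>+x. ennreal (norm (conv (\<phi> k) G x - G x) powr p) \<partial>lborel) \<le>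
          (\<integral>\<^sup>+x. ennreal (d / A) * indicator (cball 0 (\<bar>R\<bar> + 2)) x \<partial>(lborel :: (real^'n) measure))"
      proof (rule nn_integral_mono)
        fix x
        show "ennreal (norm (conv (\<phi> k) G x - G x) powr p) \<le>
            ennreal (d / A) * indicator (cball 0 (\<bar>R\<bar> + 2)) x"
        proof (cases "norm x \<le> \<bar>R\<bar> + 2")
          case True
          have "norm (conv (\<phi> k) G x - G x) \<le> \<eta>"
          proof (rule conv_continuous_close[OF iG \<phi>])
            show "norm (G y - G x) \<le> \<eta>" if "dist y x < r k" for x y
              using s(2)[of y x] that elim by (simp add: dist_norm)
          qed
          then have "norm (conv (\<phi> k) G x - G x) powr p \<le> d / A"
            using p unfolding \<eta>(2)[symmetric] by (intro powr_mono2) auto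
          then show ?thesis using True by (auto intro: ennreal_leI)
        next
          case False
          have "\<phi> k (x - y) *\<^sub>R G y = 0" for y
          proof (cases "norm y > R + 1")
            case False': False
            have "norm (x - y) \<ge> norm x - norm y" by (rule norm_triangle_ineq2)
            with False False' elim have "norm (x - y) \<ge> r k" by linarith
            then show ?thesis using m(3) by simp
          qed (simp add: G(2))
          then have "conv (\<phi> k) G x = 0" by (simp only: conv_def) simp
          moreover have "G x = 0" using False G(2) by auto
          ultimately show ?thesis using False by simp
        qed
      qed
      also have "\<dots> = ennreal (d / A) * ennreal (A - 1)"
      proof -
        have "emeasure lborel (cball (0::real^'n) (\<bar>R\<bar> + 2)) = ennreal (A - 1)"
          using emeasure_lborel_cball_finite[of "0::real^'n" "\<bar>R\<bar> + 2"]
          unfolding A_def by (subst emeasure_eq_ennreal_measure) auto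
        then show ?thesis by (subst nn_integral_cmult_indicator) auto
      qed
      also have "\<dots> < ennreal d"
      proof -
        have "d / A * (A - 1) < d" using A \<open>d > 0\<close> by (simp add: field_simps)
        moreover have "A - 1 \<ge> 0" by (simp add: A_def)
        moreover have "d / A \<ge> 0" using A \<open>d > 0\<close> by simp
        ultimately show ?thesis using \<open>d > 0\<close>
          by (subst ennreal_mult[symmetric]) (auto intro!: ennreal_lessI)
      qed
      finally show ?thesis .
    qed
    have 3: "(\<integral>\<^sup>+x. ennreal (norm (G x - F x) powr p) \<partial>lborel) < ennreal d"
      using G(3) by (simp add: norm_minus_commute)
    have "(\<integral>\<^sup>+x. ennreal (norm (conv (\<phi> k) F x - F x) powr p) \<partial>lborel) \<le> ennreal c *
      ((\<integral>\<^sup>+x. ennreal (norm (conv (\<phi> k) F x - conv (\<phi> k) G x) powr p) \<partial>lborel) +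
       (\<integral>\<^sup>+x. ennreal (norm (conv (\<phi> k) G x - F x) powr p) \<partial>lborel))"
      unfolding c_def by (rule nn_integral_powr_norm_diff_le) (use p in auto)
    also have "\<dots> \<le> ennreal c *
      ((\<integral>\<^sup>+x. ennreal (norm (conv (\<phi> k) F x - conv (\<phi> k) G x) powr p) \<partial>lborel) + ennreal c *
       ((\<integral>\<^sup>+x. ennreal (norm (conv (\<phi> k) G x - G x) powr p) \<partial>lborel) +
        (\<integral>\<^sup>+x. ennreal (norm (G x - F x) powr p) \<partial>lborel)))"
      unfolding c_def
      by (intro mult_left_mono add_left_mono nn_integral_powr_norm_diff_le) (use p in auto)
    also have "\<dots> < ennreal c * (ennreal d + ennreal c * (ennreal d + ennreal d))"
      using c 1 2 3 by (intro ennreal_mult_strict_left_mono add_strict_mono) auto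
    also have "\<dots> = ennreal (c * (d + c * (d + d)))"
      using c \<open>d > 0\<close> by (simp add: ennreal_mult flip: mult_2)
    also have "\<dots> = ennreal e" by (simp only: de)
    finally show ?case .
  qed
qed

section \<open>A Morrey estimate\<close>

lemma nn_integral_powr_unit_interval:
  assumes "0 \<le> q" "q < 1"
  shows "(\<integral>\<^sup>+t. indicator {0<..1} t * ennreal (t powr - q) \<partial>lborel) = ennreal (1 / (1 - q))"
proof -
  have "((\<lambda>t. t powr - q) has_integral (1 / (1 - q))) {0..1}"
    using has_integral_powr_from_0[of "- q" 1] assms by simp
  then have I: "((\<lambda>t. if t \<in> {0..1} then t powr - q else 0) has_integral (1 / (1 - q))) UNIV"
    by (simp only: has_integral_restrict_UNIV)
  have "(\<integral>\<^sup>+t. ennreal (if t \<in> {0..1} then t powr - q else 0) \<partial>lborel) = ennreal (1 / (1 - q))"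
    by (rule nn_integral_has_integral_lborel[OF _ _ I]) auto
  moreover have "ennreal (if t \<in> {0..1} then t powr - q else 0) = indicator {0<..1} t * ennreal (t powr - q)" for t
    by (auto simp: indicator_def)
  ultimately show ?thesis by simp
qed

text \<open>No optimal constant is sought: if \<open>K \<le> \<theta> * y\<close> the first term on
  the right dominates, otherwise \<open>y \<le> K / \<theta>\<close> and the second one
  does.\<close>

lemma Young_powr:
  fixes K y \<theta> p :: real
  assumes "K \<ge> 0" "y \<ge> 0" "\<theta> > 0" "p > 1"
  shows "K * y powr (p - 1) \<le> \<theta> * y powr p + K powr p * \<theta> powr (1 - p)"
proof (cases "K \<le> \<theta> * y")
  case True
  have "K * y powr (p - 1) \<le> \<theta> * y * y powr (p - 1)" using True by (intro mult_right_mono) auto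
  also have "\<dots> = \<theta> * y powr p"
    using assms by (cases "y = 0") (auto simp: powr_diff)
  finally show ?thesis using assms by (simp add: add_increasing2)
next
  case False
  then have "y \<le> K / \<theta>" using assms by (simp add: field_simps)
  then have "y powr (p - 1) \<le> (K / \<theta>) powr (p - 1)" using assms by (intro powr_mono2) auto
  then have "K * y powr (p - 1) \<le> K * (K / \<theta>) powr (p - 1)" using assms by (intro mult_left_mono) auto
  also have "\<dots> = K powr p * \<theta> powr (1 - p)"
    using assms by (cases "K = 0") (auto simp: powr_divide powr_diff)
  finally show ?thesis using assms by (simp add: add_increasing)
qed

text \<open>Fundamental theorem of calculus along the segment. The \<open>ennreal\<close> integral
  over the parameter is ready for Tonelli's theorem, and t = 0 is left out because the next step
  substitutes by a dilation of ratio t.\<close>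

lemma ennreal_abs_diff_le_line_integral:
  fixes w :: "real^'n \<Rightarrow> real"
  assumes "smooth w"
  shows "ennreal \<bar>w x - w z\<bar> \<le>
    (\<integral>\<^sup>+t. indicator {0<..1} t * ennreal (norm (z - x) * norm (grad w (x + t *\<^sub>R (z - x)))) \<partial>lborel)"
proof -
  define h where "h t = w (x + t *\<^sub>R (z - x))" for t
  define h' where "h' t = grad w (x + t *\<^sub>R (z - x)) \<bullet> (z - x)" for t
  define g where "g t = norm (z - x) * norm (grad w (x + t *\<^sub>R (z - x)))" for t
  have cg: "continuous_on UNIV g"
    unfolding g_def by (intro continuous_intros continuous_on_compose2[OF smooth_continuous_on_grad[OF assms, of UNIV]]) auto
  have "(h has_vector_derivative h' t) (at t within {0..1})" for t
  proof -
    have "(h has_derivative (\<lambda>s. grad w (x + t *\<^sub>R (z - x)) \<bullet> (s *\<^sub>R (z - x)))) (at t)"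
      unfolding h_def
      by (rule has_derivative_compose[OF _ smooth_has_derivative[OF assms]])
        (auto intro!: derivative_eq_intros)
    then show ?thesis
      by (auto simp: has_vector_derivative_def h'_def intro: has_derivative_at_withinI)
  qed
  then have "(h' has_integral (h 1 - h 0)) {0..1}"
    by (intro fundamental_theorem_of_calculus) auto
  then have "h' integrable_on {0..1}" "integral {0..1} h' = h 1 - h 0"
    by (auto simp: has_integral_iff)
  moreover have ig: "g integrable_on {0..1}"
    using cg continuous_on_subset by (intro integrable_continuous_real) blast
  moreover have "norm (h' t) \<le> g t" for t
    using Cauchy_Schwarz_ineq2[of "grad w (x + t *\<^sub>R (z - x))" "z - x"]
    by (simp add: h'_def g_def mult.commute)
  ultimately have "norm (h 1 - h 0) \<le> integral {0..1} g"
    using Henstock_Kurzweil_Integration.integral_norm_bound_integral[of h' "{0..1}" g] by simp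
  then have "\<bar>w x - w z\<bar> \<le> integral {0..1} g"
    by (simp add: h_def abs_minus_commute)
  then have "ennreal \<bar>w x - w z\<bar> \<le> ennreal (integral {0..1} g)" by (rule ennreal_leI)
  also have "\<dots> = (\<integral>\<^sup>+t. ennreal (if t \<in> {0..1} then g t else 0) \<partial>lborel)"
  proof (rule nn_integral_has_integral_lborel[symmetric])
    show "((\<lambda>t. if t \<in> {0..1} then g t else 0) has_integral integral {0..1} g) UNIV"
      using ig by (simp only: has_integral_restrict_UNIV integrable_integral)
    have [measurable]: "g \<in> borel_measurable borel" using cg by (rule borel_measurable_continuous_onI)
    show "(\<lambda>t. if t \<in> {0..1} then g t else 0) \<in> borel_measurable borel" by measurable
  qed (auto simp: g_def)
  also have "\<dots> = (\<integral>\<^sup>+t. indicator {0<..1} t * ennreal (g t) \<partial>lborel)"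
  proof (rule nn_integral_cong_AE)
    show "AE t in lborel. ennreal (if t \<in> {0..1} then g t else 0) = indicator {0<..1} t * ennreal (g t)"
      using AE_lborel_singleton[of 0] by eventually_elim (auto simp: indicator_def)
  qed
  finally show ?thesis by (simp add: g_def)
qed

text \<open>After exchanging the integrals, for fixed \<open>t\<close> the map z to x + t (z - x)
  contracts the convex ball into itself with Jacobian t^n. Balancing the energy term against the
  volume term leaves t to the power -n/p, integrable on the unit interval precisely because
  \<open>p\<close> exceeds the dimension.\<close>

lemma Morrey_mean_oscillation:
  fixes w :: "real^'n \<Rightarrow> real" and p :: real
  assumes w: "smooth w" and p: "p > CARD('n)" and \<rho>: "\<rho> > 0" and K: "K \<ge> 0"
    and energy: "(\<integral>\<^sup>+z. indicator (ball a \<rho>) z * ennreal (norm (grad w z) powr p) \<partial>lborel)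
      \<le> ennreal (K * \<rho> powr (real CARD('n) - p))"
    and x: "x \<in> ball a \<rho>"
  shows "(\<integral>\<^sup>+z. indicator (ball a \<rho>) z * ennreal \<bar>w x - w z\<bar> \<partial>lborel) \<le>
    ennreal (2 * \<rho> ^ CARD('n) * (K + unit_ball_vol CARD('n)) / (1 - CARD('n) / p))"
proof -
  define n where "n = real CARD('n)"
  define q where "q = n / p"
  define \<omega> where "\<omega> = unit_ball_vol n"
  define I where "I = ball a \<rho>"
  have n: "n > 0" by (simp add: n_def)
  have p1: "p > 1" using p by (simp add: Suc_leI le_less_trans[of 1 "real CARD('n)"] less_le_trans)
  have q: "0 \<le> q" "q < 1" using p n p1 by (auto simp: q_def n_def)
  have \<omega>: "\<omega> \<ge> 0" by (simp add: \<omega>_def n_def)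
  have cg: "continuous_on UNIV (grad w)" by (rule smooth_continuous_on_grad[OF w])
  have [measurable]: "grad w \<in> borel_measurable borel" "I \<in> sets borel" "w \<in> borel_measurable borel"
    using borel_measurable_continuous_onI[OF cg] borel_measurable_continuous_onI[OF smooth_continuous_on[OF w]]
    by (auto simp: I_def)
  have emI: "emeasure lborel I = ennreal (\<omega> * \<rho> powr n)"
    using \<rho> by (simp add: I_def emeasure_ball \<omega>_def n_def powr_realpow)
  define D where "D t z = norm (grad w (x + t *\<^sub>R (z - x)))" for t z
  have D[measurable]: "(\<lambda>(z, t). D t z) \<in> borel_measurable (lborel \<Otimes>\<^sub>M lborel)"
  proof -
    have "continuous_on UNIV (\<lambda>(z, t). D t z)"
      unfolding D_def case_prod_beta
      by (intro continuous_intros continuous_on_compose2[OF cg]) auto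
    then have "(\<lambda>(z, t). D t z) \<in> borel_measurable borel" by (rule borel_measurable_continuous_onI)
    then show ?thesis unfolding lborel_prod by simp
  qed
  have D'[measurable]: "D t \<in> borel_measurable borel" for t
    unfolding D_def by (intro borel_measurable_continuous_onI continuous_intros continuous_on_compose2[OF cg]) auto
  have inner: "(\<integral>\<^sup>+z. indicator I z * ennreal (D t z) \<partial>lborel) \<le>
      ennreal (\<rho> powr (n - 1) * (K + \<omega>) * t powr - q)" if t: "0 < t" "t \<le> 1" for t
  proof -
    \<comment> \<open>With this weight both terms of the splitting of \<open>D t z\<close> below integrate to multiples of \<open>t\<^sup>-\<^sup>q\<close>.\<close>
    define \<tau> where "\<tau> = \<rho> * t powr q"
    have \<tau>: "\<tau> > 0" using \<rho> t by (simp add: \<tau>_def)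
    have "(\<integral>\<^sup>+z. indicator I z * ennreal (D t z) \<partial>lborel) \<le>
      (\<integral>\<^sup>+z. ennreal (\<tau> powr (p - 1)) * (indicator I z * ennreal (D t z powr p)) +
        ennreal (1 / \<tau>) * indicator I z \<partial>lborel)"
    proof (rule nn_integral_mono)
      fix z
      \<comment> \<open>A pointwise replacement for Hoelder's inequality: where \<open>D t z\<close>
        exceeds \<open>1 / \<tau>\<close>, the factor \<open>(\<tau> * D t z) powr (p - 1)\<close>
        is at least 1.\<close>
      have "D t z \<le> \<tau> powr (p - 1) * D t z powr p + 1 / \<tau>"
      proof (cases "D t z \<le> 1 / \<tau>")
        case False
        then have "1 \<le> \<tau> * D t z" using \<tau> by (simp add: field_simps)
        then have "1 powr (p - 1) \<le> (\<tau> * D t z) powr (p - 1)" using p1 by (intro powr_mono2) auto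
        then have "D t z * 1 \<le> D t z * (\<tau> * D t z) powr (p - 1)"
          by (intro mult_left_mono) (auto simp: D_def)
        also have "\<dots> = \<tau> powr (p - 1) * D t z powr p"
          using \<tau> p1 by (cases "D t z = 0") (auto simp: powr_mult powr_diff D_def)
        finally show ?thesis using \<tau> by (simp add: add_increasing2)
      qed (simp add: add_increasing)
      then have "ennreal (D t z) \<le> ennreal (\<tau> powr (p - 1)) * ennreal (D t z powr p) + ennreal (1 / \<tau>)"
        using \<tau> by (simp add: ennreal_leI flip: ennreal_plus ennreal_mult')
      then show "indicator I z * ennreal (D t z) \<le>
          ennreal (\<tau> powr (p - 1)) * (indicator I z * ennreal (D t z powr p)) + ennreal (1 / \<tau>) * indicator I z"
        by (simp add: indicator_def)
    qed
    also have "\<dots> = ennreal (\<tau> powr (p - 1)) * (\<integral>\<^sup>+z. indicator I z * ennreal (D t z powr p) \<partial>lborel) +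
        ennreal (1 / \<tau>) * ennreal (\<omega> * \<rho> powr n)"
      by (subst nn_integral_add) (auto simp: nn_integral_cmult nn_integral_cmult_indicator emI)
    also have "\<dots> \<le> ennreal (\<tau> powr (p - 1)) * ennreal (t powr - n * (K * \<rho> powr (n - p))) +
        ennreal (1 / \<tau>) * ennreal (\<omega> * \<rho> powr n)"
    proof (intro add_right_mono mult_left_mono)
      define f where "f y = indicator I y * ennreal (norm (grad w y) powr p)" for y
      have [measurable]: "f \<in> borel_measurable borel" unfolding f_def by measurable
      have "indicator I z * ennreal (D t z powr p) \<le> f ((x - t *\<^sub>R x) + t *\<^sub>R z)" for z
      proof (cases "z \<in> I")
        case True
        have "(1 - t) *\<^sub>R x + t *\<^sub>R z \<in> I"
          using convex_ball[of a \<rho>] x True t unfolding I_def by (intro convexD) auto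
        moreover have "(1 - t) *\<^sub>R x + t *\<^sub>R z = (x - t *\<^sub>R x) + t *\<^sub>R z"
          and "x + t *\<^sub>R (z - x) = (x - t *\<^sub>R x) + t *\<^sub>R z"
          by (simp_all add: algebra_simps)
        ultimately show ?thesis using True by (simp only: f_def D_def indicator_simps)
      qed simp
      then have "(\<integral>\<^sup>+z. indicator I z * ennreal (D t z powr p) \<partial>lborel) \<le>
          (\<integral>\<^sup>+z. f ((x - t *\<^sub>R x) + t *\<^sub>R z) \<partial>lborel)"
        by (rule nn_integral_mono)
      also have "\<dots> = ennreal (t powr - n) * (ennreal (t powr n) * (\<integral>\<^sup>+z. f ((x - t *\<^sub>R x) + t *\<^sub>R z) \<partial>lborel))"
        using t by (simp add: mult.assoc[symmetric] flip: ennreal_mult powr_add)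
      also have "ennreal (t powr n) * (\<integral>\<^sup>+z. f ((x - t *\<^sub>R x) + t *\<^sub>R z) \<partial>lborel) = (\<integral>\<^sup>+z. f z \<partial>lborel)"
        using nn_integral_lborel_affine[of f t "x - t *\<^sub>R x"] t by (simp add: n_def powr_realpow)
      also have "(\<integral>\<^sup>+z. f z \<partial>lborel) \<le> ennreal (K * \<rho> powr (n - p))"
        using energy unfolding f_def n_def I_def .
      finally show "(\<integral>\<^sup>+z. indicator I z * ennreal (D t z powr p) \<partial>lborel) \<le>
          ennreal (t powr - n * (K * \<rho> powr (n - p)))"
        by (simp add: mult_left_mono ennreal_mult')
    qed auto
    also have "\<dots> = ennreal (\<tau> powr (p - 1) * (t powr - n * (K * \<rho> powr (n - p))) + 1 / \<tau> * (\<omega> * \<rho> powr n))"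
    proof -
      have "ennreal b * ennreal c + ennreal d * ennreal e = ennreal (b * c + d * e)"
        if "b \<ge> 0" "c \<ge> 0" "d \<ge> 0" "e \<ge> 0" for b c d e
        using that by (simp add: ennreal_mult)
      then show ?thesis using K \<omega> \<tau> by simp
    qed
    also have "\<tau> powr (p - 1) * (t powr - n * (K * \<rho> powr (n - p))) + 1 / \<tau> * (\<omega> * \<rho> powr n) =
        \<rho> powr (n - 1) * (K + \<omega>) * t powr - q"
    proof -
      have "\<tau> powr (p - 1) * (t powr - n * (K * \<rho> powr (n - p))) =
          K * (\<rho> powr (p - 1) * \<rho> powr (n - p)) * (t powr (q * (p - 1)) * t powr - n)"
        using \<rho> t by (simp add: \<tau>_def powr_mult powr_powr)
      also have "\<dots> = K * \<rho> powr (n - 1) * t powr (q * (p - 1) - n)"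
        by (simp flip: powr_add)
      also have "q * (p - 1) - n = - q" using p1 by (simp add: q_def field_simps)
      finally have 1: "\<tau> powr (p - 1) * (t powr - n * (K * \<rho> powr (n - p))) = K * \<rho> powr (n - 1) * t powr - q" .
      have "1 / \<tau> * (\<omega> * \<rho> powr n) = \<omega> * \<rho> powr (n - 1) * t powr - q"
        using \<rho> t by (simp add: \<tau>_def powr_minus powr_diff field_simps)
      with 1 show ?thesis by (simp add: algebra_simps)
    qed
    finally show ?thesis .
  qed
  have "(\<integral>\<^sup>+z. indicator I z * ennreal \<bar>w x - w z\<bar> \<partial>lborel) \<le>
      (\<integral>\<^sup>+z. \<integral>\<^sup>+t. indicator {0<..1} t * (ennreal (2 * \<rho>) * (indicator I z * ennreal (D t z))) \<partial>lborel \<partial>lborel)"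
  proof (rule nn_integral_mono)
    fix z
    show "indicator I z * ennreal \<bar>w x - w z\<bar> \<le>
        (\<integral>\<^sup>+t. indicator {0<..1} t * (ennreal (2 * \<rho>) * (indicator I z * ennreal (D t z))) \<partial>lborel)"
    proof (cases "z \<in> I")
      case True
      have "norm (z - x) \<le> 2 * \<rho>"
        using True x dist_triangle2[of z x a] by (simp add: I_def dist_norm[symmetric] dist_commute)
      then have "ennreal (norm (z - x) * D t z) \<le> ennreal (2 * \<rho>) * ennreal (D t z)" for t
        using \<rho> by (simp add: D_def mult_right_mono ennreal_leI flip: ennreal_mult')
      then have "(\<integral>\<^sup>+t. indicator {0<..1} t * ennreal (norm (z - x) * D t z) \<partial>lborel) \<le>
          (\<integral>\<^sup>+t. indicator {0<..1} t * (ennreal (2 * \<rho>) * (indicator I z * ennreal (D t z))) \<partial>lborel)"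
        using True by (intro nn_integral_mono mult_left_mono) auto
      then show ?thesis
        using True ennreal_abs_diff_le_line_integral[OF w, of x z] unfolding D_def by simp
    qed simp
  qed
  also have "\<dots> = (\<integral>\<^sup>+t. \<integral>\<^sup>+z. indicator {0<..1} t * (ennreal (2 * \<rho>) * (indicator I z * ennreal (D t z))) \<partial>lborel \<partial>lborel)"
    by (rule lborel_pair.Fubini'[symmetric]) measurable
  also have "\<dots> \<le> (\<integral>\<^sup>+t. ennreal (2 * \<rho> powr n * (K + \<omega>)) * (indicator {0<..1} t * ennreal (t powr - q)) \<partial>lborel)"
  proof (rule nn_integral_mono)
    fix t :: real
    show "(\<integral>\<^sup>+z. indicator {0<..1} t * (ennreal (2 * \<rho>) * (indicator I z * ennreal (D t z))) \<partial>lborel) \<le>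
        ennreal (2 * \<rho> powr n * (K + \<omega>)) * (indicator {0<..1} t * ennreal (t powr - q))"
    proof (cases "0 < t \<and> t \<le> 1")
      case True
      then have "(\<integral>\<^sup>+z. indicator {0<..1} t * (ennreal (2 * \<rho>) * (indicator I z * ennreal (D t z))) \<partial>lborel)
          = ennreal (2 * \<rho>) * (\<integral>\<^sup>+z. indicator I z * ennreal (D t z) \<partial>lborel)"
        by (simp add: nn_integral_cmult)
      also have "\<dots> \<le> ennreal (2 * \<rho>) * ennreal (\<rho> powr (n - 1) * (K + \<omega>) * t powr - q)"
        using True by (intro mult_left_mono inner) auto
      also have "\<dots> = ennreal (2 * \<rho> powr n * (K + \<omega>) * t powr - q)"
        using \<rho> K \<omega> by (simp add: powr_diff flip: ennreal_mult)
      also have "\<dots> = ennreal (2 * \<rho> powr n * (K + \<omega>)) * (indicator {0<..1} t * ennreal (t powr - q))"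
        using True K \<omega> by (simp add: ennreal_mult)
      finally show ?thesis .
    qed auto
  qed
  also have "\<dots> = ennreal (2 * \<rho> powr n * (K + \<omega>)) * ennreal (1 / (1 - q))"
    using nn_integral_powr_unit_interval[OF q] by (simp add: nn_integral_cmult)
  also have "\<dots> = ennreal (2 * \<rho> powr n * (K + \<omega>) / (1 - q))"
    using K \<omega> q by (simp flip: ennreal_mult)
  finally show ?thesis
    using \<rho> by (simp add: I_def \<omega>_def q_def n_def powr_realpow)
qed

text \<open>Average the triangle inequality over intermediate points \<open>z\<close> of the ball.
  The n-th power of the radius cancels, so the bound does not depend on the scale.\<close>

lemma Morrey_oscillation:
  fixes w :: "real^'n \<Rightarrow> real" and p :: real
  assumes w: "smooth w" and p: "p > CARD('n)" and \<rho>: "\<rho> > 0" and K: "K \<ge> 0"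
    and energy: "(\<integral>\<^sup>+z. indicator (ball a \<rho>) z * ennreal (norm (grad w z) powr p) \<partial>lborel)
      \<le> ennreal (K * \<rho> powr (real CARD('n) - p))"
    and x: "x \<in> ball a \<rho>" and y: "y \<in> ball a \<rho>"
  shows "\<bar>w x - w y\<bar> \<le>
    4 * (K + unit_ball_vol CARD('n)) / ((1 - CARD('n) / p) * unit_ball_vol CARD('n))"
proof -
  define \<omega> where "\<omega> = unit_ball_vol CARD('n)"
  define I where "I = ball a \<rho>"
  define M where "M = 2 * \<rho> ^ CARD('n) * (K + \<omega>) / (1 - CARD('n) / p)"
  have \<omega>: "\<omega> > 0" by (simp add: \<omega>_def)
  have p0: "p > 0" using p by (rule le_less_trans[rotated]) simp
  have q: "1 - CARD('n) / p > 0" using p p0 by simp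
  have M: "M \<ge> 0" using \<omega> q \<rho> K by (simp add: M_def)
  have [measurable]: "I \<in> sets borel" "w \<in> borel_measurable borel"
    using borel_measurable_continuous_onI[OF smooth_continuous_on[OF w]] by (auto simp: I_def)
  have "ennreal (\<bar>w x - w y\<bar> * (\<omega> * \<rho> ^ CARD('n))) = (\<integral>\<^sup>+z. ennreal \<bar>w x - w y\<bar> * indicator I z \<partial>lborel)"
    using \<rho> \<omega> by (simp add: nn_integral_cmult_indicator I_def emeasure_ball \<omega>_def ennreal_mult)
  also have "\<dots> \<le> (\<integral>\<^sup>+z. indicator I z * ennreal \<bar>w x - w z\<bar> + indicator I z * ennreal \<bar>w y - w z\<bar> \<partial>lborel)"
    by (intro nn_integral_mono) (auto simp: indicator_def ennreal_leI simp flip: ennreal_plus)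
  also have "\<dots> = (\<integral>\<^sup>+z. indicator I z * ennreal \<bar>w x - w z\<bar> \<partial>lborel) +
      (\<integral>\<^sup>+z. indicator I z * ennreal \<bar>w y - w z\<bar> \<partial>lborel)"
    by (rule nn_integral_add) measurable
  also have "\<dots> \<le> ennreal M + ennreal M"
    unfolding I_def M_def \<omega>_def
    using Morrey_mean_oscillation[OF w p \<rho> K energy x] Morrey_mean_oscillation[OF w p \<rho> K energy y]
    by (intro add_mono)
  also have "\<dots> = ennreal (2 * M)" using M by (simp flip: ennreal_plus)
  finally have "\<bar>w x - w y\<bar> * (\<omega> * \<rho> ^ CARD('n)) \<le> 2 * M" using M by simp
  also have "2 * M = (4 * (K + \<omega>) / ((1 - CARD('n) / p) * \<omega>)) * (\<omega> * \<rho> ^ CARD('n))"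
    using \<omega> q by (simp add: M_def)
  finally show ?thesis using \<omega> \<rho> unfolding \<omega>_def by (subst (asm) mult_le_cancel_right_pos) auto
qed

section \<open>The energy estimate\<close>

lemma smooth_ln:
  assumes "smooth f" "\<And>x. f x > 0"
  shows "smooth (\<lambda>x. ln (f x))" and "grad (\<lambda>x. ln (f x)) x = (1 / f x) *\<^sub>R grad f x"
proof -
  have *: "((\<lambda>x. ln (f x)) has_derivative (\<lambda>v. (1 / f x) * (grad f x \<bullet> v))) (at x)" for x
    by (rule has_derivative_eq_rhs, rule has_derivative_compose[OF smooth_has_derivative[OF assms(1)]
          DERIV_ln_divide[OF assms(2), unfolded has_field_derivative_def]]) simp
  then show "grad (\<lambda>x. ln (f x)) x = (1 / f x) *\<^sub>R grad f x"
    by (intro grad_eqI) simp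
  have "smooth (\<lambda>x. f x powr - 1 * (grad f x \<bullet> v))" for v
    by (intro smooth_mult smooth_powr smooth_grad_inner assms)
  then have "smooth (\<lambda>x. (1 / f x) * (grad f x \<bullet> v))" for v
    using assms(2) by (simp add: powr_minus_divide less_imp_le)
  then show "smooth (\<lambda>x. ln (f x))"
    by (rule smoothI[OF *])
qed

lemma grad_powr:
  assumes "smooth f" "\<And>x. f x > 0"
  shows "grad (\<lambda>x. f x powr s) x = (s * f x powr (s - 1)) *\<^sub>R grad f x"
proof (rule grad_eqI)
  show "((\<lambda>x. f x powr s) has_derivative (\<lambda>v. ((s * f x powr (s - 1)) *\<^sub>R grad f x) \<bullet> v)) (at x)"
    by (rule has_derivative_eq_rhs, rule has_derivative_compose[OF smooth_has_derivative[OF assms(1)]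
          has_real_derivative_powr[OF assms(2), unfolded has_field_derivative_def]]) simp
qed

lemma grad_const_add: "smooth f \<Longrightarrow> grad (\<lambda>x. c + f x) x = grad f x"
  using smooth_has_derivative[of f x] by (intro grad_eqI) (auto intro!: derivative_eq_intros)

text \<open>
  \<open>V\<close> stands for \<open>K + u\<close> or \<open>K - u\<close> on the ball of radius \<open>R\<close>, extended by \<open>0\<close>; \<open>F\<close> for its weak
  gradient; and \<open>A\<close> and \<open>B\<close> for the coefficients of the equation evaluated along \<open>u\<close>, up to the sign
  of \<open>u\<close>. All of them are Borel functions, so that Fubini's theorem applies.
\<close>

locale normalized_solution =
  fixes p a0 a1 b1 R :: real and V :: "real^'n \<Rightarrow> real" and F A :: "real^'n \<Rightarrow> real^'n"
    and B :: "real^'n \<Rightarrow> real"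
  assumes p: "p > CARD('n)" and a0: "a0 > 0" and a1: "a1 \<ge> 0" and b1: "b1 \<ge> 0"
    and V_integrable: "integrable lborel V" and V_nonneg: "V x \<ge> 0"
    and V_outside: "norm x > R \<Longrightarrow> V x = 0"
    and F_measurable: "F \<in> borel_measurable borel"
    and F_integrable: "integrable lborel (\<lambda>x. norm (F x) powr p)"
    and F_outside: "norm x > R \<Longrightarrow> F x = 0"
    and weak_gradient: "\<phi> \<in> test_functions (ball 0 R) \<Longrightarrow>
      (\<integral>y. V y *\<^sub>R grad \<phi> y \<partial>lborel) = - (\<integral>y. \<phi> y *\<^sub>R F y \<partial>lborel)"
    and A_measurable: "A \<in> borel_measurable borel" and B_measurable: "B \<in> borel_measurable borel"
    and growth: "AE x in lborel. a0 * norm (F x) powr p \<le> A x \<bullet> F x \<and>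
      norm (A x) \<le> a1 * norm (F x) powr (p - 1) \<and> \<bar>B x\<bar> * norm x \<le> b1 * norm (F x) powr (p - 1)"
    and equation: "\<phi> \<in> test_functions (ball 0 R) \<Longrightarrow>
      (\<integral>x. A x \<bullet> grad \<phi> x \<partial>lborel) + (\<integral>x. B x * \<phi> x \<partial>lborel) = 0"
begin

lemma p_gt_1: "p > 1"
  using p less_le_trans[of 1 "real CARD('n)" p] by (cases "CARD('n) = 1") (auto simp: Suc_lessI)

lemmas [measurable] = F_measurable A_measurable B_measurable

lemma F_fin: "(\<integral>\<^sup>+x. ennreal (norm (F x) powr p) \<partial>lborel) < top"
  using F_integrable by (subst nn_integral_eq_integral) auto

text \<open>Through the growth conditions this makes both integrands of the equation integrable. As
  the support is bounded, |F|^(p-1) \<le> 1 + |F|^p suffices.\<close>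

lemma F_powr_integrable: "integrable lborel (\<lambda>x. norm (F x) powr (p - 1))"
proof (rule Bochner_Integration.integrable_bound)
  show "integrable lborel (\<lambda>x. indicator (cball 0 R) x + norm (F x) powr p)"
    using F_integrable emeasure_lborel_cball_finite[of "0::real^'n" R]
    by (intro Bochner_Integration.integrable_add integrable_real_indicator) auto
  show "AE x in lborel. norm (norm (F x) powr (p - 1)) \<le> norm (indicator (cball 0 R) x + norm (F x) powr p)"
  proof (intro always_eventually allI)
    fix x
    show "norm (norm (F x) powr (p - 1)) \<le> norm (indicator (cball 0 R) x + norm (F x) powr p)"
    proof (cases "norm x \<le> R")
      case True
      have "norm (F x) powr (p - 1) \<le> 1 + norm (F x) powr p"
      proof (cases "norm (F x) \<le> 1")
        case True
        then have "norm (F x) powr (p - 1) \<le> 1 powr (p - 1)" using p_gt_1 by (intro powr_mono2) auto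
        then show ?thesis by (simp add: add_increasing2)
      next
        case False
        then have "norm (F x) powr (p - 1) \<le> norm (F x) powr p" by (intro powr_mono) auto
        then show ?thesis by simp
      qed
      then show ?thesis using True by simp
    qed (simp add: F_outside)
  qed
qed measurable

text \<open>8 p^2 is the constant of \<open>norm_grad_bump_le\<close>, multiplied by the growth
  bound \<open>a1\<close>; \<open>b1\<close> is the lower order contribution. Both occur divided by
  the radius of the ball, so they are merged.\<close>

definition weight_const :: real where "weight_const = 8 * p\<^sup>2 * a1 + b1"

lemma weight_const: "weight_const \<ge> 0"
  using a1 b1 by (simp add: weight_const_def)

text \<open>The left side is the integrand of the equation for the bump times W powr (1 - p), with
  \<open>g\<close> the gradient of \<open>W\<close>. Coercivity holds along \<open>F\<close>, not
  along \<open>g\<close>; exchanging them costs |A| |F - g|, split by Young's inequality with weight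
  \<open>\<kappa>\<close>, and \<open>W \<ge> \<epsilon>\<close> bounds the coefficient. Coercivity
  yields -2 \<theta> times the energy density, of which one \<theta> is spent on absorbing the
  cutoff and lower order terms.\<close>

lemma energy_pointwise:
  fixes x x0 g :: "real^'n"
  assumes \<rho>: "\<rho> > 0" and \<epsilon>: "\<epsilon> > 0" and \<kappa>: "\<kappa> > 0" and \<theta>: "\<theta> = (p - 1) * a0 / 2"
    and W: "W \<ge> \<epsilon>" and x: "norm x \<ge> \<rho>"
    and str: "a0 * norm (F x) powr p \<le> A x \<bullet> F x" "norm (A x) \<le> a1 * norm (F x) powr (p - 1)"
      "\<bar>B x\<bar> * norm x \<le> b1 * norm (F x) powr (p - 1)"
  defines "Z \<equiv> bump x0 \<rho> x"
  shows "A x \<bullet> (W powr (1 - p) *\<^sub>R grad (bump x0 \<rho>) x + (Z * ((1 - p) * W powr - p)) *\<^sub>R g) +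
      B x * (Z * W powr (1 - p)) \<le>
    - \<theta> * (Z * (norm (F x) / W) powr p) +
      ((p - 1) * \<epsilon> powr - p * a1 * (\<kappa> * norm (F x) powr p + \<kappa> powr (1 - p) * norm (F x - g) powr p) +
       \<theta> powr (1 - p) * (weight_const / \<rho>) powr p)"
proof -
  define f where "f = norm (F x)"
  define X where "X = f / W"
  have W0: "W > 0" using W \<epsilon> by simp
  have p1: "p > 1" by (rule p_gt_1)
  have Z: "0 \<le> Z" "Z \<le> 1" by (auto simp: Z_def bump_nonneg bump_le_1)
  have f: "f \<ge> 0" by (simp add: f_def)
  have X: "X \<ge> 0" using f W0 by (simp add: X_def)
  have \<theta>0: "\<theta> > 0" using p1 a0 by (simp add: \<theta>)
  have Xp: "X powr p = f powr p * W powr - p" "X powr (p - 1) = f powr (p - 1) * W powr (1 - p)"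
    using f W0 powr_minus_divide[of W "p - 1"] by (simp_all add: X_def powr_divide powr_minus_divide)
  have Wp: "Z * W powr - p \<le> \<epsilon> powr - p"
  proof -
    have "W powr - p \<le> \<epsilon> powr - p" using W \<epsilon> p1 by (intro powr_mono2') auto
    then have "Z * W powr - p \<le> 1 * \<epsilon> powr - p" using Z by (intro mult_mono) auto
    then show ?thesis by simp
  qed
  have t1: "A x \<bullet> grad (bump x0 \<rho>) x * W powr (1 - p) \<le>
      a1 * (8 * p\<^sup>2 / \<rho> * Z powr ((p - 1) / p)) * X powr (p - 1)"
  proof -
    have "A x \<bullet> grad (bump x0 \<rho>) x \<le> norm (A x) * norm (grad (bump x0 \<rho>) x)"
      using Cauchy_Schwarz_ineq2[of "A x" "grad (bump x0 \<rho>) x"] by linarith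
    also have "\<dots> \<le> (a1 * f powr (p - 1)) * (8 * p\<^sup>2 / \<rho> * Z powr ((p - 1) / p))"
      using str(2) norm_grad_bump_le[OF p1 \<rho>, of x0 x] a1 unfolding f_def Z_def
      by (intro mult_mono) auto
    finally show ?thesis
      using mult_right_mono[of _ _ "W powr (1 - p)"] by (fastforce simp: Xp mult_ac)
  qed
  have t3: "B x * (Z * W powr (1 - p)) \<le> b1 / \<rho> * Z powr ((p - 1) / p) * X powr (p - 1)"
  proof -
    have "\<bar>B x\<bar> * \<rho> \<le> \<bar>B x\<bar> * norm x" using x by (intro mult_left_mono) auto
    then have "\<bar>B x\<bar> * \<rho> \<le> b1 * f powr (p - 1)" using str(3) by (simp add: f_def)
    moreover have "B x * \<rho> \<le> \<bar>B x\<bar> * \<rho>" using \<rho> by (intro mult_right_mono) auto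
    ultimately have "B x * \<rho> \<le> b1 * f powr (p - 1)" by linarith
    then have "B x \<le> b1 / \<rho> * f powr (p - 1)" using \<rho> by (simp add: field_simps)
    then have "B x * (Z * W powr (1 - p)) \<le> b1 / \<rho> * f powr (p - 1) * (Z * W powr (1 - p))"
      using Z by (intro mult_right_mono) auto
    also have "\<dots> = b1 / \<rho> * Z * X powr (p - 1)" by (simp add: Xp)
    also have "\<dots> \<le> b1 / \<rho> * Z powr ((p - 1) / p) * X powr (p - 1)"
    proof (intro mult_right_mono mult_left_mono)
      \<comment> \<open>As 0 \<le> Z \<le> 1, a smaller exponent brings the lower order term into
        the form of the cutoff term.\<close>
      have "Z powr 1 \<le> Z powr ((p - 1) / p)" using Z p1 by (intro powr_mono') (auto simp: field_simps)
      then show "Z \<le> Z powr ((p - 1) / p)" using Z by simp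
    qed (use b1 \<rho> in auto)
    finally show ?thesis .
  qed
  \<comment> \<open>Both factors combine into powers of the single base Z^(1/p) X, whose p-th power
    is exactly the energy density.\<close>
  have Y: "(weight_const / \<rho>) * (Z powr ((p - 1) / p) * X powr (p - 1)) \<le>
      \<theta> * (Z * X powr p) + (weight_const / \<rho>) powr p * \<theta> powr (1 - p)"
  proof -
    have "Z powr ((p - 1) / p) * X powr (p - 1) = (Z powr (1 / p) * X) powr (p - 1)"
      using Z X by (simp add: powr_mult powr_powr)
    moreover have "Z * X powr p = (Z powr (1 / p) * X) powr p"
      using Z X p1 by (simp add: powr_mult powr_powr)
    ultimately show ?thesis
      using Young_powr[of "weight_const / \<rho>" "Z powr (1 / p) * X" \<theta> p] weight_const \<rho> X \<theta>0 p1 by simp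
  qed
  have t2: "(Z * ((1 - p) * W powr - p)) * (A x \<bullet> g) \<le> - 2 * \<theta> * (Z * X powr p) +
      (p - 1) * \<epsilon> powr - p * a1 * (\<kappa> * f powr p + \<kappa> powr (1 - p) * norm (F x - g) powr p)"
  proof -
    define d where "d = norm (F x - g)"
    have "A x \<bullet> F x - A x \<bullet> g \<le> norm (A x) * d"
      using Cauchy_Schwarz_ineq2[of "A x" "F x - g"] by (simp add: inner_diff_right d_def)
    also have "\<dots> \<le> a1 * f powr (p - 1) * d" using str(2) by (intro mult_right_mono) (auto simp: f_def d_def)
    finally have "a0 * f powr p - a1 * (d * f powr (p - 1)) \<le> A x \<bullet> g"
      using str(1) by (simp add: f_def mult_ac)
    moreover have "d * f powr (p - 1) \<le> \<kappa> * f powr p + d powr p * \<kappa> powr (1 - p)"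
      using f \<kappa> p1 by (intro Young_powr) (auto simp: d_def)
    ultimately have "a0 * f powr p - a1 * (\<kappa> * f powr p + \<kappa> powr (1 - p) * d powr p) \<le> A x \<bullet> g"
      using a1 by (smt (verit) mult.commute mult_left_mono)
    then have "(p - 1) * (Z * W powr - p) * (a0 * f powr p - a1 * (\<kappa> * f powr p + \<kappa> powr (1 - p) * d powr p))
        \<le> (p - 1) * (Z * W powr - p) * (A x \<bullet> g)"
      using p1 Z by (intro mult_left_mono) auto
    moreover have "(Z * W powr - p) * ((p - 1) * (a1 * (\<kappa> * f powr p + \<kappa> powr (1 - p) * d powr p))) \<le>
        \<epsilon> powr - p * ((p - 1) * (a1 * (\<kappa> * f powr p + \<kappa> powr (1 - p) * d powr p)))"
      using Wp p1 a1 \<kappa> by (intro mult_right_mono) auto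
    moreover have "(p - 1) * (Z * W powr - p) * (a0 * f powr p) = 2 * \<theta> * (Z * X powr p)"
      by (simp add: \<theta> Xp)
    ultimately show ?thesis unfolding d_def[symmetric] by (simp add: algebra_simps)
  qed
  have "A x \<bullet> (W powr (1 - p) *\<^sub>R grad (bump x0 \<rho>) x + (Z * ((1 - p) * W powr - p)) *\<^sub>R g) +
      B x * (Z * W powr (1 - p)) =
    A x \<bullet> grad (bump x0 \<rho>) x * W powr (1 - p) + (Z * ((1 - p) * W powr - p)) * (A x \<bullet> g) +
      B x * (Z * W powr (1 - p))"
    by (simp add: inner_add_right mult.commute)
  moreover have "a1 * (8 * p\<^sup>2 / \<rho> * Z powr ((p - 1) / p)) * X powr (p - 1) +
      b1 / \<rho> * Z powr ((p - 1) / p) * X powr (p - 1) =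
      (weight_const / \<rho>) * (Z powr ((p - 1) / p) * X powr (p - 1))"
    using \<rho> by (simp add: weight_const_def field_simps)
  ultimately show ?thesis
    using t1 t2 t3 Y unfolding f_def[symmetric] X_def[symmetric] by (simp add: algebra_simps)
qed


lemma gradient_error_integrable:
  assumes "smooth v"
  shows "integrable lborel (\<lambda>x. indicator (ball a s) x * norm (F x - grad v x) powr p)"
proof -
  have cg: "continuous_on UNIV (grad v)" by (rule smooth_continuous_on_grad[OF assms])
  define g where "g = grad v"
  have [measurable]: "g \<in> borel_measurable borel" "ball a s \<in> sets borel"
    using cg by (auto simp: g_def intro: borel_measurable_continuous_onI)
  have "compact (grad v ` cball a s)"
    using cg continuous_on_subset by (intro compact_continuous_image) auto
  then obtain M where M: "M > 0" "\<forall>y\<in>grad v ` cball a s. norm y \<le> M"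
    using compact_imp_bounded bounded_pos by blast
  show ?thesis
    unfolding g_def[symmetric]
  proof (rule Bochner_Integration.integrable_bound)
    show "integrable lborel (\<lambda>x. 2 powr p * (norm (F x) powr p + M powr p * indicator (ball a s) x))"
      using F_integrable emeasure_lborel_ball_finite[of a s]
      by (intro integrable_mult_right Bochner_Integration.integrable_add integrable_real_indicator) auto
    show "AE x in lborel. norm (indicator (ball a s) x * norm (F x - g x) powr p) \<le>
        norm (2 powr p * (norm (F x) powr p + M powr p * indicator (ball a s) x))"
    proof (intro always_eventually allI)
      fix x
      show "norm (indicator (ball a s) x * norm (F x - g x) powr p) \<le>
        norm (2 powr p * (norm (F x) powr p + M powr p * indicator (ball a s) x))"
      proof (cases "x \<in> ball a s")
        case True
        then have "norm (g x) \<le> M" using M by (auto simp: g_def)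
        then have "norm (F x - g x) \<le> norm (F x) + M"
          using norm_triangle_ineq4[of "F x" "g x"] by linarith
        then have "norm (F x - g x) powr p \<le> (norm (F x) + M) powr p"
          using p_gt_1 by (intro powr_mono2) auto
        also have "\<dots> \<le> 2 powr p * (norm (F x) powr p + M powr p)"
          using M p_gt_1 by (intro powr_add_le) auto
        finally show ?thesis using True by simp
      qed simp
    qed
  qed measurable
qed

text \<open>The pointwise inequality is integrated, and the equation makes its left side 0. The term
  with \<open>\<kappa>\<close> runs over the whole space, since \<open>\<kappa>\<close> itself will
  be small. The gradient error is localized, because for a mollified \<open>v\<close> it is small
  only away from the sphere of radius \<open>R\<close>.\<close>

lemma energy_estimate:
  fixes x0 :: "real^'n"
  assumes \<rho>: "\<rho> > 0" "3 * \<rho> \<le> norm x0" "cball x0 (2 * \<rho>) \<subseteq> ball 0 R" and \<epsilon>: "\<epsilon> > 0" and \<kappa>: "\<kappa> > 0"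
    and v: "smooth v" "\<And>x. v x \<ge> 0" and \<theta>: "\<theta> = (p - 1) * a0 / 2"
  shows "integrable lborel (\<lambda>x. bump x0 \<rho> x * (norm (F x) / (\<epsilon> + v x)) powr p)" (is ?I)
    and "\<theta> * (\<integral>x. bump x0 \<rho> x * (norm (F x) / (\<epsilon> + v x)) powr p \<partial>lborel) \<le>
      (p - 1) * \<epsilon> powr - p * a1 * (\<kappa> * (\<integral>x. norm (F x) powr p \<partial>lborel) + \<kappa> powr (1 - p) *
        (\<integral>x. indicator (ball x0 (2 * \<rho>)) x * norm (F x - grad v x) powr p \<partial>lborel)) +
      \<theta> powr (1 - p) * (weight_const / \<rho>) powr p * (unit_ball_vol CARD('n) * (2 * \<rho>) ^ CARD('n))" (is ?E)
proof -
  define Z where "Z = bump x0 \<rho>"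
  define W where "W x = \<epsilon> + v x" for x
  define cut :: "real^'n \<Rightarrow> real" where "cut = indicator (ball x0 (2 * \<rho>))"
  define \<phi> where "\<phi> x = Z x * W x powr (1 - p)" for x
  have sZ: "smooth Z" by (simp add: Z_def smooth_bump)
  have W: "W x \<ge> \<epsilon>" "W x > 0" for x using v(2)[of x] \<epsilon> by (auto simp: W_def)
  have sW: "smooth W" unfolding W_def by (intro smooth_add smooth_const v)
  have sWp: "smooth (\<lambda>x. W x powr s)" for s by (rule smooth_powr[OF sW W(2)])
  have s\<phi>: "smooth \<phi>" unfolding \<phi>_def by (intro smooth_mult sZ sWp)
  have gW: "grad W x = grad v x" for x unfolding W_def by (rule grad_const_add[OF v(1)])
  have g\<phi>: "grad \<phi> x = W x powr (1 - p) *\<^sub>R grad Z x + (Z x * ((1 - p) * W x powr - p)) *\<^sub>R grad v x" for x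
    unfolding \<phi>_def by (subst grad_mult[OF sZ sWp], subst grad_powr[OF sW W(2)]) (simp add: gW)
  have Z0: "Z x = 0" if "x \<notin> ball x0 (2 * \<rho>)" for x
    using bump_eq_0[OF \<rho>(1), of x x0] that by (simp add: Z_def dist_norm norm_minus_commute)
  have gZ0: "grad Z x = 0" if "x \<notin> ball x0 (2 * \<rho>)" for x
    using norm_grad_bump_le[OF p_gt_1 \<rho>(1), of x0 x] Z0[OF that] by (simp add: Z_def)
  have Zt: "Z \<in> test_functions (ball 0 R)"
    unfolding Z_def by (rule bump_in_test_functions[OF \<rho>(1,3)])
  have \<phi>t: "\<phi> \<in> test_functions (ball 0 R)"
  proof (rule test_functionsI[OF s\<phi>])
    show "{x. \<phi> x \<noteq> 0} \<subseteq> closure {x. Z x \<noteq> 0}"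
      using closure_subset[of "{x. Z x \<noteq> 0}"] by (auto simp: \<phi>_def)
  qed (use Zt in \<open>auto simp: test_functions_def\<close>)
  have [measurable]: "cut \<in> borel_measurable borel"
    unfolding cut_def by (rule borel_measurable_indicator) simp
  have [measurable]: "Z \<in> borel_measurable borel" "W \<in> borel_measurable borel"
    "\<phi> \<in> borel_measurable borel" "grad \<phi> \<in> borel_measurable borel"
    using sZ sW s\<phi> smooth_continuous_on smooth_continuous_on_grad
    by (auto intro!: borel_measurable_continuous_onI)
  obtain M where M: "M > 0" "\<And>x. norm (\<phi> x) \<le> M"
    using continuous_vanishing_bounded[of \<phi> R] smooth_continuous_on[OF s\<phi>] test_functions_0_outside[OF \<phi>t]
    by (metis mem_ball_0 order_less_imp_not_less)
  obtain M' where M': "M' > 0" "\<And>x. norm (grad \<phi> x) \<le> M'"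
    using continuous_vanishing_bounded[of "grad \<phi>" R] smooth_continuous_on_grad[OF s\<phi>]
      test_functions_0_outside[OF \<phi>t]
    by (metis mem_ball_0 order_less_imp_not_less)
  \<comment> \<open>3 \<rho> minus the radius 2 \<rho>. This turns the bound on
    \<open>\<bar>B x\<bar> * norm x\<close> into one on \<open>\<bar>B x\<bar>\<close>.\<close>
  have far: "norm x \<ge> \<rho>" if "x \<in> ball x0 (2 * \<rho>)" for x
    using that \<rho>(2) norm_triangle_ineq2[of x0 x] by (simp add: dist_norm)
  have iA: "integrable lborel (\<lambda>x. A x \<bullet> grad \<phi> x)"
  proof (rule Bochner_Integration.integrable_bound)
    show "integrable lborel (\<lambda>x. a1 * M' * norm (F x) powr (p - 1))" using F_powr_integrable by simp
    show "AE x in lborel. norm (A x \<bullet> grad \<phi> x) \<le> norm (a1 * M' * norm (F x) powr (p - 1))"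
      using growth
    proof eventually_elim
      case (elim x)
      have "norm (A x \<bullet> grad \<phi> x) \<le> norm (A x) * norm (grad \<phi> x)"
        using Cauchy_Schwarz_ineq2 by simp
      also have "\<dots> \<le> (a1 * norm (F x) powr (p - 1)) * M'"
        using elim M' a1 by (intro mult_mono) auto
      finally show ?case using a1 M' by (simp add: abs_mult mult_ac)
    qed
  qed measurable
  have iB: "integrable lborel (\<lambda>x. B x * \<phi> x)"
  proof (rule Bochner_Integration.integrable_bound)
    show "integrable lborel (\<lambda>x. b1 / \<rho> * M * norm (F x) powr (p - 1))" using F_powr_integrable by simp
    show "AE x in lborel. norm (B x * \<phi> x) \<le> norm (b1 / \<rho> * M * norm (F x) powr (p - 1))"
      using growth
    proof eventually_elim
      case (elim x)
      show ?case
      proof (cases "x \<in> ball x0 (2 * \<rho>)")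
        case True
        have "\<bar>B x\<bar> * \<rho> \<le> \<bar>B x\<bar> * norm x" using far[OF True] by (intro mult_left_mono) auto
        then have "\<bar>B x\<bar> \<le> b1 / \<rho> * norm (F x) powr (p - 1)" using elim \<rho>(1) by (simp add: field_simps)
        then have "\<bar>B x\<bar> * norm (\<phi> x) \<le> b1 / \<rho> * norm (F x) powr (p - 1) * M"
          using M b1 \<rho> by (intro mult_mono) auto
        then show ?thesis using b1 \<rho> M by (simp add: abs_mult mult_ac)
      qed (simp add: \<phi>_def Z0)
    qed
  qed measurable
  have W_le: "(norm (F x) / W x) powr p \<le> \<epsilon> powr - p * norm (F x) powr p" for x
  proof -
    have "(norm (F x) / W x) powr p \<le> (norm (F x) / \<epsilon>) powr p"
      using W[of x] \<epsilon> p_gt_1 by (intro powr_mono2 divide_left_mono) auto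
    then show ?thesis using \<epsilon> by (simp add: powr_divide powr_minus field_simps)
  qed
  have iZ: "integrable lborel (\<lambda>x. Z x * (norm (F x) / W x) powr p)"
  proof (rule Bochner_Integration.integrable_bound)
    show "integrable lborel (\<lambda>x. \<epsilon> powr - p * norm (F x) powr p)" using F_integrable by simp
    show "AE x in lborel. norm (Z x * (norm (F x) / W x) powr p) \<le> norm (\<epsilon> powr - p * norm (F x) powr p)"
    proof (intro always_eventually allI)
      fix x
      have "Z x * (norm (F x) / W x) powr p \<le> 1 * (\<epsilon> powr - p * norm (F x) powr p)"
        using W_le bump_le_1[of x0 \<rho> x] by (intro mult_mono) (auto simp: Z_def)
      then show "norm (Z x * (norm (F x) / W x) powr p) \<le> norm (\<epsilon> powr - p * norm (F x) powr p)"
        using bump_nonneg[of x0 \<rho> x] by (simp add: Z_def)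
    qed
  qed measurable
  then show ?I by (simp add: Z_def W_def)
  have icut: "integrable lborel cut"
    unfolding cut_def using emeasure_lborel_ball_finite[of x0 "2 * \<rho>"]
    by (intro integrable_real_indicator) auto
  have id: "integrable lborel (\<lambda>x. cut x * norm (F x - grad v x) powr p)"
    unfolding cut_def by (rule gradient_error_integrable[OF v(1)])
  define c where "c = (p - 1) * \<epsilon> powr - p * a1"
  define c' where "c' = \<theta> powr (1 - p) * (weight_const / \<rho>) powr p"
  have c: "c \<ge> 0" "c' \<ge> 0" using p_gt_1 a1 by (auto simp: c_def c'_def)
  have "0 = (\<integral>x. A x \<bullet> grad \<phi> x + B x * \<phi> x \<partial>lborel)"
    using equation[OF \<phi>t] iA iB by (simp add: Bochner_Integration.integral_add)
  also have "\<dots> \<le> (\<integral>x. - \<theta> * (Z x * (norm (F x) / W x) powr p) + (c * \<kappa> * norm (F x) powr p +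
      c * \<kappa> powr (1 - p) * (cut x * norm (F x - grad v x) powr p) + c' * cut x) \<partial>lborel)"
  proof (rule integral_mono_AE)
    show "AE x in lborel. A x \<bullet> grad \<phi> x + B x * \<phi> x \<le>
      - \<theta> * (Z x * (norm (F x) / W x) powr p) + (c * \<kappa> * norm (F x) powr p +
      c * \<kappa> powr (1 - p) * (cut x * norm (F x - grad v x) powr p) + c' * cut x)"
      using growth
    proof eventually_elim
      case (elim x)
      show ?case
      proof (cases "x \<in> ball x0 (2 * \<rho>)")
        case True
        then show ?thesis
          using energy_pointwise[OF \<rho>(1) \<epsilon> \<kappa> \<theta> W(1)[of x] far[OF True], of x0 "grad v x"] elim
          unfolding g\<phi> \<phi>_def Z_def[symmetric] c_def[symmetric] c'_def[symmetric]
          by (simp add: cut_def algebra_simps)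
      next
        case False
        then show ?thesis using c \<kappa> by (simp add: g\<phi> \<phi>_def Z0 gZ0 cut_def)
      qed
    qed
  qed (use iA iB iZ id icut F_integrable in auto)
  also have "\<dots> = - \<theta> * (\<integral>x. Z x * (norm (F x) / W x) powr p \<partial>lborel) +
      (c * \<kappa> * (\<integral>x. norm (F x) powr p \<partial>lborel) +
       c * \<kappa> powr (1 - p) * (\<integral>x. cut x * norm (F x - grad v x) powr p \<partial>lborel) + c' * (\<integral>x. cut x \<partial>lborel))"
    using iZ id icut F_integrable by simp
  also have "(\<integral>x. cut x \<partial>lborel) = unit_ball_vol CARD('n) * (2 * \<rho>) ^ CARD('n)"
    using \<rho>(1) by (simp add: cut_def content_ball)
  finally show ?E
    unfolding c_def[symmetric] c'_def[symmetric] cut_def[symmetric] Z_def[symmetric] W_def[symmetric]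
    by (simp add: algebra_simps)
qed

end

section \<open>Harnack's inequality\<close>

text \<open>
  A chain of balls along a ray is obtained by multiplying the odds \<open>s / (R - s)\<close> of the distance \<open>s\<close>
  to the origin repeatedly by \<open>4 / 5\<close>, so that its length is logarithmic in the ratio of the odds.
\<close>

lemma odds_step:
  fixes \<sigma> R s s' :: real
  assumes "\<sigma> > 0" "R > 0"
  defines "s \<equiv> R * \<sigma> / (1 + \<sigma>)" and "s' \<equiv> R * (4 / 5 * \<sigma>) / (1 + 4 / 5 * \<sigma>)"
  shows "0 < s" "s < R" "0 < s'" "s' < s" "s - s' < min s (R - s) / 3"
proof -
  have s: "R - s = R / (1 + \<sigma>)" using assms by (simp add: s_def field_simps)
  show "0 < s" "0 < s'" using assms by (auto simp: s_def s'_def intro!: divide_pos_pos add_pos_pos)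
  show "s < R" using s assms by (smt (verit) divide_pos_pos)
  have d: "s - s' = R / (1 + \<sigma>) * (\<sigma> / (5 + 4 * \<sigma>))"
    using assms by (simp add: s_def s'_def divide_simps add_pos_pos) (simp add: algebra_simps)
  have Rp: "R / (1 + \<sigma>) > 0" using assms by simp
  have q: "0 < \<sigma> / (5 + 4 * \<sigma>)" "\<sigma> / (5 + 4 * \<sigma>) < 1 / 3" "\<sigma> / (5 + 4 * \<sigma>) < \<sigma> / 3"
    using assms by (auto simp: divide_simps)
  show "s' < s" using d Rp q(1) by (smt (verit) mult_pos_pos)
  have A: "s - s' < R / (1 + \<sigma>) * (1 / 3)" unfolding d by (rule mult_strict_left_mono[OF q(2) Rp])
  have B: "s - s' < R / (1 + \<sigma>) * (\<sigma> / 3)" unfolding d by (rule mult_strict_left_mono[OF q(3) Rp])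
  have "R / (1 + \<sigma>) * (1 / 3) = (R - s) / 3" unfolding s by simp
  moreover have "R / (1 + \<sigma>) * (\<sigma> / 3) = s / 3" by (simp add: s_def)
  ultimately have "s - s' < (R - s) / 3" "s - s' < s / 3" using A B by linarith+
  then show "s - s' < min s (R - s) / 3" by (cases "s \<le> R - s") (simp_all only: min_def if_True if_False)
qed

text \<open>
  The first summand \<open>1\<close> and the last one leave room for the mollification errors.
\<close>

definition energy_const :: "real \<Rightarrow> real \<Rightarrow> real \<Rightarrow> real \<Rightarrow> real \<Rightarrow> real" where
  "energy_const n p a0 a1 b1 = (let \<theta> = (p - 1) * a0 / 2 in 2 powr p * (exp (1 / 3) *
     ((1 + \<theta> powr (1 - p) * (8 * p\<^sup>2 * a1 + b1) powr p * (unit_ball_vol n * 2 powr n)) / \<theta>) + 1))"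

text \<open>The constant of \<open>Morrey_oscillation\<close> with \<open>energy_const\<close> for
  K: the oscillation of the logarithm on one ball of the chain.\<close>

definition harnack_const :: "real \<Rightarrow> real \<Rightarrow> real \<Rightarrow> real \<Rightarrow> real \<Rightarrow> real" where
  "harnack_const n p a0 a1 b1 =
     4 * (energy_const n p a0 a1 b1 + unit_ball_vol n) / ((1 - n / p) * unit_ball_vol n)"

text \<open>The argument of \<open>ln\<close> is the quotient of the odds r / (r3 - r) at r2 and at
  r1. The factor 5 comes from ln (5/4) \<ge> 1/5, where 4/5 is the ratio of consecutive odds in a
  chain; the 1 rounds the number of balls up.\<close>

definition harnack_factor :: "real \<Rightarrow> real \<Rightarrow> real \<Rightarrow> real \<Rightarrow> real \<Rightarrow> real \<Rightarrow> real \<Rightarrow> real \<Rightarrow> real" where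
  "harnack_factor n p a0 a1 b1 r1 r2 r3 =
     exp (- harnack_const n p a0 a1 b1 * (1 + 5 * ln ((r2 / r1) * ((r3 - r1) / (r3 - r2)))))"

lemma energy_const_nonneg:
  assumes "p > 1" "a0 > 0" "n \<ge> 0" shows "energy_const n p a0 a1 b1 \<ge> 0"
proof -
  have "(p - 1) * a0 / 2 > 0" using assms by simp
  then show ?thesis using assms(3) by (simp add: energy_const_def Let_def)
qed

lemma harnack_const_pos:
  assumes "p > 1" "p > n" "a0 > 0" "n \<ge> 0" shows "harnack_const n p a0 a1 b1 > 0"
proof -
  have "1 - n / p > 0" using assms by simp
  then show ?thesis
    using assms energy_const_nonneg
    by (auto simp: harnack_const_def intro!: divide_pos_pos mult_pos_pos add_nonneg_pos)
qed

context normalized_solution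
begin

lemma constants:
  "energy_const (real CARD('n)) p a0 a1 b1 \<ge> 0" "harnack_const (real CARD('n)) p a0 a1 b1 > 0"
  using p_gt_1 p a0 by (auto intro!: energy_const_nonneg harnack_const_pos)

text \<open>\<open>k1\<close> and \<open>k2\<close> bound the errors of the energy estimate and
  \<open>k3\<close> that of the final passage from \<open>F\<close> to \<open>grad v\<close>, all by
  the natural size \<open>E0\<close>. Hence the bound retains neither \<open>\<epsilon>\<close> nor
  \<open>\<kappa>\<close> nor the total energy of \<open>F\<close>.\<close>

lemma log_energy:
  fixes x0 :: "real^'n" and c \<kappa> \<delta> :: real
  assumes \<rho>: "\<rho> > 0" "3 * \<rho> \<le> norm x0" "cball x0 (2 * \<rho>) \<subseteq> ball 0 R" and \<epsilon>: "\<epsilon> > 0" and \<kappa>: "\<kappa> > 0"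
    and v: "smooth v" "\<And>x. v x \<ge> 0"
    and c: "c = (p - 1) * \<epsilon> powr - p * a1"
    and E0: "E0 = \<rho> powr (CARD('n) - p)"
    and k1: "c * (\<kappa> * (\<integral>x. norm (F x) powr p \<partial>lborel)) \<le> E0 / 2"
    and d: "(\<integral>x. indicator (ball x0 (2 * \<rho>)) x * norm (F x - grad v x) powr p \<partial>lborel) \<le> \<delta>"
    and k2: "c * (\<kappa> powr (1 - p) * \<delta>) \<le> E0 / 2" and k3: "\<epsilon> powr - p * \<delta> \<le> E0"
  shows "(\<integral>\<^sup>+z. indicator (ball x0 \<rho>) z * ennreal (norm (grad (\<lambda>x. ln (\<epsilon> + v x)) z) powr p) \<partial>lborel)
      \<le> ennreal (energy_const CARD('n) p a0 a1 b1 * \<rho> powr (CARD('n) - p))"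
proof -
  define n where "n = real CARD('n)"
  define \<omega> where "\<omega> = unit_ball_vol n"
  define \<theta> where "\<theta> = (p - 1) * a0 / 2"
  have \<theta>0: "\<theta> > 0" using p_gt_1 a0 by (simp add: \<theta>_def)
  define W where "W x = \<epsilon> + v x" for x
  define h where "h x = bump x0 \<rho> x * (norm (F x) / W x) powr p" for x
  define cut :: "real^'n \<Rightarrow> real" where "cut = indicator (ball x0 (2 * \<rho>))"
  define D where "D x = cut x * norm (F x - grad v x) powr p" for x
  have W: "W x \<ge> \<epsilon>" "W x > 0" for x using v(2)[of x] \<epsilon> by (auto simp: W_def)
  have sW: "smooth W" unfolding W_def by (intro smooth_add smooth_const v)
  have h: "integrable lborel h" "\<And>x. h x \<ge> 0"
    unfolding h_def W_def by (rule energy_estimate(1)[OF \<rho> \<epsilon> \<kappa> v \<theta>_def]) (simp add: bump_nonneg)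
  have D: "integrable lborel D" "\<And>x. D x \<ge> 0"
    unfolding D_def cut_def by (rule gradient_error_integrable[OF v(1)]) simp
  define C where "C = \<theta> powr (1 - p) * (8 * p\<^sup>2 * a1 + b1) powr p * (\<omega> * 2 powr n)"
  have en: "\<theta> * (\<integral>x. h x \<partial>lborel) \<le> E0 * (1 + C)"
  proof -
    have "\<theta> * (\<integral>x. h x \<partial>lborel) \<le>
        c * (\<kappa> * (\<integral>x. norm (F x) powr p \<partial>lborel) + \<kappa> powr (1 - p) * (\<integral>x. D x \<partial>lborel)) +
        \<theta> powr (1 - p) * (weight_const / \<rho>) powr p * (\<omega> * (2 * \<rho>) ^ CARD('n))"
      using energy_estimate(2)[OF \<rho> \<epsilon> \<kappa> v \<theta>_def]
      unfolding h_def W_def D_def cut_def c \<omega>_def n_def .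
    also have "\<theta> powr (1 - p) * (weight_const / \<rho>) powr p * (\<omega> * (2 * \<rho>) ^ CARD('n)) = C * E0"
    proof -
      have "(2 * \<rho>) ^ CARD('n) = 2 powr n * \<rho> powr n"
        using \<rho>(1) by (simp add: n_def powr_realpow power_mult_distrib)
      moreover have "(weight_const / \<rho>) powr p = weight_const powr p * \<rho> powr - p"
        using \<rho>(1) weight_const by (simp add: powr_divide powr_minus_divide)
      moreover have "E0 = \<rho> powr n * \<rho> powr - p" by (simp add: E0 n_def flip: powr_add)
      ultimately show ?thesis by (simp add: C_def weight_const_def)
    qed
    also have "c * (\<kappa> * (\<integral>x. norm (F x) powr p \<partial>lborel) + \<kappa> powr (1 - p) * (\<integral>x. D x \<partial>lborel)) \<le> E0"
    proof -
      have "c \<ge> 0" using p_gt_1 a1 by (simp add: c)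
      then have "c * (\<kappa> powr (1 - p) * (\<integral>x. D x \<partial>lborel)) \<le> c * (\<kappa> powr (1 - p) * \<delta>)"
        using d unfolding D_def cut_def by (intro mult_left_mono) auto
      then show ?thesis using k1 k2 by (simp add: distrib_left)
    qed
    finally show ?thesis by (simp add: algebra_simps)
  qed
  \<comment> \<open>On the smaller ball the bump is at least exp(-1/3), hence the factor exp(1/3); 2
    powr p pays for splitting \<open>grad v\<close> into \<open>F\<close> and the error.\<close>
  have pw: "indicator (ball x0 \<rho>) z * ennreal (norm (grad (\<lambda>x. ln (\<epsilon> + v x)) z) powr p) \<le>
      ennreal (2 powr p * (exp (1 / 3) * h z + \<epsilon> powr - p * D z))" for z
  proof (cases "z \<in> ball x0 \<rho>")
    case True
    have "norm (grad (\<lambda>x. ln (\<epsilon> + v x)) z) = norm (grad v z) / W z"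
      using smooth_ln(2)[OF sW W(2), of z] grad_const_add[OF v(1), of \<epsilon> z] W(2)[of z]
      by (simp add: W_def)
    also have "norm (grad v z) \<le> norm (F z) + norm (F z - grad v z)"
      using norm_triangle_ineq4[of "F z" "F z - grad v z"] by simp
    then have "norm (grad v z) / W z \<le> norm (F z) / W z + norm (F z - grad v z) / W z"
      using W(2)[of z] by (simp add: divide_right_mono flip: add_divide_distrib)
    finally have "norm (grad (\<lambda>x. ln (\<epsilon> + v x)) z) powr p \<le>
        (norm (F z) / W z + norm (F z - grad v z) / W z) powr p"
      using p_gt_1 by (intro powr_mono2) auto
    also have "\<dots> \<le> 2 powr p * ((norm (F z) / W z) powr p + (norm (F z - grad v z) / W z) powr p)"
      using W(2)[of z] p_gt_1 by (intro powr_add_le) auto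
    also have "\<dots> \<le> 2 powr p * (exp (1 / 3) * h z + \<epsilon> powr - p * D z)"
    proof (intro mult_left_mono add_mono)
      have "exp (- 1 / 3) \<le> bump x0 \<rho> z"
        using bump_ge[OF \<rho>(1), of z x0 1] True by (simp add: dist_norm norm_minus_commute)
      then have "exp (1 / 3) * exp (- 1 / 3) \<le> exp (1 / 3) * bump x0 \<rho> z" by (intro mult_left_mono) auto
      then have "1 \<le> exp (1 / 3) * bump x0 \<rho> z" by (simp flip: exp_add)
      then have "1 * (norm (F z) / W z) powr p \<le> exp (1 / 3) * bump x0 \<rho> z * (norm (F z) / W z) powr p"
        by (intro mult_right_mono) auto
      then show "(norm (F z) / W z) powr p \<le> exp (1 / 3) * h z" by (simp add: h_def)
      have "z \<in> ball x0 (2 * \<rho>)" using True \<rho>(1) by simp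
      moreover have "(norm (F z - grad v z) / W z) powr p \<le> (norm (F z - grad v z) / \<epsilon>) powr p"
        using W[of z] \<epsilon> p_gt_1 by (intro powr_mono2 divide_left_mono) auto
      ultimately show "(norm (F z - grad v z) / W z) powr p \<le> \<epsilon> powr - p * D z"
        using \<epsilon> by (simp add: D_def cut_def powr_divide powr_minus_divide)
    qed auto
    finally show ?thesis using True by (simp add: ennreal_leI)
  qed simp
  have "(\<integral>\<^sup>+z. indicator (ball x0 \<rho>) z * ennreal (norm (grad (\<lambda>x. ln (\<epsilon> + v x)) z) powr p) \<partial>lborel) \<le>
      (\<integral>\<^sup>+z. ennreal (2 powr p * (exp (1 / 3) * h z + \<epsilon> powr - p * D z)) \<partial>lborel)"
    by (rule nn_integral_mono) (rule pw)
  also have "\<dots> = ennreal (\<integral>z. 2 powr p * (exp (1 / 3) * h z + \<epsilon> powr - p * D z) \<partial>lborel)"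
    using h D by (intro nn_integral_eq_integral) auto
  also have "(\<integral>z. 2 powr p * (exp (1 / 3) * h z + \<epsilon> powr - p * D z) \<partial>lborel) =
      2 powr p * (exp (1 / 3) * (\<integral>z. h z \<partial>lborel) + \<epsilon> powr - p * (\<integral>z. D z \<partial>lborel))"
    using h D by simp
  also have "\<dots> \<le> 2 powr p * (exp (1 / 3) * (E0 * (1 + C) / \<theta>) + E0)"
  proof (intro mult_left_mono add_mono)
    show "(\<integral>z. h z \<partial>lborel) \<le> E0 * (1 + C) / \<theta>" using en \<theta>0 by (simp add: field_simps)
    have "\<epsilon> powr - p * (\<integral>z. D z \<partial>lborel) \<le> \<epsilon> powr - p * \<delta>"
      using d unfolding D_def cut_def by (intro mult_left_mono) auto
    then show "\<epsilon> powr - p * (\<integral>z. D z \<partial>lborel) \<le> E0" using k3 by simp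
  qed auto
  also have "\<dots> = energy_const CARD('n) p a0 a1 b1 * \<rho> powr (CARD('n) - p)"
    unfolding energy_const_def Let_def E0 C_def \<theta>_def \<omega>_def n_def by (simp add: algebra_simps)
  finally show ?thesis by (simp add: ennreal_leI)
qed

end

section \<open>Harnack estimates for the mollified functions along chains of balls\<close>

locale mollified_solution = normalized_solution p a0 a1 b1 R V F A B
  for p a0 a1 b1 R :: real and V :: "real^'n \<Rightarrow> real" and F A :: "real^'n \<Rightarrow> real^'n"
    and B :: "real^'n \<Rightarrow> real" +
  fixes \<phi> :: "nat \<Rightarrow> real^'n \<Rightarrow> real" and r :: "nat \<Rightarrow> real"
  assumes mollifier: "mollifier (r k) (\<phi> k)" and r_tendsto: "r \<longlonglongrightarrow> 0"
begin

lemma mollified_nonneg: "conv (\<phi> k) V x \<ge> 0"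
  by (rule conv_ge[OF V_integrable mollifier]) (simp add: V_nonneg)

text \<open>How large \<open>k\<close> must be depends on the ball and on \<open>\<epsilon>\<close>,
  but the bound does not. The strict inequality with \<open>R\<close> leaves room for the support of
  the mollifier.\<close>

lemma local_Harnack:
  fixes x0 :: "real^'n"
  assumes \<rho>: "\<rho> > 0" "3 * \<rho> \<le> norm x0" "norm x0 + 2 * \<rho> < R" and \<epsilon>: "\<epsilon> > 0"
  shows "\<forall>\<^sub>F k in sequentially. \<forall>x\<in>ball x0 \<rho>. \<forall>y\<in>ball x0 \<rho>.
    \<bar>ln (\<epsilon> + conv (\<phi> k) V x) - ln (\<epsilon> + conv (\<phi> k) V y)\<bar> \<le> harnack_const CARD('n) p a0 a1 b1"
proof -
  define J where "J = (\<integral>x. norm (F x) powr p \<partial>lborel)"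
  define E0 where "E0 = \<rho> powr (CARD('n) - p)"
  define c where "c = (p - 1) * \<epsilon> powr - p * a1"
  \<comment> \<open>\<open>\<kappa>\<close> settles \<open>k1\<close>; then \<open>b\<close> adds up
    the coefficients of \<open>\<delta>\<close> in \<open>k2\<close> and \<open>k3\<close>, so that
    one choice of \<open>\<delta>\<close> settles both. The added ones exclude division by
    0.\<close>
  define \<kappa> where "\<kappa> = E0 / (2 * (c * J + 1))"
  define b where "b = c * \<kappa> powr (1 - p) + \<epsilon> powr - p"
  define \<delta> where "\<delta> = E0 / (2 * (b + 1))"
  have E0: "E0 > 0" using \<rho> by (simp add: E0_def)
  have c: "c \<ge> 0" using p_gt_1 a1 by (simp add: c_def)
  have J: "J \<ge> 0" by (simp add: J_def)
  have cJ: "c * J \<ge> 0" using c J by simp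
  have \<kappa>: "\<kappa> > 0" using E0 cJ by (simp add: \<kappa>_def add_nonneg_pos)
  have b: "b \<ge> 0" using c by (simp add: b_def)
  have \<delta>: "\<delta> > 0" using E0 b by (simp add: \<delta>_def add_nonneg_pos)
  have k1: "c * (\<kappa> * J) \<le> E0 / 2"
  proof -
    have "c * (\<kappa> * J) = E0 / 2 * (c * J / (c * J + 1))" by (simp add: \<kappa>_def field_simps)
    also have "\<dots> \<le> E0 / 2 * 1" using E0 cJ by (intro mult_left_mono) (auto simp: field_simps)
    finally show ?thesis by simp
  qed
  have b\<delta>: "b * \<delta> \<le> E0 / 2"
  proof -
    have "b * \<delta> = E0 / 2 * (b / (b + 1))" by (simp add: \<delta>_def field_simps)
    also have "\<dots> \<le> E0 / 2 * 1" using E0 b by (intro mult_left_mono) (auto simp: field_simps)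
    finally show ?thesis by simp
  qed
  have k2: "c * (\<kappa> powr (1 - p) * \<delta>) \<le> E0 / 2"
  proof -
    have "c * (\<kappa> powr (1 - p) * \<delta>) \<le> b * \<delta>"
      using \<delta> unfolding b_def by (subst mult.assoc[symmetric], intro mult_right_mono) auto
    with b\<delta> show ?thesis by linarith
  qed
  have k3: "\<epsilon> powr - p * \<delta> \<le> E0"
  proof -
    have "\<epsilon> powr - p * \<delta> \<le> b * \<delta>"
      using \<delta> c unfolding b_def by (intro mult_right_mono) auto
    with b\<delta> E0 show ?thesis by linarith
  qed
  have ball: "cball x0 (2 * \<rho>) \<subseteq> ball 0 R"
  proof
    fix x assume "x \<in> cball x0 (2 * \<rho>)"
    then have "norm (x - x0) \<le> 2 * \<rho>" by (simp add: dist_norm norm_minus_commute)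
    then show "x \<in> ball 0 R" using norm_triangle_ineq[of "x - x0" x0] \<rho> by simp
  qed
  have "(\<lambda>k. \<integral>\<^sup>+x. ennreal (norm (conv (\<phi> k) F x - F x) powr p) \<partial>lborel) \<longlonglongrightarrow> 0"
    by (rule conv_Lp_tendsto[OF F_measurable _ F_fin F_outside mollifier r_tendsto]) (use p_gt_1 in auto)
  then have "\<forall>\<^sub>F k in sequentially. (\<integral>\<^sup>+x. ennreal (norm (conv (\<phi> k) F x - F x) powr p) \<partial>lborel) < ennreal \<delta>"
    by (rule order_tendstoD(2)) (use \<delta> in simp)
  moreover have "\<forall>\<^sub>F k in sequentially. r k < R - (norm x0 + 2 * \<rho>)"
    using r_tendsto \<rho> by (intro order_tendstoD(2)) auto
  ultimately show ?thesis
  proof eventually_elim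
    case (elim k)
    define v where "v = conv (\<phi> k) V"
    have v: "smooth v" "\<And>x. v x \<ge> 0"
      unfolding v_def by (rule smooth_mollifier_conv[OF V_integrable mollifier]) (rule mollified_nonneg)
    \<comment> \<open>For such \<open>k\<close> the reflected kernel centred at \<open>x\<close>
      stays inside the ball of radius \<open>R\<close>, so the gradient error is nothing but the
      mollification error of \<open>F\<close>.\<close>
    have gv: "grad v x = conv (\<phi> k) F x" if "x \<in> ball x0 (2 * \<rho>)" for x
      unfolding v_def
    proof (rule grad_mollifier_conv[OF V_integrable mollifier _ weak_gradient])
      show "cball x (r k) \<subseteq> ball 0 R"
      proof
        fix y assume "y \<in> cball x (r k)"
        then have "norm (y - x) \<le> r k" by (simp add: dist_norm norm_minus_commute)
        moreover have "norm (x - x0) < 2 * \<rho>" using that by (simp add: dist_norm norm_minus_commute)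
        moreover have "norm y \<le> norm (y - x) + (norm (x - x0) + norm x0)"
          using norm_triangle_ineq[of "y - x" x] norm_triangle_ineq[of "x - x0" x0] by simp
        ultimately show "y \<in> ball 0 R" using elim(2) by simp
      qed
    qed
    define D where "D x = indicator (ball x0 (2 * \<rho>)) x * norm (F x - grad v x) powr p" for x
    have D: "integrable lborel D" "\<And>x. D x \<ge> 0"
      unfolding D_def by (rule gradient_error_integrable[OF v(1)]) simp
    have "ennreal (\<integral>x. D x \<partial>lborel) = (\<integral>\<^sup>+x. ennreal (D x) \<partial>lborel)"
      using D by (intro nn_integral_eq_integral[symmetric]) auto
    also have "\<dots> \<le> (\<integral>\<^sup>+x. ennreal (norm (conv (\<phi> k) F x - F x) powr p) \<partial>lborel)"
      by (intro nn_integral_mono ennreal_leI) (auto simp: D_def indicator_def gv norm_minus_commute)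
    finally have "ennreal (\<integral>x. D x \<partial>lborel) < ennreal \<delta>" using elim(1) by (rule le_less_trans)
    then have "(\<integral>x. D x \<partial>lborel) \<le> \<delta>" using D by (simp add: ennreal_less_iff)
    then have energy: "(\<integral>\<^sup>+z. indicator (ball x0 \<rho>) z * ennreal (norm (grad (\<lambda>x. ln (\<epsilon> + v x)) z) powr p) \<partial>lborel)
        \<le> ennreal (energy_const CARD('n) p a0 a1 b1 * \<rho> powr (CARD('n) - p))"
      using log_energy[OF \<rho>(1,2) ball \<epsilon> \<kappa> v c_def E0_def k1[unfolded J_def] _ k2 k3]
      unfolding D_def by blast
    have "smooth (\<lambda>x. ln (\<epsilon> + v x))"
      using v \<epsilon> by (intro smooth_ln smooth_add smooth_const) (auto intro: add_pos_nonneg)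
    from Morrey_oscillation[OF this p \<rho>(1) constants(1) energy]
    show ?case unfolding harnack_const_def v_def by blast
  qed
qed

text \<open>\<open>s\<close> inverts the odds: \<open>\<sigma> j\<close> is the odds of the distance
  \<open>s j\<close> with respect to \<open>R\<close>. A chain of fixed length imposes only finitely
  many conditions on \<open>k\<close>, so the estimate still holds eventually.\<close>

lemma Harnack_chain:
  fixes y :: "real^'n"
  assumes y: "y \<noteq> 0" "norm y < R" and \<epsilon>: "\<epsilon> > 0"
  defines "\<sigma> \<equiv> \<lambda>j. (4 / 5) ^ j * (norm y / (R - norm y))"
  defines "s \<equiv> \<lambda>j. R * \<sigma> j / (1 + \<sigma> j)"
  shows "\<forall>\<^sub>F k in sequentially. ln (\<epsilon> + conv (\<phi> k) V ((s j / norm y) *\<^sub>R y)) \<le>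
    ln (\<epsilon> + conv (\<phi> k) V y) + real j * harnack_const CARD('n) p a0 a1 b1"
proof (induction j)
  case 0
  have "s 0 = norm y"
  proof -
    have "R > 0" using y(2) norm_ge_zero[of y] by linarith
    moreover have "1 + norm y / (R - norm y) = R / (R - norm y)" using y by (simp add: field_simps)
    ultimately show ?thesis using y by (simp add: s_def \<sigma>_def)
  qed
  then show ?case using y by simp
next
  case (Suc j)
  have R: "R > 0" using y(2) norm_ge_zero[of y] by linarith
  have \<sigma>: "\<sigma> j > 0" using y by (simp add: \<sigma>_def)
  have \<sigma>': "\<sigma> (Suc j) = 4 / 5 * \<sigma> j" by (simp add: \<sigma>_def)
  have st: "0 < s j" "s j < R" "0 < s (Suc j)" "s (Suc j) < s j" "s j - s (Suc j) < min (s j) (R - s j) / 3"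
    using odds_step[OF \<sigma> R] by (simp_all only: s_def \<sigma>')
  \<comment> \<open>One third of the distance to the origin or to the sphere of radius
    \<open>R\<close>, whichever is smaller, meets both conditions of \<open>local_Harnack\<close>,
    and by \<open>odds_step\<close> the next point of the chain is closer than that.\<close>
  define \<rho> where "\<rho> = min (s j) (R - s j) / 3"
  define pt where "pt i = (s i / norm y) *\<^sub>R y" for i
  have \<rho>: "\<rho> > 0" using st by (simp add: \<rho>_def)
  have npt: "norm (pt i) = s i" if "s i > 0" for i using that y by (simp add: pt_def)
  have "dist (pt j) (pt (Suc j)) = s j - s (Suc j)"
  proof -
    have "pt j - pt (Suc j) = ((s j - s (Suc j)) / norm y) *\<^sub>R y"
      by (simp add: pt_def diff_divide_distrib scaleR_diff_left)
    then show ?thesis using st(4) y by (simp add: dist_norm)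
  qed
  then have "pt (Suc j) \<in> ball (pt j) \<rho>" using st(5) by (simp add: \<rho>_def)
  moreover have "pt j \<in> ball (pt j) \<rho>" using \<rho> by simp
  moreover have "3 * \<rho> \<le> norm (pt j)" "norm (pt j) + 2 * \<rho> < R"
  proof -
    have "\<rho> \<le> s j / 3" "\<rho> \<le> (R - s j) / 3" by (simp_all add: \<rho>_def)
    note f = this npt[OF st(1)] st(2)
    from f show "3 * \<rho> \<le> norm (pt j)" by linarith
    from f show "norm (pt j) + 2 * \<rho> < R" by argo
  qed
  note local_Harnack[OF \<rho> this \<epsilon>]
  ultimately have "\<forall>\<^sub>F k in sequentially.
      \<bar>ln (\<epsilon> + conv (\<phi> k) V (pt (Suc j))) - ln (\<epsilon> + conv (\<phi> k) V (pt j))\<bar> \<le> harnack_const CARD('n) p a0 a1 b1"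
    by (auto elim: eventually_mono)
  with Suc show ?case
    unfolding pt_def by eventually_elim (auto simp: algebra_simps)
qed


text \<open>Convergence in L^1 is the case p = 1 of \<open>conv_Lp_tendsto\<close>, and some
  subsequence then converges almost everywhere. Passing to it is harmless, as the estimates hold for
  all large \<open>k\<close>.\<close>

lemma mollified_tendsto_AE:
  obtains q :: "nat \<Rightarrow> nat" where "strict_mono q"
    "AE x in lborel. (\<lambda>k. conv (\<phi> (q k)) V x) \<longlonglongrightarrow> V x"
proof -
  have Vm[measurable]: "V \<in> borel_measurable borel" using V_integrable by auto
  have fin: "(\<integral>\<^sup>+x. ennreal (norm (V x) powr 1) \<partial>lborel) < top"
    using V_integrable by (simp add: integrable_iff_bounded V_nonneg)
  have lim: "(\<lambda>k. \<integral>\<^sup>+x. ennreal (norm (conv (\<phi> k) V x - V x) powr 1) \<partial>lborel) \<longlonglongrightarrow> 0"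
    by (rule conv_Lp_tendsto[OF Vm _ fin V_outside mollifier r_tendsto]) auto
  have int: "integrable lborel (\<lambda>x. conv (\<phi> k) V x - V x)" for k
  proof (rule Bochner_Integration.integrable_diff[OF integrableI_bounded V_integrable])
    show "conv (\<phi> k) V \<in> borel_measurable lborel"
      using borel_measurable_conv[OF mollifierD(6)[OF mollifier] Vm] by simp
    have "(\<integral>\<^sup>+x. ennreal (norm (conv (\<phi> k) V x) powr 1) \<partial>lborel) \<le> (\<integral>\<^sup>+x. ennreal (norm (V x) powr 1) \<partial>lborel)"
      by (rule nn_integral_powr_norm_conv_le[OF _ V_integrable mollifier]) simp
    with fin show "(\<integral>\<^sup>+x. ennreal (norm (conv (\<phi> k) V x)) \<partial>lborel) < \<infinity>" by simp
  qed
  have "(\<lambda>k. enn2real (\<integral>\<^sup>+x. ennreal (norm (conv (\<phi> k) V x - V x) powr 1) \<partial>lborel)) \<longlonglongrightarrow> enn2real 0"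
    using tendsto_enn2real[of _ 0] lim by simp
  moreover have "(\<integral>x. norm (conv (\<phi> k) V x - V x) \<partial>lborel) =
      enn2real (\<integral>\<^sup>+x. ennreal (norm (conv (\<phi> k) V x - V x) powr 1) \<partial>lborel)" for k
    using borel_measurable_integrable[OF int[of k]] by (subst integral_eq_nn_integral) auto
  ultimately have "(\<lambda>k. \<integral>x. norm (conv (\<phi> k) V x - V x) \<partial>lborel) \<longlonglongrightarrow> 0" by simp
  from tendsto_L1_AE_subseq[OF int this] obtain q :: "nat \<Rightarrow> nat" where
    q: "strict_mono q" "AE x in lborel. (\<lambda>k. conv (\<phi> (q k)) V x - V x) \<longlonglongrightarrow> 0" by blast
  show thesis
    by (rule that[OF q(1)]) (use q(2) in \<open>simp add: LIM_zero_iff\<close>)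
qed

text \<open>The chain is followed until its distance to the origin is strictly below
  \<open>r1\<close>. Once the mollification radius is smaller than the remaining gap, the
  mollification at the end point averages only values that are at least
  \<open>\<mu>\<close>.\<close>

lemma Harnack_mollified:
  fixes y :: "real^'n"
  assumes r: "0 < r1" "r1 \<le> norm y" "norm y < r2" "r2 < R" and \<epsilon>: "\<epsilon> > 0" and \<mu>: "\<mu> \<ge> 0"
    and low: "AE x in lborel. x \<in> ball 0 r1 \<longrightarrow> \<mu> \<le> V x"
  defines "T \<equiv> (r2 / r1) * ((R - r1) / (R - r2))"
  shows "\<forall>\<^sub>F k in sequentially.
    exp (- harnack_const CARD('n) p a0 a1 b1 * (1 + 5 * ln T)) * (\<epsilon> + \<mu>) \<le> \<epsilon> + conv (\<phi> k) V y"
proof -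
  let ?H = "harnack_const CARD('n) p a0 a1 b1"
  define \<sigma>0 where "\<sigma>0 = norm y / (R - norm y)"
  define \<sigma>1 where "\<sigma>1 = r1 / (R - r1)"
  define \<sigma> where "\<sigma> j = (4 / 5) ^ j * \<sigma>0" for j :: nat
  define s where "s j = R * \<sigma> j / (1 + \<sigma> j)" for j
  have R: "R > 0" "norm y < R" "r1 < R" "y \<noteq> 0" using r by auto
  have \<sigma>p: "\<sigma>1 > 0" "\<sigma>0 > 0" using r R by (auto simp: \<sigma>0_def \<sigma>1_def)
  have le1: "\<sigma>1 \<le> \<sigma>0" unfolding \<sigma>0_def \<sigma>1_def using r R by (intro frac_le) auto
  have "\<sigma>0 \<le> r2 / (R - r2)" unfolding \<sigma>0_def using r R by (intro frac_le) auto
  then have "\<sigma>0 / \<sigma>1 \<le> r2 / (R - r2) / \<sigma>1" using \<sigma>p by (intro divide_right_mono) auto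
  also have "\<dots> = T" using r R by (simp add: \<sigma>1_def T_def)
  finally have le2: "\<sigma>0 / \<sigma>1 \<le> T" .
  have ge1: "1 \<le> \<sigma>0 / \<sigma>1" using le1 \<sigma>p by simp
  define L where "L = ln (\<sigma>0 / \<sigma>1)"
  have L: "0 \<le> L" "L \<le> ln T" using ge1 le2 by (auto simp: L_def)
  have l54: "1 / 5 \<le> ln (5 / 4 :: real)"
  proof -
    have "ln (4 / 5 :: real) \<le> 4 / 5 - 1" by (rule ln_le_minus_one) simp
    moreover have "ln (4 / 5 :: real) = - ln (5 / 4)" using ln_inverse[of "5 / 4 :: real"] by simp
    ultimately show ?thesis by simp
  qed
  \<comment> \<open>The added 1 makes \<open>N\<close> strictly larger than L / ln (5/4), which puts
    the last point strictly inside the ball of radius \<open>r1\<close>.\<close>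
  define N where "N = nat \<lfloor>L / ln (5 / 4)\<rfloor> + 1"
  have N1: "L / ln (5 / 4) < real N" and N2: "real N \<le> 1 + L / ln (5 / 4)"
  proof -
    have "0 \<le> L / ln (5 / 4)" using L l54 by (intro divide_nonneg_nonneg) auto
    then have "real (nat \<lfloor>L / ln (5 / 4)\<rfloor>) = of_int \<lfloor>L / ln (5 / 4)\<rfloor>" by simp
    then show "L / ln (5 / 4) < real N" "real N \<le> 1 + L / ln (5 / 4)"
      using floor_correct[of "L / ln (5 / 4)"]
      unfolding N_def of_nat_add of_nat_1 of_int_add of_int_1 by linarith+
  qed
  have "L / ln (5 / 4) \<le> L / (1 / 5)" using L l54 by (intro divide_left_mono) auto
  then have N3: "real N \<le> 1 + 5 * ln T" using N2 L by simp
  have "\<sigma> N < \<sigma>1"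
  proof -
    have "L < real N * ln (5 / 4)" using N1 l54 by (simp add: field_simps)
    then have "\<sigma>0 / \<sigma>1 < (5 / 4) ^ N"
      using \<sigma>p by (subst ln_less_cancel_iff[symmetric]) (auto simp: L_def ln_realpow)
    then have "(4 / 5) ^ N * \<sigma>0 < (4 / 5) ^ N * ((5 / 4) ^ N * \<sigma>1)"
      using \<sigma>p by (intro mult_strict_left_mono) (auto simp: field_simps)
    also have "\<dots> = \<sigma>1" by (simp add: mult.assoc[symmetric] flip: power_mult_distrib)
    finally show ?thesis by (simp add: \<sigma>_def)
  qed
  have \<sigma>N: "\<sigma> N > 0" using \<sigma>p by (simp add: \<sigma>_def)
  have sN: "0 < s N" "s N < r1"
  proof -
    show "0 < s N" using \<sigma>N R by (simp add: s_def)
    have "\<sigma> N * (R - r1) < r1" using \<open>\<sigma> N < \<sigma>1\<close> R by (simp add: \<sigma>1_def field_simps)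
    then show "s N < r1" using \<sigma>N by (simp add: s_def field_simps)
  qed
  define x where "x = (s N / norm y) *\<^sub>R y"
  have nx: "norm x = s N" using sN R by (simp add: x_def)
  have "\<forall>\<^sub>F k in sequentially. ln (\<epsilon> + conv (\<phi> k) V x) \<le> ln (\<epsilon> + conv (\<phi> k) V y) + real N * ?H"
    using Harnack_chain[OF R(4,2) \<epsilon>, of N] unfolding x_def s_def \<sigma>_def \<sigma>0_def .
  moreover have "\<forall>\<^sub>F k in sequentially. r k < r1 - s N"
    using r_tendsto sN by (intro order_tendstoD(2)) auto
  ultimately show ?thesis
  proof eventually_elim
    case (elim k)
    have "\<mu> \<le> conv (\<phi> k) V x"
    proof (rule conv_ge[OF V_integrable mollifier])
      show "AE z in lborel. z \<in> ball x (r k) \<longrightarrow> \<mu> \<le> V z"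
        using low
      proof eventually_elim
        case (elim z)
        have "norm z < r1" if "norm (x - z) < r k"
          using that norm_triangle_ineq4[of x "x - z"] nx \<open>r k < r1 - s N\<close> by simp
        with elim show ?case by (simp add: dist_norm)
      qed
    qed
    then have "ln (\<epsilon> + \<mu>) \<le> ln (\<epsilon> + conv (\<phi> k) V x)" using \<epsilon> \<mu> by simp
    also have "\<dots> \<le> ln (\<epsilon> + conv (\<phi> k) V y) + (1 + 5 * ln T) * ?H"
      using elim(1) mult_right_mono[OF N3, of ?H] constants(2) by linarith
    finally have "exp (ln (\<epsilon> + \<mu>) + - ?H * (1 + 5 * ln T)) \<le> exp (ln (\<epsilon> + conv (\<phi> k) V y))"
      by (simp add: algebra_simps)
    moreover have "exp (ln (\<epsilon> + conv (\<phi> k) V y)) = \<epsilon> + conv (\<phi> k) V y"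
      using \<epsilon> mollified_nonneg[of k y] by (simp add: add_pos_nonneg)
    moreover have "exp (ln (\<epsilon> + \<mu>)) = \<epsilon> + \<mu>" using \<epsilon> \<mu> by simp
    ultimately show ?case by (simp only: exp_add mult.commute)
  qed
qed

text \<open>First \<open>k\<close> tends to infinity along the subsequence at almost every point,
  then \<epsilon> tends to 0; this order is possible because the factor does not involve \<epsilon>.
  Inside the ball of radius \<open>r1\<close> the bound is immediate, as the factor is at most
  1.\<close>

lemma Harnack_AE:
  assumes r: "0 < r1" "r1 < r2" "r2 < R" and \<mu>: "\<mu> \<ge> 0"
    and low: "AE x in lborel. x \<in> ball 0 r1 \<longrightarrow> \<mu> \<le> V x"
  shows "AE x in lborel. x \<in> ball 0 r2 \<longrightarrow>
    harnack_factor CARD('n) p a0 a1 b1 r1 r2 R * \<mu> \<le> V x"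
proof -
  define E where "E = harnack_factor CARD('n) p a0 a1 b1 r1 r2 R"
  have "1 \<le> (r2 / r1) * ((R - r1) / (R - r2))"
  proof -
    have "1 \<le> r2 / r1" "1 \<le> (R - r1) / (R - r2)" using r by auto
    from mult_mono[OF this] show ?thesis using r by simp
  qed
  then have "0 \<le> harnack_const CARD('n) p a0 a1 b1 * (1 + 5 * ln ((r2 / r1) * ((R - r1) / (R - r2))))"
    using constants(2) by (intro mult_nonneg_nonneg add_nonneg_nonneg) (auto intro: ln_ge_zero)
  then have E: "0 < E" "E \<le> 1"
    unfolding E_def harnack_factor_def by (simp_all only: exp_gt_zero exp_le_one_iff mult_minus_left neg_le_0_iff_le)
  obtain q :: "nat \<Rightarrow> nat" where q: "strict_mono q"
    "AE x in lborel. (\<lambda>k. conv (\<phi> (q k)) V x) \<longlonglongrightarrow> V x"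
    by (rule mollified_tendsto_AE)
  show ?thesis
    unfolding E_def[symmetric] using q(2) low
  proof eventually_elim
    case (elim y)
    show ?case
    proof
      assume y: "y \<in> ball 0 r2"
      show "E * \<mu> \<le> V y"
      proof (cases "norm y < r1")
        case True
        then have "1 * \<mu> \<le> V y" using elim(2) by simp
        moreover have "E * \<mu> \<le> 1 * \<mu>" using E \<mu> by (intro mult_right_mono) auto
        ultimately show ?thesis by linarith
      next
        case False
        have "E * \<mu> \<le> V y + \<epsilon>" if \<epsilon>: "\<epsilon> > 0" for \<epsilon>
        proof -
          have "\<forall>\<^sub>F k in sequentially. E * (\<epsilon> + \<mu>) \<le> \<epsilon> + conv (\<phi> k) V y"
            unfolding E_def harnack_factor_def using False y r by (intro Harnack_mollified[OF r(1) _ _ r(3) \<epsilon> \<mu> low]) auto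
          then have "\<forall>\<^sub>F k in sequentially. E * (\<epsilon> + \<mu>) \<le> \<epsilon> + conv (\<phi> (q k)) V y"
            by (rule eventually_subseq[OF q(1)])
          moreover have "(\<lambda>k. \<epsilon> + conv (\<phi> (q k)) V y) \<longlonglongrightarrow> \<epsilon> + V y"
            by (intro tendsto_intros elim)
          ultimately have "E * (\<epsilon> + \<mu>) \<le> \<epsilon> + V y"
            using tendsto_lowerbound[OF _ _ sequentially_bot] by blast
          moreover have "E * \<epsilon> \<ge> 0" using E \<epsilon> by simp
          ultimately show ?thesis by (simp add: distrib_left)
        qed
        then show ?thesis by (rule field_le_epsilon)
      qed
    qed
  qed
qed

end

context normalized_solution
begin

lemma Harnack:
  assumes r: "0 < r1" "r1 < r2" "r2 < R" and \<mu>: "\<mu> \<ge> 0"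
    and low: "AE x in lborel. x \<in> ball 0 r1 \<longrightarrow> \<mu> \<le> V x"
  shows "AE x in lborel. x \<in> ball 0 r2 \<longrightarrow>
    harnack_factor CARD('n) p a0 a1 b1 r1 r2 R * \<mu> \<le> V x"
proof -
  have "\<exists>\<phi> :: real^'n \<Rightarrow> real. mollifier (inverse (real (Suc k))) \<phi>" for k
    by (rule mollifier_exists[of "inverse (real (Suc k))"]) auto
  then have "\<forall>k. \<exists>\<phi> :: real^'n \<Rightarrow> real. mollifier (inverse (real (Suc k))) \<phi>" by blast
  from choice[OF this] obtain \<phi> :: "nat \<Rightarrow> real^'n \<Rightarrow> real"
    where \<phi>: "\<And>k. mollifier (inverse (real (Suc k))) (\<phi> k)" by blast
  interpret mollified_solution p a0 a1 b1 R V F A B \<phi> "\<lambda>k. inverse (real (Suc k))"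
    by unfold_locales (use \<phi> LIMSEQ_inverse_real_of_nat in auto)
  show ?thesis by (rule Harnack_AE[OF assms])
qed

end

section \<open>The constant\<close>

text \<open>Raise 1 + \<kappa> x \<le> exp (\<kappa> x) with \<kappa> = \<alpha>/p to the power
  \<open>p\<close>; \<open>D\<close> compensates for \<kappa> < 1.\<close>

lemma one_plus_powr_le_exp:
  fixes \<alpha> p :: real
  assumes "\<alpha> > 0" "p > 0"
  obtains C where "C > 0" "\<And>x. x \<ge> 0 \<Longrightarrow> (1 + x) powr p \<le> C * exp (\<alpha> * x)"
proof -
  define \<kappa> where "\<kappa> = \<alpha> / p"
  define D where "D = max 1 (1 / \<kappa>)"
  have \<kappa>: "\<kappa> > 0" "p * \<kappa> = \<alpha>" using assms by (auto simp: \<kappa>_def)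
  have D: "D \<ge> 1" "D * \<kappa> \<ge> 1" using \<kappa> by (auto simp: D_def max_def field_simps)
  have "(1 + x) powr p \<le> D powr p * exp (\<alpha> * x)" if "x \<ge> 0" for x
  proof -
    have "1 + x \<le> D + D * \<kappa> * x"
      using D(1) mult_right_mono[OF D(2) that] by simp
    also have "\<dots> = D * (1 + \<kappa> * x)" by (simp add: algebra_simps)
    also have "\<dots> \<le> D * exp (\<kappa> * x)" using D(1) by (intro mult_left_mono exp_ge_add_one_self) auto
    finally have "(1 + x) powr p \<le> (D * exp (\<kappa> * x)) powr p" using that assms by (intro powr_mono2) auto
    also have "\<dots> = D powr p * exp (\<alpha> * x)"
      using D(1) \<kappa>(2) by (simp add: powr_mult exp_powr_real mult_ac)
    finally show ?thesis .
  qed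
  moreover have "D powr p > 0" using D(1) by simp
  ultimately show thesis using that by blast
qed

text \<open>Half of the exponent is traded for a linear factor. In \<open>chain_length_bound\<close>
  the linear factor, divided by the logarithm \<open>a\<close>, produces \<open>y\<close>, and the
  remaining exponential beats a power.\<close>

lemma exp_minus_1_ge:
  fixes z :: real assumes "z \<ge> 0" shows "z / 2 * exp (z / 2) \<le> exp z - 1"
proof -
  have "exp z - 1 = (exp (z / 2) - 1) * (exp (z / 2) + 1)"
    by (simp add: algebra_simps flip: exp_add)
  moreover have "z / 2 * exp (z / 2) \<le> (exp (z / 2) - 1) * (exp (z / 2) + 1)"
  proof (rule mult_mono)
    show "z / 2 \<le> exp (z / 2) - 1" using exp_ge_add_one_self[of "z / 2"] by linarith
  qed (use assms in auto)
  ultimately show ?thesis by simp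
qed

text \<open>Let R be the mean of r2 and r3, a = ln (R / r2), b = ln (r2 / r1), y = 1 + b/a and
  \<alpha> = p - n. As (R / r1)^\<alpha> = exp (\<alpha> (a + b)), the base of the p-th root on the
  right is at least a multiple of y (1 + b)^p. On the left the argument of the logarithm is at most
  y exp b, which gives a multiple of (1 + b) (1 + ln y), and a logarithm is below a multiple of the
  p-th root.\<close>

lemma chain_length_bound:
  fixes n p :: real
  assumes n: "n > 0" and p: "p > n" "p > 1"
  obtains c where "c > 0" "\<And>r1 r2 r3. 0 < r1 \<Longrightarrow> r1 < r2 \<Longrightarrow> r2 < r3 \<Longrightarrow>
    1 + 5 * ln ((r2 / r1) * ((r3 - r1) / (r3 - r2))) \<le>
    c * (((r2 + r3) / 2) powr (p - n) * (r1 powr (n - p) - r3 powr (n - p)) / ln ((r2 + r3) / (2 * r2))) powr (1 / p)"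
proof -
  define \<alpha> where "\<alpha> = p - n"
  have \<alpha>: "\<alpha> > 0" using p by (simp add: \<alpha>_def)
  obtain C where C: "C > 0" "\<And>x. x \<ge> 0 \<Longrightarrow> (1 + x) powr p \<le> C * exp (\<alpha> / 2 * x)"
    using one_plus_powr_le_exp[of "\<alpha> / 2" p] \<alpha> p by auto
  define k where "k = (\<alpha> / (2 * C)) powr (1 / p)"
  have k: "k > 0" using \<alpha> C by (simp add: k_def)
  show thesis
  proof (rule that)
    show "5 * (1 + p) / k > 0" using k p by simp
    fix r1 r2 r3 :: real assume r: "0 < r1" "r1 < r2" "r2 < r3"
    define R where "R = (r2 + r3) / 2"
    define a where "a = ln (R / r2)"
    define b where "b = ln (r2 / r1)"
    define y where "y = 1 + b / a"
    define Q where "Q = R powr \<alpha> * (r1 powr - \<alpha> - r3 powr - \<alpha>) / a"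
    have R: "r2 < R" "R < r3" "0 < R" using r by (auto simp: R_def)
    have ab: "a > 0" "b > 0" using r R by (auto simp: a_def b_def)
    have y: "y \<ge> 1" using ab by (simp add: y_def)
    have ea: "R = r2 * exp a" and eb: "r2 = r1 * exp b" using r R by (auto simp: a_def b_def)
    have "(\<alpha> / (2 * C)) * (y * (1 + b) powr p) \<le> Q"
    proof -
      define x where "x = a + b"
      have x: "x \<ge> 0" using ab by (simp add: x_def)
      have "(\<alpha> / (2 * C)) * (y * (1 + b) powr p) \<le> (\<alpha> / (2 * C)) * (y * (1 + x) powr p)"
        using \<alpha> C ab y p by (intro mult_left_mono powr_mono2) (auto simp: x_def)
      also have "\<dots> \<le> (\<alpha> / (2 * C)) * (y * (C * exp (\<alpha> / 2 * x)))"
        using \<alpha> C y x by (intro mult_left_mono C(2)) auto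
      also have "\<dots> = (\<alpha> * x) / 2 * exp (\<alpha> * x / 2) / a"
        using C(1) ab by (simp add: y_def x_def field_simps)
      also have "\<dots> \<le> (exp (\<alpha> * x) - 1) / a"
        using \<alpha> x ab by (intro divide_right_mono exp_minus_1_ge) auto
      also have "exp (\<alpha> * x) = R powr \<alpha> * r1 powr - \<alpha>"
      proof -
        have "R = r1 * exp x" using ea eb by (simp add: x_def exp_add)
        then show ?thesis using r
          by (simp add: powr_mult exp_powr_real powr_minus mult.commute)
      qed
      \<comment> \<open>\<open>r3\<close> is replaced by the smaller \<open>R\<close>, whose powers
        cancel to 1.\<close>
      also have "(R powr \<alpha> * r1 powr - \<alpha> - 1) / a \<le> Q"
      proof -
        have "R powr \<alpha> * r3 powr - \<alpha> \<le> R powr \<alpha> * R powr - \<alpha>"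
          using R \<alpha> by (intro mult_left_mono powr_mono2') auto
        also have "\<dots> = 1" using R by (simp flip: powr_add)
        finally show ?thesis unfolding Q_def using ab by (intro divide_right_mono) (auto simp: algebra_simps)
      qed
      finally show ?thesis .
    qed
    then have "((\<alpha> / (2 * C)) * (y * (1 + b) powr p)) powr (1 / p) \<le> Q powr (1 / p)"
      using \<alpha> C y p by (intro powr_mono2) auto
    then have Q: "k * (y powr (1 / p) * (1 + b)) \<le> Q powr (1 / p)"
    proof -
      have "((\<alpha> / (2 * C)) * (y * (1 + b) powr p)) powr (1 / p) = k * (y powr (1 / p) * (1 + b) powr (p * (1 / p)))"
        by (simp only: k_def powr_mult powr_powr)
      moreover have "(1 + b) powr (p * (1 / p)) = 1 + b" using p ab by simp
      ultimately show ?thesis using \<open>_ powr (1 / p) \<le> Q powr (1 / p)\<close> by simp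
    qed
    have "ln ((r2 / r1) * ((r3 - r1) / (r3 - r2))) = b + ln ((r3 - r1) / (r3 - r2))"
      using r by (subst ln_mult) (auto simp: b_def)
    \<comment> \<open>Differences are compared with logarithms: r2 - r1 \<le> r2 b and R - r2 \<ge>
      r2 a, both from 1 + t \<le> exp t. The factor 2 in r3 - r2 = 2 (R - r2) is given away.\<close>
    also have "(r3 - r1) / (r3 - r2) \<le> y"
    proof -
      have "(r3 - r1) / (r3 - r2) = 1 + (r2 - r1) / (2 * (R - r2))"
        using r by (simp add: R_def field_simps)
      also have "(r2 - r1) / (2 * (R - r2)) \<le> (r2 * b) / (2 * (r2 * a))"
      proof (rule frac_le)
        have "r1 = r2 * exp (- b)" using eb by (simp add: exp_minus)
        moreover have "r2 * (1 - b) \<le> r2 * exp (- b)"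
          using exp_ge_add_one_self[of "- b"] r by (intro mult_left_mono) auto
        ultimately show "r2 - r1 \<le> r2 * b" by (simp add: algebra_simps)
        have "r2 * (1 + a) \<le> r2 * exp a" using r by (intro mult_left_mono exp_ge_add_one_self) auto
        then show "2 * (r2 * a) \<le> 2 * (R - r2)" using ea by (simp add: algebra_simps)
      qed (use r ab in auto)
      also have "(r2 * b) / (2 * (r2 * a)) \<le> b / a" using r ab by (simp add: field_simps)
      finally show ?thesis by (simp add: y_def)
    qed
    then have "b + ln ((r3 - r1) / (r3 - r2)) \<le> b + ln y" using r y by simp
    finally have "1 + 5 * ln ((r2 / r1) * ((r3 - r1) / (r3 - r2))) \<le> 5 * (1 + b + ln y)" by simp
    also have "\<dots> \<le> 5 * ((1 + b) * (1 + ln y))" using ab y by (simp add: algebra_simps)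
    also have "\<dots> \<le> 5 * ((1 + b) * ((1 + p) * y powr (1 / p)))"
    proof (intro mult_left_mono)
      have "ln y = p * ln (y powr (1 / p))" using y p by (simp add: ln_powr)
      also have "\<dots> \<le> p * (y powr (1 / p) - 1)"
        using p y by (intro mult_left_mono ln_le_minus_one) auto
      finally have "ln y \<le> p * y powr (1 / p)" using p by (simp add: algebra_simps)
      moreover have "1 \<le> y powr (1 / p)" using y p by (intro ge_one_powr_ge_zero) auto
      ultimately show "1 + ln y \<le> (1 + p) * y powr (1 / p)" by (simp add: algebra_simps)
    qed (use ab in auto)
    also have "\<dots> = 5 * (1 + p) / k * (k * (y powr (1 / p) * (1 + b)))" using k by simp
    also have "\<dots> \<le> 5 * (1 + p) / k * Q powr (1 / p)" using Q k p by (intro mult_left_mono) auto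
    finally show "1 + 5 * ln ((r2 / r1) * ((r3 - r1) / (r3 - r2))) \<le> 5 * (1 + p) / k *
      (((r2 + r3) / 2) powr (p - n) * (r1 powr (n - p) - r3 powr (n - p)) / ln ((r2 + r3) / (2 * r2))) powr (1 / p)"
      by (simp add: Q_def R_def a_def \<alpha>_def)
  qed
qed

section \<open>Capacity of balls\<close>

lemma integral_lebesgue_on_eq:
  fixes f :: "'a::euclidean_space \<Rightarrow> 'b::{banach, second_countable_topology}"
  assumes "S \<in> sets borel" "f \<in> borel_measurable borel" "\<And>x. x \<notin> S \<Longrightarrow> f x = 0"
  shows "integral\<^sup>L (lebesgue_on S) f = integral\<^sup>L lborel f"
proof -
  have "integral\<^sup>L (lebesgue_on S) f = (\<integral>x. indicator S x *\<^sub>R f x \<partial>lebesgue)"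
    using assms(1) by (intro integral_restrict_space) auto
  also have "(\<lambda>x. indicator S x *\<^sub>R f x) = f" using assms(3) by (auto simp: indicator_def fun_eq_iff)
  also have "integral\<^sup>L lebesgue f = integral\<^sup>L lborel f"
    using assms(2) by (intro integral_completion) simp
  finally show ?thesis .
qed

text \<open>Taken over the whole space, which for test functions gives the same value as the
  integral over their domain; a dilation then changes no domain of integration.\<close>

definition dirichlet_energy :: "real \<Rightarrow> (real^'n \<Rightarrow> real) \<Rightarrow> real" where
  "dirichlet_energy p v = (\<integral>x. norm (grad v x) powr p \<partial>lborel)"

lemma p_capacity_eq:
  assumes "open \<Omega>"
  shows "p_capacity p E \<Omega> = Inf {dirichlet_energy p v |v. v \<in> test_functions \<Omega> \<and> (\<forall>x\<in>E. v x \<ge> 1)}"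
proof -
  have "(\<integral>x. norm (grad v x) powr p \<partial>lebesgue_on \<Omega>) = dirichlet_energy p v" if "v \<in> test_functions \<Omega>" for v
  proof -
    have [measurable]: "grad v \<in> borel_measurable borel"
      using smooth_continuous_on_grad[OF test_functions_smooth[OF that]] by (rule borel_measurable_continuous_onI)
    show ?thesis
      unfolding dirichlet_energy_def
      using assms test_functions_0_outside(2)[OF that] by (intro integral_lebesgue_on_eq) auto
  qed
  then show ?thesis
    unfolding p_capacity_def by (intro arg_cong[where f=Inf] Collect_cong) metis
qed

lemma test_functions_cmult:
  assumes "v \<in> test_functions S" shows "(\<lambda>x. c * v x) \<in> test_functions S"
proof (rule test_functionsI)
  show "smooth (\<lambda>x. c * v x)" by (intro smooth_mult smooth_const test_functions_smooth[OF assms])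
  show "{x. c * v x \<noteq> 0} \<subseteq> closure {x. v x \<noteq> 0}"
    using closure_subset[of "{x. v x \<noteq> 0}"] by auto
qed (use assms in \<open>auto simp: test_functions_def\<close>)

text \<open>The set whose infimum is the capacity must be nonempty for lower bounds to pass to the
  infimum. The support radius \<open>2 * s\<close> is the midpoint of \<open>r\<close> and
  \<open>R\<close>, and \<open>m\<close> bounds the bump from below on the inner ball.\<close>

lemma capacity_admissible_exists:
  fixes r R :: real assumes "0 < r" "r < R"
  shows "\<exists>v :: real^'n \<Rightarrow> real. v \<in> test_functions (ball 0 R) \<and> (\<forall>x\<in>ball 0 r. v x \<ge> 1)"
proof -
  define s where "s = (r + R) / 4"
  define t where "t = r / s"
  define m where "m = exp (- 1 / (4 - t\<^sup>2))"
  have s: "s > 0" "2 * s < R" using assms by (auto simp: s_def)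
  have t: "0 \<le> t" "t < 2" using assms s by (auto simp: t_def s_def divide_simps)
  show ?thesis
  proof (intro exI conjI ballI)
    show "(\<lambda>x. (1 / m) * bump (0::real^'n) s x) \<in> test_functions (ball 0 R)"
      using s by (intro test_functions_cmult bump_in_test_functions) auto
    fix x :: "real^'n" assume "x \<in> ball 0 r"
    then have "m \<le> bump 0 s x" unfolding m_def using s t by (intro bump_ge) (auto simp: t_def)
    moreover have "m > 0" by (simp add: m_def)
    ultimately show "1 / m * bump 0 s x \<ge> 1" by (simp add: field_simps)
  qed
qed

lemma dirichlet_energy_nonneg: "dirichlet_energy p v \<ge> 0"
  by (simp add: dirichlet_energy_def)

lemma p_capacity_le:
  assumes "open \<Omega>" "v \<in> test_functions \<Omega>" "\<And>x. x \<in> E \<Longrightarrow> v x \<ge> 1"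
  shows "p_capacity p E \<Omega> \<le> dirichlet_energy p v"
  unfolding p_capacity_eq[OF assms(1)]
  by (rule cInf_lower) (use assms in \<open>auto intro!: bdd_belowI[of _ 0] simp: dirichlet_energy_nonneg\<close>)

lemma p_capacity_ball_ge:
  fixes r R c :: real
  assumes "0 < r" "r < R"
    and "\<And>v :: real^'n \<Rightarrow> real. v \<in> test_functions (ball 0 R) \<Longrightarrow> (\<forall>x\<in>ball 0 r. v x \<ge> 1) \<Longrightarrow> c \<le> dirichlet_energy p v"
  shows "c \<le> p_capacity p (ball (0::real^'n) r) (ball 0 R)"
  unfolding p_capacity_eq[OF open_ball]
  by (rule cInf_greatest) (use capacity_admissible_exists[OF assms(1,2)] assms(3) in auto)

lemma p_capacity_ball_nonneg:
  assumes "0 < r" "r < R" shows "0 \<le> p_capacity p (ball (0::real^'n) r) (ball 0 R)"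
  using assms by (intro p_capacity_ball_ge dirichlet_energy_nonneg)

text \<open>Competitors correspond to each other under the dilation; the volume contributes s^n and
  the gradient s^(-p).\<close>

lemma p_capacity_ball_scale_le:
  fixes p r R s :: real
  assumes r: "0 < r" "r < R" and s: "s > 0"
  shows "p_capacity p (ball (0::real^'n) (s * r)) (ball 0 (s * R)) \<le>
    s powr (real CARD('n) - p) * p_capacity p (ball (0::real^'n) r) (ball 0 R)"
proof -
  have "s powr (p - real CARD('n)) * p_capacity p (ball (0::real^'n) (s * r)) (ball 0 (s * R)) \<le>
      p_capacity p (ball (0::real^'n) r) (ball 0 R)"
  proof (rule p_capacity_ball_ge[OF r])
    fix v :: "real^'n \<Rightarrow> real" assume v: "v \<in> test_functions (ball 0 R)" "\<forall>x\<in>ball 0 r. v x \<ge> 1"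
    define w where "w x = v (0 + (1 / s) *\<^sub>R x)" for x
    note sv = test_functions_smooth[OF v(1)]
    have sw: "smooth w" unfolding w_def by (rule smooth_affine_compose[OF sv])
    let ?K = "closure {x. v x \<noteq> 0}"
    have K: "compact ?K" "?K \<subseteq> ball 0 R" using v(1) by (auto simp: test_functions_def)
    have "{x. w x \<noteq> 0} \<subseteq> (\<lambda>x. s *\<^sub>R x) ` ?K"
    proof
      fix x assume "x \<in> {x. w x \<noteq> 0}"
      then have "(1 / s) *\<^sub>R x \<in> ?K" using closure_subset[of "{x. v x \<noteq> 0}"] by (auto simp: w_def)
      then show "x \<in> (\<lambda>x. s *\<^sub>R x) ` ?K" using s by (intro image_eqI[of _ _ "(1 / s) *\<^sub>R x"]) auto
    qed
    then have wt: "w \<in> test_functions (ball 0 (s * R))"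
      using K s by (intro test_functionsI[OF sw, of "(\<lambda>x. s *\<^sub>R x) ` ?K"] compact_scaling) auto
    have w1: "w x \<ge> 1" if "x \<in> ball 0 (s * r)" for x
      using v(2) that s by (auto simp: w_def field_simps)
    have [measurable]: "grad w \<in> borel_measurable borel" "grad v \<in> borel_measurable borel"
      using smooth_continuous_on_grad sw sv by (auto intro!: borel_measurable_continuous_onI)
    have gw: "grad w (0 + s *\<^sub>R x) = (1 / s) *\<^sub>R grad v x" for x
      unfolding w_def by (subst grad_affine_compose[OF sv]) (use s in simp)
    have "dirichlet_energy p w = \<bar>s\<bar> ^ CARD('n) *\<^sub>R (\<integral>x. norm (grad w (0 + s *\<^sub>R x)) powr p \<partial>lborel)"
      unfolding dirichlet_energy_def
      by (subst integral_lborel_affine[of _ s 0]) (use s in auto)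
    also have "\<dots> = s powr real CARD('n) * (\<integral>x. s powr - p * norm (grad v x) powr p \<partial>lborel)"
      unfolding gw using s by (simp add: powr_realpow powr_divide powr_minus_divide)
    also have "\<dots> = s powr (real CARD('n) - p) * dirichlet_energy p v"
      by (simp add: dirichlet_energy_def powr_diff powr_minus_divide)
    finally have "p_capacity p (ball (0::real^'n) (s * r)) (ball 0 (s * R)) \<le>
        s powr (real CARD('n) - p) * dirichlet_energy p v"
      using p_capacity_le[OF open_ball wt, of "ball 0 (s * r)" p] w1 by simp
    then have "s powr (p - real CARD('n)) * p_capacity p (ball (0::real^'n) (s * r)) (ball 0 (s * R)) \<le>
        s powr (p - real CARD('n)) * (s powr (real CARD('n) - p) * dirichlet_energy p v)"
      by (rule mult_left_mono) simp
    also have "\<dots> = dirichlet_energy p v"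
      using s by (simp add: mult.assoc[symmetric] flip: powr_add)
    finally show "s powr (p - real CARD('n)) * p_capacity p (ball (0::real^'n) (s * r)) (ball 0 (s * R)) \<le>
      dirichlet_energy p v" .
  qed
  then have "s powr (real CARD('n) - p) * (s powr (p - real CARD('n)) * p_capacity p (ball (0::real^'n) (s * r)) (ball 0 (s * R))) \<le>
      s powr (real CARD('n) - p) * p_capacity p (ball (0::real^'n) r) (ball 0 R)"
    by (rule mult_left_mono) simp
  then show ?thesis using s by (simp add: mult.assoc[symmetric] flip: powr_add)
qed

lemma p_capacity_ball_scale:
  fixes p r R s :: real
  assumes r: "0 < r" "r < R" and s: "s > 0"
  shows "p_capacity p (ball (0::real^'n) (s * r)) (ball 0 (s * R)) =
    s powr (real CARD('n) - p) * p_capacity p (ball (0::real^'n) r) (ball 0 R)"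
proof (rule antisym[OF p_capacity_ball_scale_le[OF assms]])
  \<comment> \<open>The reverse inequality is the same one for the inverse dilation.\<close>
  have "p_capacity p (ball (0::real^'n) (1 / s * (s * r))) (ball 0 (1 / s * (s * R))) \<le>
      (1 / s) powr (real CARD('n) - p) * p_capacity p (ball (0::real^'n) (s * r)) (ball 0 (s * R))"
    using assms by (intro p_capacity_ball_scale_le) auto
  then have "s powr (real CARD('n) - p) * p_capacity p (ball (0::real^'n) r) (ball 0 R) \<le>
      s powr (real CARD('n) - p) * ((1 / s) powr (real CARD('n) - p) * p_capacity p (ball (0::real^'n) (s * r)) (ball 0 (s * R)))"
    using s by (intro mult_left_mono) auto
  then show "s powr (real CARD('n) - p) * p_capacity p (ball (0::real^'n) r) (ball 0 R) \<le>
      p_capacity p (ball (0::real^'n) (s * r)) (ball 0 (s * R))"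
    using s by (simp add: powr_divide)
qed

text \<open>
  This is \<open>\<Lambda>\<close> as a function of the three radii. It is homogeneous of degree \<open>0\<close>, hence a function of
  their ratios. The type argument carries the dimension.
\<close>

definition capacity_ratio :: "'n::finite itself \<Rightarrow> real \<Rightarrow> real \<Rightarrow> real \<Rightarrow> real \<Rightarrow> real" where
  "capacity_ratio (_ :: 'n itself) p r1 r2 r3 =
     ln ((r2 + r3) / (2 * r2)) powr (- 1 / p) * ((r2 + r3) / 2) powr (1 - real CARD('n) / p) *
     (p_capacity p (ball (0 :: real^'n) ((r2 + r3) / 2)) (ball 0 r3) +
      p_capacity p (ball (0 :: real^'n) r1) (ball 0 r2) +
      r1 powr (real CARD('n) - p) - r3 powr (real CARD('n) - p)) powr (1 / p)"

text \<open>Everything in the bracket scales by s^(n-p), whose p-th root cancels the factor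
  s^(1-n/p), and the logarithm sees only a quotient.\<close>

lemma capacity_ratio_scale:
  fixes p r1 r2 r3 s :: real
  assumes r: "0 < r1" "r1 < r2" "r2 < r3" and s: "s > 0" and p: "p > 0"
  shows "capacity_ratio TYPE('n::finite) p (s * r1) (s * r2) (s * r3) = capacity_ratio TYPE('n) p r1 r2 r3"
proof -
  define n where "n = real CARD('n)"
  define R where "R = (r2 + r3) / 2"
  define K where "K = p_capacity p (ball (0 :: real^'n) R) (ball 0 r3) +
      p_capacity p (ball (0 :: real^'n) r1) (ball 0 r2) + r1 powr (n - p) - r3 powr (n - p)"
  have R: "(s * r2 + s * r3) / 2 = s * R" "0 < R" "R < r3" using r by (auto simp: R_def algebra_simps)
  have "p_capacity p (ball (0 :: real^'n) (s * R)) (ball 0 (s * r3)) +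
      p_capacity p (ball (0 :: real^'n) (s * r1)) (ball 0 (s * r2)) + (s * r1) powr (n - p) - (s * r3) powr (n - p)
      = s powr (n - p) * K"
    using p_capacity_ball_scale[OF R(2,3) s, where 'n='n and p=p] p_capacity_ball_scale[OF r(1,2) s, where 'n='n and p=p] r s
    by (simp only: K_def n_def powr_mult distrib_left right_diff_distrib)
  moreover have "(s * r2 + s * r3) / (2 * (s * r2)) = (r2 + r3) / (2 * r2)"
    using s r by (simp add: field_simps)
  moreover have "(s * R) powr (1 - n / p) * (s powr (n - p) * K) powr (1 / p) = R powr (1 - n / p) * K powr (1 / p)"
  proof -
    have "1 - n / p + (n - p) * (1 / p) = 0" using p by (simp add: field_simps)
    then have "s powr (1 - n / p) * s powr ((n - p) * (1 / p)) = 1"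
      using s by (simp flip: powr_add)
    moreover have "(s * R) powr (1 - n / p) = s powr (1 - n / p) * R powr (1 - n / p)"
      using s R by (simp add: powr_mult)
    moreover have "(s powr (n - p) * K) powr (1 / p) = s powr ((n - p) * (1 / p)) * K powr (1 / p)"
      by (simp only: powr_mult powr_powr)
    moreover have "u * x * (v * z) = x * z" if "u * v = 1" for u v x z :: real
      using that by (metis mult.assoc mult.commute mult.left_neutral)
    ultimately show ?thesis by simp
  qed
  ultimately show ?thesis
    unfolding capacity_ratio_def n_def[symmetric] R(1) R_def[symmetric] K_def[symmetric]
    by (simp only: mult.assoc)
qed

text \<open>Capacities are nonnegative, so dropping them leaves the lower bound in the form that
  \<open>chain_length_bound\<close> expects. It is positive because n - p is negative and r1 < r3;
  this later gives \<lambda> < 1.\<close>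

lemma capacity_ratio_ge:
  fixes p r1 r2 r3 :: real
  assumes r: "0 < r1" "r1 < r2" "r2 < r3" and p: "p > real CARD('n::finite)"
  shows "(((r2 + r3) / 2) powr (p - real CARD('n)) * (r1 powr (real CARD('n) - p) - r3 powr (real CARD('n) - p)) /
      ln ((r2 + r3) / (2 * r2))) powr (1 / p) \<le> capacity_ratio TYPE('n) p r1 r2 r3"
    and "capacity_ratio TYPE('n) p r1 r2 r3 > 0"
proof -
  define n where "n = real CARD('n)"
  define R where "R = (r2 + r3) / 2"
  define a where "a = ln ((r2 + r3) / (2 * r2))"
  define K where "K = p_capacity p (ball (0 :: real^'n) R) (ball 0 r3) +
      p_capacity p (ball (0 :: real^'n) r1) (ball 0 r2) + r1 powr (n - p) - r3 powr (n - p)"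
  define d where "d = r1 powr (n - p) - r3 powr (n - p)"
  have p0: "p > 0" using p by (rule le_less_trans[rotated]) simp
  have R: "0 < R" "R < r3" using r by (auto simp: R_def)
  have a: "a > 0" using r by (simp add: a_def field_simps)
  have d: "d > 0" unfolding d_def using r p by (simp add: n_def powr_less_mono2_neg)
  have K: "d \<le> K" using p_capacity_ball_nonneg[OF R, where 'n='n and p=p] p_capacity_ball_nonneg[OF r(1,2), where 'n='n and p=p]
    by (simp add: K_def d_def)
  have e: "a powr (- 1 / p) * R powr (1 - n / p) * x powr (1 / p) = (R powr (p - n) * x / a) powr (1 / p)"
    if "x > 0" for x
  proof -
    have "a powr (- 1 / p) = 1 / a powr (1 / p)" using powr_minus_divide[of a "1 / p"] by simp
    moreover have "(p - n) * (1 / p) = 1 - n / p" using p0 by (simp add: field_simps)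
    ultimately show ?thesis using that a R p0 by (simp add: powr_divide powr_mult powr_powr)
  qed
  have cr: "capacity_ratio TYPE('n) p r1 r2 r3 = (R powr (p - n) * K / a) powr (1 / p)"
    using e[of K] K d unfolding capacity_ratio_def K_def R_def a_def n_def by simp
  show "capacity_ratio TYPE('n) p r1 r2 r3 > 0" using K d a R by (simp add: cr)
  show "(((r2 + r3) / 2) powr (p - real CARD('n)) * (r1 powr (real CARD('n) - p) - r3 powr (real CARD('n) - p)) /
      ln ((r2 + r3) / (2 * r2))) powr (1 / p) \<le> capacity_ratio TYPE('n) p r1 r2 r3"
    unfolding cr n_def[symmetric] R_def[symmetric] a_def[symmetric] d_def[symmetric]
    using K a d p0 by (intro powr_mono2 divide_right_mono mult_left_mono) auto
qed

section \<open>Borel representatives\<close>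

text \<open>Lebesgue measure is complete: \<open>f\<close> differs from \<open>g\<close> only within
  a null set, all of whose subsets are measurable.\<close>

lemma lebesgue_measurable_AE_cong:
  fixes f g :: "'a::euclidean_space \<Rightarrow> 'b::topological_space"
  assumes g: "g \<in> borel_measurable lebesgue" and ae: "AE x in lebesgue. f x = g x"
  shows "f \<in> borel_measurable lebesgue"
proof (rule measurableI)
  fix X :: "'b set" assume X: "X \<in> sets borel"
  obtain N where N: "N \<in> null_sets lebesgue" "{x. f x \<noteq> g x} \<subseteq> N"
    using ae unfolding eventually_ae_filter by auto
  have "f -` X \<inter> N \<in> null_sets lebesgue"
    by (rule null_sets_completion_subset[OF _ N(1)]) auto
  then have "(g -` X \<inter> space lebesgue - N) \<union> (f -` X \<inter> N) \<in> sets lebesgue"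
    by (intro sets.Un sets.Diff measurable_sets[OF g X] null_setsD2[OF N(1)] null_setsD2)
  also have "(g -` X \<inter> space lebesgue - N) \<union> (f -` X \<inter> N) = f -` X \<inter> space lebesgue"
    using N(2) by auto
  finally show "f -` X \<inter> space lebesgue \<in> sets lebesgue" .
qed simp

lemma borel_representative_vec:
  fixes f :: "'a::euclidean_space \<Rightarrow> real^'m"
  assumes "f \<in> borel_measurable lebesgue"
  obtains g where "g \<in> borel_measurable borel" "AE x in lborel. f x = g x"
proof -
  have "\<forall>i. \<exists>g. g \<in> borel_measurable borel \<and> (AE x in lborel. f x $ i = g x)"
  proof
    fix i
    have "(\<lambda>x. f x $ i) \<in> borel_measurable lebesgue"
      by (rule measurable_compose[OF assms borel_measurable_nth])
    from completion_ex_borel_measurable_real[OF this]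
    show "\<exists>g. g \<in> borel_measurable borel \<and> (AE x in lborel. f x $ i = g x)" by auto
  qed
  from choice[OF this] obtain h where
    h: "\<forall>i. h i \<in> borel_measurable borel \<and> (AE x in lborel. f x $ i = h i x)" by blast
  show thesis
  proof (rule that)
    show "(\<lambda>x. \<chi> i. h i x) \<in> borel_measurable borel"
      using h by (subst borel_measurable_euclidean_space) (auto simp: Basis_vec_def inner_axis)
    have "AE x in lborel. \<forall>i. f x $ i = h i x"
      using h by (subst AE_all_countable) blast
    then show "AE x in lborel. f x = (\<chi> i. h i x)"
      by eventually_elim (simp add: vec_eq_iff)
  qed
qed

lemma borel_representative_real:
  fixes f :: "'a::euclidean_space \<Rightarrow> real"
  assumes "f \<in> borel_measurable lebesgue"
  obtains g where "g \<in> borel_measurable borel" "AE x in lborel. f x = g x"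
  using completion_ex_borel_measurable_real[OF assms] by auto

text \<open>The extension of \<open>f\<close> by 0 inherits measurability from its Borel
  representative \<open>g\<close>. This is how statements over \<open>lebesgue_on\<close> enter the
  Borel setting.\<close>

lemma integral_lebesgue_on_AE_eq:
  fixes f g :: "'a::euclidean_space \<Rightarrow> 'b::{banach, second_countable_topology}"
  assumes S: "S \<in> sets borel" and g: "g \<in> borel_measurable borel"
    and ae: "AE x in lborel. indicator S x *\<^sub>R f x = g x"
  shows "integral\<^sup>L (lebesgue_on S) f = integral\<^sup>L lborel g"
proof -
  have g': "g \<in> borel_measurable lebesgue" using g by (intro measurable_completion) simp
  have ae': "AE x in lebesgue. indicator S x *\<^sub>R f x = g x" by (rule AE_completion[OF ae])
  have "integral\<^sup>L (lebesgue_on S) f = (\<integral>x. indicator S x *\<^sub>R f x \<partial>lebesgue)"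
    using S by (intro integral_restrict_space) auto
  also have "\<dots> = integral\<^sup>L lebesgue g"
    by (rule integral_cong_AE[OF lebesgue_measurable_AE_cong[OF g' ae'] g' ae'])
  also have "\<dots> = integral\<^sup>L lborel g" using g by (intro integral_completion) simp
  finally show ?thesis .
qed

lemma integrable_lebesgue_on_AE_iff:
  fixes f g :: "'a::euclidean_space \<Rightarrow> 'b::{banach, second_countable_topology}"
  assumes S: "S \<in> sets borel" and g: "g \<in> borel_measurable borel"
    and ae: "AE x in lborel. indicator S x *\<^sub>R f x = g x"
  shows "integrable (lebesgue_on S) f \<longleftrightarrow> integrable lborel g"
proof -
  have g': "g \<in> borel_measurable lebesgue" using g by (intro measurable_completion) simp
  have ae': "AE x in lebesgue. indicator S x *\<^sub>R f x = g x" by (rule AE_completion[OF ae])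
  have "integrable (lebesgue_on S) f \<longleftrightarrow> integrable lebesgue (\<lambda>x. indicator S x *\<^sub>R f x)"
    using S by (intro integrable_restrict_space) auto
  also have "\<dots> \<longleftrightarrow> integrable lebesgue g"
    by (rule integrable_cong_AE[OF lebesgue_measurable_AE_cong[OF g' ae'] g' ae'])
  also have "\<dots> \<longleftrightarrow> integrable lborel g" using g by (intro integrable_completion) simp
  finally show ?thesis .
qed

section \<open>Caratheodory functions\<close>

lemma AE_lebesgue_on_iff:
  assumes "S \<in> sets borel"
  shows "(AE x in lebesgue_on S. P x) \<longleftrightarrow> (AE x in lborel. x \<in> S \<longrightarrow> P x)"
  using assms by (subst AE_restrict_space_iff) (auto simp: AE_completion_iff)

text \<open>The pair (u, Du) is approximated by simple functions. For these the composition is glued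
  from finitely many sections, measurable by assumption, and continuity in (t, h) carries over to
  the limit at almost every point.\<close>

lemma Caratheodory_measurable:
  fixes A :: "real^'n \<Rightarrow> real \<Rightarrow> real^'n \<Rightarrow> 'b::euclidean_space"
  assumes A: "Caratheodory G A" and G: "G \<in> sets borel" and S: "S \<in> sets borel" "S \<subseteq> G"
    and u: "u \<in> borel_measurable (lebesgue_on S)" and Du: "Du \<in> borel_measurable (lebesgue_on S)"
  shows "(\<lambda>x. indicator S x *\<^sub>R A x (u x) (Du x)) \<in> borel_measurable lebesgue"
proof -
  have S': "S \<inter> space lebesgue \<in> sets lebesgue" using S by auto
  define w where "w x = (u x, Du x)" for x
  have w: "w \<in> borel_measurable (lebesgue_on S)"
    unfolding w_def by (rule borel_measurable_Pair[OF u Du])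
  obtain s where s: "\<And>i::nat. simple_function (lebesgue_on S) (s i)"
    and lim: "\<And>x. x \<in> space (lebesgue_on S) \<Longrightarrow> (\<lambda>i. s i x) \<longlonglongrightarrow> w x"
    using borel_measurable_implies_sequence_metric[OF w, of 0] by blast
  have spS: "space (lebesgue_on S) = S" by (simp add: space_restrict_space)
  define f where "f i x = indicator S x *\<^sub>R A x (fst (s i x)) (snd (s i x))" for i x
  have fm: "f i \<in> borel_measurable lebesgue" for i
  proof -
    have "(\<lambda>x. A x (fst (s i x)) (snd (s i x))) \<in> borel_measurable (lebesgue_on S)"
    proof (rule measurable_compose_countable'[where f="\<lambda>z x. A x (fst z) (snd z)" and I="s i ` space (lebesgue_on S)"])
      show "(\<lambda>x. A x (fst z) (snd z)) \<in> borel_measurable (lebesgue_on S)" for z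
      proof (rule measurable_restrict_mono[OF _ S(2)])
        show "(\<lambda>x. A x (fst z) (snd z)) \<in> borel_measurable (lebesgue_on G)"
          using A unfolding Caratheodory_def by blast
      qed
      have fin: "finite (s i ` space (lebesgue_on S))" using s simple_functionD(1) by blast
      then show "countable (s i ` space (lebesgue_on S))" by (rule countable_finite)
      show "s i \<in> lebesgue_on S \<rightarrow>\<^sub>M count_space (s i ` space (lebesgue_on S))"
        using measurable_count_space_eq2[OF fin] s simple_functionD(2) by blast
    qed
    then show ?thesis unfolding f_def by (subst (asm) borel_measurable_restrict_space_iff[OF S'])
  qed
  have "AE x in lborel. x \<in> G \<longrightarrow> continuous_on UNIV (\<lambda>(t, h). A x t h)"
    using A G by (simp add: Caratheodory_def AE_lebesgue_on_iff)
  then have "AE x in lborel. (\<lambda>i. f i x) \<longlonglongrightarrow> indicator S x *\<^sub>R A x (u x) (Du x)"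
  proof eventually_elim
    case (elim x)
    show ?case
    proof (cases "x \<in> S")
      case True
      then have "continuous_on UNIV (\<lambda>(t, h). A x t h)" using elim S(2) by auto
      then have "(\<lambda>i. (\<lambda>(t, h). A x t h) (s i x)) \<longlonglongrightarrow> (\<lambda>(t, h). A x t h) (w x)"
        using lim[of x] True spS by (intro continuous_on_tendsto_compose[of UNIV "\<lambda>(t, h). A x t h"]) auto
      then show ?thesis using True by (simp add: f_def w_def case_prod_beta)
    qed (simp add: f_def)
  qed
  then have ae: "AE x in lebesgue. (\<lambda>i. f i x) \<longlonglongrightarrow> indicator S x *\<^sub>R A x (u x) (Du x)"
    by (rule AE_completion)
  obtain N where N: "N \<in> null_sets lebesgue"
      "{x. \<not> (\<lambda>i. f i x) \<longlonglongrightarrow> indicator S x *\<^sub>R A x (u x) (Du x)} \<subseteq> N"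
    using ae unfolding eventually_ae_filter by auto
  have Ns: "- N \<in> sets lebesgue" using sets.compl_sets[OF null_setsD2[OF N(1)]] by (simp add: Compl_eq_Diff_UNIV)
  \<comment> \<open>Cutting out the exceptional null set turns convergence almost everywhere into
    convergence everywhere; completeness then brings back the original function.\<close>
  define h where "h x = indicator (- N) x *\<^sub>R (indicator S x *\<^sub>R A x (u x) (Du x))" for x
  have "h \<in> borel_measurable lebesgue"
  proof (rule borel_measurable_LIMSEQ_metric)
    show "(\<lambda>x. indicator (- N) x *\<^sub>R f i x) \<in> borel_measurable lebesgue" for i
      using fm Ns by (intro borel_measurable_scaleR borel_measurable_indicator)
    show "(\<lambda>i. indicator (- N) x *\<^sub>R f i x) \<longlonglongrightarrow> h x" for x
    proof (cases "x \<in> N")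
      case False
      then have "(\<lambda>i. f i x) \<longlonglongrightarrow> indicator S x *\<^sub>R A x (u x) (Du x)" using N(2) by auto
      then show ?thesis unfolding h_def by (intro tendsto_intros)
    qed (simp add: h_def)
  qed
  moreover have "AE x in lebesgue. indicator S x *\<^sub>R A x (u x) (Du x) = h x"
    using AE_not_in[OF N(1)] by eventually_elim (simp add: h_def)
  ultimately show ?thesis by (rule lebesgue_measurable_AE_cong)
qed

text \<open>In the assumptions the null set depends on (t, h), whereas the pair to be inserted
  varies with \<open>x\<close>. A countable dense set of pairs has a common null set, and off it
  continuity extends the inequalities to all pairs, as they define a closed set;
  \<open>p > 1\<close> makes the powers of the norm continuous.\<close>

lemma structural_assumptions_AE:
  fixes A :: "real^'n \<Rightarrow> real \<Rightarrow> real^'n \<Rightarrow> real^'n" and p :: real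
  assumes str: "structural_assumptions p a0 a1 b1 G A B" and G: "G \<in> sets borel" and p: "p > 1"
  shows "AE x in lborel. x \<in> G \<longrightarrow> (\<forall>t h. A x t h \<bullet> h \<ge> a0 * norm h powr p \<and>
    norm (A x t h) \<le> a1 * norm h powr (p - 1) \<and> \<bar>B x t h\<bar> \<le> lower_order_weight b1 x * norm h powr (p - 1))"
proof -
  obtain D :: "(real \<times> (real^'n)) set" where D: "countable D"
    "\<And>X. open X \<Longrightarrow> X \<noteq> {} \<Longrightarrow> \<exists>d\<in>D. d \<in> X"
    using countable_dense_exists[where 'a="real \<times> (real^'n)"] by blast
  define P where "P x t h \<longleftrightarrow> A x t h \<bullet> h \<ge> a0 * norm h powr p \<and>
    norm (A x t h) \<le> a1 * norm h powr (p - 1) \<and> \<bar>B x t h\<bar> \<le> lower_order_weight b1 x * norm h powr (p - 1)" for x t h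
  have "AE x in lborel. x \<in> G \<longrightarrow> P x t h" for t h
  proof -
    have "AE x in lebesgue_on G. P x t h"
      using str unfolding structural_assumptions_def P_def by blast
    then show ?thesis by (rule AE_lebesgue_on_iff[OF G, THEN iffD1])
  qed
  then have "AE x in lborel. \<forall>z\<in>D. x \<in> G \<longrightarrow> P x (fst z) (snd z)"
    using D(1) by (subst AE_ball_countable) auto
  moreover have "AE x in lborel. x \<in> G \<longrightarrow> continuous_on UNIV (\<lambda>(t, h). A x t h)"
    "AE x in lborel. x \<in> G \<longrightarrow> continuous_on UNIV (\<lambda>(t, h). B x t h)"
    using str G by (simp_all add: structural_assumptions_def Caratheodory_def AE_lebesgue_on_iff)
  ultimately show ?thesis
    unfolding P_def[symmetric]
  proof eventually_elim
    case (elim x)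
    show ?case
    proof (intro impI allI)
      fix t h assume x: "x \<in> G"
      define C where "C = {z. P x (fst z) (snd z)}"
      have cA: "continuous_on UNIV (\<lambda>z. A x (fst z) (snd z))" and cB: "continuous_on UNIV (\<lambda>z. B x (fst z) (snd z))"
        using elim x by (auto simp: case_prod_beta)
      have cn: "continuous_on UNIV (\<lambda>z::real \<times> (real^'n). norm (snd z) powr q)" if "q > 0" for q
        using that by (intro continuous_on_powr' continuous_intros) auto
      have cp: "continuous_on UNIV (\<lambda>z::real \<times> (real^'n). norm (snd z) powr p)"
        "continuous_on UNIV (\<lambda>z::real \<times> (real^'n). norm (snd z) powr (p - 1))"
        using cn p by auto
      have "closed C"
        unfolding C_def P_def
        by (intro closed_Collect_conj closed_Collect_le continuous_intros cA cB cp)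
      moreover have "D \<subseteq> C" using elim(1) x by (auto simp: C_def)
      ultimately have "- C = {}" using D(2)[of "- C"] by (auto simp: open_Compl)
      then have "(t, h) \<in> C" by auto
      then show "P x t h" by (simp add: C_def)
    qed
  qed
qed

text \<open>The approximating sequence is constant, and \<open>integration_by_parts\<close>
  identifies the weak gradient.\<close>

lemma test_function_in_W1p_0:
  fixes \<phi> :: "real^'n \<Rightarrow> real" and p :: real
  assumes S: "open S" and \<phi>: "\<phi> \<in> test_functions S" and p: "p > 0"
  shows "in_W1p_0 p S \<phi> (grad \<phi>)"
proof -
  note s = test_functions_smooth[OF \<phi>]
  note c = smooth_continuous_on[OF s, of UNIV] smooth_continuous_on_grad[OF s, of UNIV]
  note o = test_functions_0_outside[OF \<phi>]
  obtain r where r: "\<And>z. norm z > r \<Longrightarrow> \<phi> z = 0"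
    using test_functions_vanishing[OF \<phi>] by blast
  have Lp: "Lp_on p S f" if cf: "continuous_on UNIV f" and v: "\<And>z. norm z > r \<Longrightarrow> f z = 0" and o: "\<And>z. z \<notin> S \<Longrightarrow> f z = 0"
    for f :: "real^'n \<Rightarrow> 'b::euclidean_space"
  proof -
    have fm: "f \<in> borel_measurable borel" using cf by (rule borel_measurable_continuous_onI)
    have cp: "continuous_on UNIV (\<lambda>x. norm (f x) powr p)"
      using p by (intro continuous_on_powr' continuous_intros cf) auto
    have "integrable lborel (\<lambda>x. norm (f x) powr p)"
      by (rule integrable_continuous_vanishing[OF cp, of r]) (simp add: v)
    then have "integrable (lebesgue_on S) (\<lambda>x. norm (f x) powr p)"
      using o S borel_measurable_continuous_onI[OF cp]
      by (subst integrable_lebesgue_on_AE_iff[of S "\<lambda>x. norm (f x) powr p"]) (auto simp: indicator_def)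
    moreover have "f \<in> borel_measurable (lebesgue_on S)"
      using fm by (intro measurable_restrict_space1 measurable_completion) simp
    ultimately show ?thesis by (simp add: Lp_on_def)
  qed
  have abs: "f absolutely_integrable_on K" if "compact K" "continuous_on UNIV f"
    for f :: "real^'n \<Rightarrow> 'b::euclidean_space" and K
  proof -
    have "integrable lborel (\<lambda>x. indicator K x *\<^sub>R f x)"
      using that continuous_on_subset by (intro borel_integrable_compact) auto
    then show ?thesis
      unfolding set_integrable_def by (subst integrable_completion) auto
  qed
  have "has_weak_gradient_on S \<phi> (grad \<phi>)"
    unfolding has_weak_gradient_on_def
  proof (intro conjI allI impI ballI)
    fix \<psi> assume \<psi>: "\<psi> \<in> test_functions S"
    note s' = test_functions_smooth[OF \<psi>]
    note c' = smooth_continuous_on[OF s', of UNIV] smooth_continuous_on_grad[OF s', of UNIV]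
    note o' = test_functions_0_outside[OF \<psi>]
    have "(\<integral>x. \<phi> x *\<^sub>R grad \<psi> x \<partial>lebesgue_on S) = (\<integral>x. \<phi> x *\<^sub>R grad \<psi> x \<partial>lborel)"
      by (rule integral_lebesgue_on_eq)
        (use S o in \<open>auto intro!: borel_measurable_continuous_onI continuous_on_scaleR c c'\<close>)
    also have "\<dots> = - (\<integral>x. \<psi> x *\<^sub>R grad \<phi> x \<partial>lborel)" by (rule integration_by_parts[OF s \<psi>])
    also have "(\<integral>x. \<psi> x *\<^sub>R grad \<phi> x \<partial>lborel) = (\<integral>x. \<psi> x *\<^sub>R grad \<phi> x \<partial>lebesgue_on S)"
      by (rule integral_lebesgue_on_eq[symmetric])
        (use S o' in \<open>auto intro!: borel_measurable_continuous_onI continuous_on_scaleR c c'\<close>)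
    finally show "(\<integral>x. \<phi> x *\<^sub>R grad \<psi> x \<partial>lebesgue_on S) = - (\<integral>x. \<psi> x *\<^sub>R grad \<phi> x \<partial>lebesgue_on S)" .
  qed (use abs c in auto)
  moreover have "Lp_on p S \<phi>" "Lp_on p S (grad \<phi>)"
    using c o r grad_vanishing[of r \<phi>] by (auto intro!: Lp)
  ultimately have "in_W1p p S \<phi> (grad \<phi>)" by (simp add: in_W1p_def)
  then show ?thesis
    unfolding in_W1p_0_def using \<phi> by (intro conjI exI[of _ "\<lambda>_. \<phi>"]) auto
qed

section \<open>Weak solutions\<close>

text \<open>Both branches of the weight satisfy this scale-invariant bound, the form in which the
  lower order growth enters \<open>normalized_solution\<close>.\<close>

lemma lower_order_weight_le:
  assumes "b1 \<ge> 0" shows "lower_order_weight b1 x * norm x \<le> b1"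
  using assms by (auto simp: lower_order_weight_def mult_left_le)

lemma integrable_lebesgue_on_subset:
  fixes f :: "'a::euclidean_space \<Rightarrow> 'b::{banach, second_countable_topology}"
  assumes "integrable (lebesgue_on T) f" "S \<subseteq> T" "S \<in> sets lebesgue" "T \<in> sets lebesgue"
  shows "integrable (lebesgue_on S) f"
proof -
  have "set_integrable lebesgue T f"
    using assms(1,4) unfolding set_integrable_def by (subst integrable_restrict_space[symmetric]) auto
  then have "set_integrable lebesgue S f" by (rule set_integrable_subset[OF _ assms(3,2)])
  then show ?thesis
    using assms(3) unfolding set_integrable_def by (subst integrable_restrict_space) auto
qed

lemma test_functions_mono: "S \<subseteq> T \<Longrightarrow> test_functions S \<subseteq> test_functions T"
  by (auto simp: test_functions_def)

text \<open>One statement for M - u (\<sigma> = -1, K = M) and u - m (\<sigma> = 1, K = -m).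
  Multiplying the gradient and both coefficients by \<sigma> preserves the growth conditions and the
  equation. All data are cut off to the ball of radius \<open>r3\<close> and replaced by Borel
  representatives; the jump across the sphere is invisible to test functions supported
  inside.\<close>

lemma weak_solution_Harnack:
  fixes G :: "(real^'n) set" and u :: "real^'n \<Rightarrow> real" and p a0 a1 b1 K \<sigma> \<mu> :: real
  assumes p: "p > real CARD('n)" and a: "a0 > 0" "a1 \<ge> 0" "b1 \<ge> 0"
    and G: "open G" and r: "0 < r1" "r1 < r2" "r2 < r3" and sub: "cball 0 r3 \<subseteq> G"
    and str: "structural_assumptions p a0 a1 b1 G A B" and sol: "weak_solution p G A B u"
    and \<sigma>: "\<sigma> = 1 \<or> \<sigma> = - 1"
    and nonneg: "AE x in lborel. x \<in> ball 0 r3 \<longrightarrow> 0 \<le> K + \<sigma> * u x"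
    and \<mu>: "\<mu> \<ge> 0" and low: "AE x in lborel. x \<in> ball 0 r1 \<longrightarrow> \<mu> \<le> K + \<sigma> * u x"
  shows "AE x in lborel. x \<in> ball 0 r2 \<longrightarrow>
    harnack_factor (real CARD('n)) p a0 a1 b1 r1 r2 r3 * \<mu>
      \<le> K + \<sigma> * u x"
proof -
  define S where "S = ball (0::real^'n) r3"
  have S: "S \<in> sets borel" "open S" "S \<subseteq> cball 0 r3" "S \<subseteq> G" using sub by (auto simp: S_def)
  have Gb: "G \<in> sets borel" using G by simp
  have p1: "p > 1" using p less_le_trans[of 1 "real CARD('n)" p]
    by (cases "CARD('n) = 1") (auto simp: Suc_lessI)
  have \<sigma>2: "\<sigma> * \<sigma> = 1" "\<bar>\<sigma>\<bar> = 1" using \<sigma> by auto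
  obtain Du where W: "in_W1p_loc p G u Du" and eq: "\<And>D \<eta> D\<eta>. open D \<Longrightarrow> compact (closure D) \<Longrightarrow>
      closure D \<subseteq> G \<Longrightarrow> in_W1p_0 p D \<eta> D\<eta> \<Longrightarrow>
      (\<integral>x. A x (u x) (Du x) \<bullet> D\<eta> x \<partial>lebesgue_on D) + (\<integral>x. B x (u x) (Du x) * \<eta> x \<partial>lebesgue_on D) = 0"
    using sol unfolding weak_solution_def by blast
  have Lp: "Lp_on p (cball 0 r3) u" "Lp_on p (cball 0 r3) Du"
    using W sub by (simp_all add: in_W1p_loc_def Lp_loc_on_def)
  have wg: "has_weak_gradient_on G u Du" using W by (simp add: in_W1p_loc_def)
  then have uabs: "u absolutely_integrable_on cball 0 r3"
    using sub unfolding has_weak_gradient_on_def by (meson compact_cball)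
  from wg have weak: "\<And>\<phi>. \<phi> \<in> test_functions G \<Longrightarrow>
      (\<integral>x. u x *\<^sub>R grad \<phi> x \<partial>lebesgue_on G) = - (\<integral>x. \<phi> x *\<^sub>R Du x \<partial>lebesgue_on G)"
    unfolding has_weak_gradient_on_def by (elim conjE bspec)
  have um: "u \<in> borel_measurable (lebesgue_on S)" and Dum: "Du \<in> borel_measurable (lebesgue_on S)"
    using Lp S(3) unfolding Lp_on_def by (auto intro: measurable_restrict_mono)
  have S': "S \<inter> space lebesgue \<in> sets lebesgue" using S by auto
  obtain u0 where u0: "u0 \<in> borel_measurable borel" "AE x in lborel. indicator S x *\<^sub>R u x = u0 x"
    using um borel_representative_real unfolding borel_measurable_restrict_space_iff[OF S'] by blast
  obtain D0 where D0: "D0 \<in> borel_measurable borel" "AE x in lborel. indicator S x *\<^sub>R Du x = D0 x"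
    using Dum borel_representative_vec unfolding borel_measurable_restrict_space_iff[OF S'] by blast
  have CA: "Caratheodory G A" "Caratheodory G B" using str by (auto simp: structural_assumptions_def)
  obtain A0 where A0: "A0 \<in> borel_measurable borel"
      "AE x in lborel. indicator S x *\<^sub>R A x (u x) (Du x) = A0 x"
    using borel_representative_vec[OF Caratheodory_measurable[OF CA(1) Gb S(1,4) um Dum]] by blast
  obtain B0 where B0: "B0 \<in> borel_measurable borel"
      "AE x in lborel. indicator S x *\<^sub>R B x (u x) (Du x) = B0 x"
    using borel_representative_real[OF Caratheodory_measurable[OF CA(2) Gb S(1,4) um Dum]] by blast
  define iS :: "real^'n \<Rightarrow> real" where "iS = indicator S"
  define u1 where "u1 x = iS x * u0 x" for x
  define D1 where "D1 x = iS x *\<^sub>R D0 x" for x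
  \<comment> \<open>Clipping at 0 makes nonnegativity hold at every point, as the locale requires;
    by \<open>nonneg\<close> it alters \<open>V\<close> only on a null set.\<close>
  define V where "V x = iS x * max 0 (K + \<sigma> * u1 x)" for x
  define F where "F x = \<sigma> *\<^sub>R D1 x" for x
  define A1 where "A1 x = (\<sigma> * iS x) *\<^sub>R A0 x" for x
  define B1 where "B1 x = (\<sigma> * iS x) * B0 x" for x
  have iS: "iS x = 1" if "x \<in> S" for x using that by (simp add: iS_def)
  have iS0: "iS x = 0" if "x \<notin> S" for x using that by (simp add: iS_def)
  note [measurable] = u0(1) D0(1) A0(1) B0(1)
  have [measurable]: "iS \<in> borel_measurable borel"
    unfolding iS_def using S(1) by (intro borel_measurable_indicator) simp
  have meas[measurable]: "u1 \<in> borel_measurable borel" "D1 \<in> borel_measurable borel" "V \<in> borel_measurable borel"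
    "F \<in> borel_measurable borel" "A1 \<in> borel_measurable borel" "B1 \<in> borel_measurable borel"
    unfolding u1_def D1_def V_def F_def A1_def B1_def by measurable
  have ae: "AE x in lborel. x \<in> S \<longrightarrow> u1 x = u x \<and> D1 x = Du x \<and> V x = K + \<sigma> * u x \<and>
      A1 x = \<sigma> *\<^sub>R A x (u x) (Du x) \<and> B1 x = \<sigma> * B x (u x) (Du x)"
    using u0(2) D0(2) A0(2) B0(2) nonneg
    by eventually_elim (auto simp: u1_def D1_def V_def A1_def B1_def iS S_def[symmetric])
  have out: "u1 x = 0" "D1 x = 0" "V x = 0" "F x = 0" "A1 x = 0" "B1 x = 0" if "x \<notin> S" for x
    using iS0[OF that] by (auto simp: u1_def D1_def V_def F_def A1_def B1_def)
  have sets: "S \<in> sets lebesgue" "cball (0::real^'n) r3 \<in> sets lebesgue" using S by auto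
  have u1_int: "integrable lborel u1"
  proof -
    have "integrable (lebesgue_on (cball 0 r3)) u"
      using uabs sets(2) unfolding set_integrable_def by (subst integrable_restrict_space) auto
    then have i: "integrable (lebesgue_on S) u" by (rule integrable_lebesgue_on_subset[OF _ S(3) sets])
    have "AE x in lborel. indicator S x *\<^sub>R u x = u1 x"
      using ae by eventually_elim (auto simp: indicator_def out)
    from integrable_lebesgue_on_AE_iff[OF S(1) meas(1) this] i show ?thesis by (rule iffD1)
  qed
  have D1_int: "integrable lborel (\<lambda>x. norm (D1 x) powr p)"
  proof -
    have i: "integrable (lebesgue_on S) (\<lambda>x. norm (Du x) powr p)"
      using Lp(2) by (intro integrable_lebesgue_on_subset[OF _ S(3) sets]) (simp add: Lp_on_def)
    have e: "AE x in lborel. indicator S x *\<^sub>R (norm (Du x) powr p) = norm (D1 x) powr p"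
      using ae by eventually_elim (auto simp: indicator_def out)
    have m: "(\<lambda>x. norm (D1 x) powr p) \<in> borel_measurable borel" by measurable
    from integrable_lebesgue_on_AE_iff[OF S(1) m e] i show ?thesis by (rule iffD1)
  qed
  have conv_int: "(\<integral>x. f x \<partial>lebesgue_on T) = (\<integral>x. g x \<partial>lborel)"
    if "T \<in> sets borel" "g \<in> borel_measurable borel" "S \<subseteq> T"
      and "\<And>x. x \<notin> S \<Longrightarrow> f x = 0" "\<And>x. x \<notin> S \<Longrightarrow> g x = 0" "AE x in lborel. x \<in> S \<longrightarrow> f x = g x"
    for T and f g :: "real^'n \<Rightarrow> 'c::{banach, second_countable_topology}"
  proof (rule integral_lebesgue_on_AE_eq[OF that(1,2)])
    show "AE x in lborel. indicator T x *\<^sub>R f x = g x"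
      using that(6) by eventually_elim (use that(3-5) in \<open>auto simp: indicator_def\<close>)
  qed
  have test: "smooth \<phi>" "\<phi> \<in> borel_measurable borel" "grad \<phi> \<in> borel_measurable borel"
    if "\<phi> \<in> test_functions S" for \<phi> :: "real^'n \<Rightarrow> real"
    using test_functions_smooth[OF that] smooth_continuous_on smooth_continuous_on_grad
    by (auto intro!: borel_measurable_continuous_onI)
  interpret normalized_solution p a0 a1 b1 r3 V F A1 B1
  proof
    show "V x \<ge> 0" for x by (simp add: V_def iS_def)
    show "V x = 0" "F x = 0" if "norm x > r3" for x
      using that out[of x] by (auto simp: S_def)
    show "integrable lborel V"
    proof (rule Bochner_Integration.integrable_bound)
      have "integrable lborel iS"
        unfolding iS_def S_def using emeasure_lborel_ball_finite[of "0::real^'n" r3]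
        by (intro integrable_real_indicator) auto
      then show "integrable lborel (\<lambda>x. \<bar>K\<bar> * iS x + \<bar>u1 x\<bar>)" using u1_int by auto
      show "AE x in lborel. norm (V x) \<le> norm (\<bar>K\<bar> * iS x + \<bar>u1 x\<bar>)"
      proof (intro always_eventually allI)
        fix x
        have "\<bar>\<sigma> * u1 x\<bar> = \<bar>u1 x\<bar>" using \<sigma> by auto
        then show "norm (V x) \<le> norm (\<bar>K\<bar> * iS x + \<bar>u1 x\<bar>)"
          by (cases "x \<in> S") (auto simp: V_def iS iS0)
      qed
    qed simp
    show "integrable lborel (\<lambda>x. norm (F x) powr p)" using D1_int \<sigma>2 by (simp add: F_def)
    show "AE x in lborel. a0 * norm (F x) powr p \<le> A1 x \<bullet> F x \<and>
      norm (A1 x) \<le> a1 * norm (F x) powr (p - 1) \<and> \<bar>B1 x\<bar> * norm x \<le> b1 * norm (F x) powr (p - 1)"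
      using ae structural_assumptions_AE[OF str Gb p1]
    proof eventually_elim
      case (elim x)
      show ?case
      proof (cases "x \<in> S")
        case True
        then have e: "F x = \<sigma> *\<^sub>R Du x" "A1 x = \<sigma> *\<^sub>R A x (u x) (Du x)" "B1 x = \<sigma> * B x (u x) (Du x)"
          using elim(1) by (auto simp: F_def)
        have g: "A x (u x) (Du x) \<bullet> Du x \<ge> a0 * norm (Du x) powr p"
          "norm (A x (u x) (Du x)) \<le> a1 * norm (Du x) powr (p - 1)"
          "\<bar>B x (u x) (Du x)\<bar> \<le> lower_order_weight b1 x * norm (Du x) powr (p - 1)"
          using elim(2) True S(4) by auto
        have "\<bar>B x (u x) (Du x)\<bar> * norm x \<le> lower_order_weight b1 x * norm (Du x) powr (p - 1) * norm x"
          using g(3) by (rule mult_right_mono) simp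
        also have "\<dots> = (lower_order_weight b1 x * norm x) * norm (Du x) powr (p - 1)" by simp
        also have "\<dots> \<le> b1 * norm (Du x) powr (p - 1)"
          using lower_order_weight_le[OF a(3)] by (rule mult_right_mono) simp
        finally have "\<bar>B x (u x) (Du x)\<bar> * norm x \<le> b1 * norm (Du x) powr (p - 1)" .
        moreover have "A1 x \<bullet> F x = A x (u x) (Du x) \<bullet> Du x"
          by (simp add: e \<sigma>2 mult.assoc[symmetric])
        moreover have "norm (A1 x) = norm (A x (u x) (Du x))" "norm (F x) = norm (Du x)"
          "\<bar>B1 x\<bar> = \<bar>B x (u x) (Du x)\<bar>"
          by (simp_all add: e \<sigma>2 abs_mult)
        ultimately show ?thesis using g by simp
      qed (simp add: out)
    qed
    fix \<phi> :: "real^'n \<Rightarrow> real"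
    assume \<phi>: "\<phi> \<in> test_functions (ball 0 r3)"
    then have \<phi>S: "\<phi> \<in> test_functions S" by (simp add: S_def)
    note t = test[OF \<phi>S] and o = test_functions_0_outside[OF \<phi>S]
    note [measurable] = t(2,3)
    have \<phi>G: "\<phi> \<in> test_functions G" using \<phi>S test_functions_mono[OF S(4)] by auto
    obtain \<rho> where \<rho>: "\<And>z. norm z > \<rho> \<Longrightarrow> \<phi> z = 0" using test_functions_vanishing[OF \<phi>S] by blast
    have g\<rho>: "grad \<phi> z = 0" if "norm z > \<rho>" for z using grad_vanishing[of \<rho> \<phi> z] \<rho> that by blast
    obtain M where M: "M > 0" "\<And>z. norm (grad \<phi> z) \<le> M"
      using continuous_vanishing_bounded[OF smooth_continuous_on_grad[OF t(1)], of \<rho>] g\<rho> by blast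
    show "(\<integral>y. V y *\<^sub>R grad \<phi> y \<partial>lborel) = - (\<integral>y. \<phi> y *\<^sub>R F y \<partial>lborel)"
    proof -
      have "(\<integral>x. u x *\<^sub>R grad \<phi> x \<partial>lebesgue_on G) = (\<integral>x. u1 x *\<^sub>R grad \<phi> x \<partial>lborel)"
        by (rule conv_int[OF Gb _ S(4)]) (use ae o out in auto)
      moreover have "(\<integral>x. \<phi> x *\<^sub>R Du x \<partial>lebesgue_on G) = (\<integral>x. \<phi> x *\<^sub>R D1 x \<partial>lborel)"
        by (rule conv_int[OF Gb _ S(4)]) (use ae o out in auto)
      ultimately have w: "(\<integral>x. u1 x *\<^sub>R grad \<phi> x \<partial>lborel) = - (\<integral>x. \<phi> x *\<^sub>R D1 x \<partial>lborel)"
        using weak[OF \<phi>G] by simp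
      have i1: "integrable lborel (\<lambda>x. u1 x *\<^sub>R grad \<phi> x)"
      proof (rule Bochner_Integration.integrable_bound)
        show "integrable lborel (\<lambda>x. M * \<bar>u1 x\<bar>)" using u1_int by auto
        show "AE x in lborel. norm (u1 x *\<^sub>R grad \<phi> x) \<le> norm (M * \<bar>u1 x\<bar>)"
        proof (intro always_eventually allI)
          fix x
          have "\<bar>u1 x\<bar> * norm (grad \<phi> x) \<le> \<bar>u1 x\<bar> * M" using M by (intro mult_left_mono) auto
          then show "norm (u1 x *\<^sub>R grad \<phi> x) \<le> norm (M * \<bar>u1 x\<bar>)" using M by (simp add: abs_mult mult.commute)
        qed
      qed measurable
      have i2: "integrable lborel (grad \<phi>)"
        by (rule integrable_continuous_vanishing[OF smooth_continuous_on_grad[OF t(1)] g\<rho>])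
      have "(\<integral>x. V x *\<^sub>R grad \<phi> x \<partial>lborel) = (\<integral>x. K *\<^sub>R grad \<phi> x + \<sigma> *\<^sub>R (u1 x *\<^sub>R grad \<phi> x) \<partial>lborel)"
      proof (rule integral_cong_AE)
        show "AE x in lborel. V x *\<^sub>R grad \<phi> x = K *\<^sub>R grad \<phi> x + \<sigma> *\<^sub>R (u1 x *\<^sub>R grad \<phi> x)"
          using ae
        proof eventually_elim
          case (elim x)
          show ?case
            by (cases "x \<in> S") (use elim in \<open>auto simp: o algebra_simps\<close>)
        qed
      qed measurable
      also have "\<dots> = K *\<^sub>R (\<integral>x. grad \<phi> x \<partial>lborel) + \<sigma> *\<^sub>R (\<integral>x. u1 x *\<^sub>R grad \<phi> x \<partial>lborel)"
        using i1 i2 by (subst Bochner_Integration.integral_add)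
          (auto simp del: scaleR_scaleR)
      \<comment> \<open>So the constant \<open>K\<close> leaves no trace in the weak
        gradient.\<close>
      also have "(\<integral>x. grad \<phi> x \<partial>lborel) = 0" using \<rho> by (intro integral_grad_eq_0[OF t(1), of \<rho>])
      also have "K *\<^sub>R 0 + \<sigma> *\<^sub>R (\<integral>x. u1 x *\<^sub>R grad \<phi> x \<partial>lborel) = - (\<sigma> *\<^sub>R (\<integral>x. \<phi> x *\<^sub>R D1 x \<partial>lborel))"
        by (simp add: w)
      also have "\<sigma> *\<^sub>R (\<integral>x. \<phi> x *\<^sub>R D1 x \<partial>lborel) = (\<integral>x. \<sigma> *\<^sub>R (\<phi> x *\<^sub>R D1 x) \<partial>lborel)"
        by (rule integral_scaleR_right[symmetric])
      also have "\<dots> = (\<integral>x. \<phi> x *\<^sub>R F x \<partial>lborel)" by (simp add: F_def mult.commute)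
      finally show ?thesis .
    qed
    show "(\<integral>x. A1 x \<bullet> grad \<phi> x \<partial>lborel) + (\<integral>x. B1 x * \<phi> x \<partial>lborel) = 0"
    proof -
      \<comment> \<open>The whole ball \<open>S\<close> serves as the relatively compact domain in
        the definition of a solution.\<close>
      have "closure S = cball 0 r3" using r by (simp add: S_def)
      then have "(\<integral>x. A x (u x) (Du x) \<bullet> grad \<phi> x \<partial>lebesgue_on S) + (\<integral>x. B x (u x) (Du x) * \<phi> x \<partial>lebesgue_on S) = 0"
        using sub p1 by (intro eq[OF S(2) _ _ test_function_in_W1p_0[OF S(2) \<phi>S]]) auto
      moreover have "(\<integral>x. A x (u x) (Du x) \<bullet> grad \<phi> x \<partial>lebesgue_on S) = (\<integral>x. \<sigma> * (A1 x \<bullet> grad \<phi> x) \<partial>lborel)"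
      proof (rule conv_int[OF S(1) _ order_refl])
        show "AE x in lborel. x \<in> S \<longrightarrow> A x (u x) (Du x) \<bullet> grad \<phi> x = \<sigma> * (A1 x \<bullet> grad \<phi> x)"
          using ae by eventually_elim (auto simp: \<sigma>2 mult.assoc[symmetric])
      qed (use o in auto)
      moreover have "(\<integral>x. B x (u x) (Du x) * \<phi> x \<partial>lebesgue_on S) = (\<integral>x. \<sigma> * (B1 x * \<phi> x) \<partial>lborel)"
      proof (rule conv_int[OF S(1) _ order_refl])
        show "AE x in lborel. x \<in> S \<longrightarrow> B x (u x) (Du x) * \<phi> x = \<sigma> * (B1 x * \<phi> x)"
          using ae by eventually_elim (auto simp: \<sigma>2 mult.assoc[symmetric])
      qed (use o in auto)
      ultimately have "\<sigma> * ((\<integral>x. A1 x \<bullet> grad \<phi> x \<partial>lborel) + (\<integral>x. B1 x * \<phi> x \<partial>lborel)) = 0"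
        by (simp add: distrib_left)
      then show ?thesis using \<sigma> by auto
    qed
  qed (use p a meas in auto)
  have "AE x in lborel. x \<in> ball 0 r1 \<longrightarrow> \<mu> \<le> V x"
    using low ae
  proof eventually_elim
    case (elim x)
    then show ?case using r by (auto simp: S_def)
  qed
  from Harnack[OF r \<mu> this] ae show ?thesis
  proof eventually_elim
    case (elim x)
    then show ?case using r by (auto simp: S_def)
  qed
qed


section \<open>Essential suprema on balls and the three balls inequality\<close>

lemma AE_lebesgue_ball_iff:
  "(AE x in lebesgue_on (ball (0::real^'n) r). P x) \<longleftrightarrow> (AE x in lborel. x \<in> ball 0 r \<longrightarrow> P x)"
  by (rule AE_lebesgue_on_iff) simp

lemma sup_on_ball_AE:
  "AE x in lborel. x \<in> ball 0 r \<longrightarrow> ereal (u x) \<le> sup_on_ball u r"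
  using esssup_AE[where M = "lebesgue_on (ball 0 r)" and f = "\<lambda>x. ereal (u x)"]
  unfolding sup_on_ball_def AE_lebesgue_ball_iff .

text \<open>Measurability is assumed because \<open>esssup\<close> is infinite on nonmeasurable
  functions.\<close>

lemma sup_on_ball_le:
  assumes "u \<in> borel_measurable (lebesgue_on (ball 0 r))"
    and "AE x in lborel. x \<in> ball 0 r \<longrightarrow> ereal (u x) \<le> c"
  shows "sup_on_ball u r \<le> c"
  unfolding sup_on_ball_def
  using assms by (intro esssup_I) (auto simp: AE_lebesgue_ball_iff)

text \<open>A ball has positive measure. The fact keeps sums of opposite infinities out of the
  extended real arithmetic below.\<close>

lemma sup_on_ball_neq_MInf:
  fixes u :: "real^'n \<Rightarrow> real"
  assumes "r > 0" shows "sup_on_ball u r \<noteq> - \<infinity>"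
proof
  assume "sup_on_ball u r = - \<infinity>"
  then have "AE x in lborel. x \<notin> ball (0::real^'n) r"
    using sup_on_ball_AE[of r u] by simp
  then have "ball (0::real^'n) r \<in> null_sets lborel"
    by (subst AE_iff_null_sets) auto
  then have "measure lborel (ball (0::real^'n) r) = 0" by (simp add: measure_eq_0_null_sets)
  then show False using assms by simp
qed

lemma inf_on_ball_eq: "inf_on_ball u r = - sup_on_ball (\<lambda>x. - u x) r"
  by (simp add: inf_on_ball_def sup_on_ball_def essinf_def)

lemma weak_solution_measurable:
  assumes "weak_solution p G A B u" "cball 0 R \<subseteq> G" "r \<le> R"
  shows "u \<in> borel_measurable (lebesgue_on (ball 0 r))"
proof -
  obtain Du where "in_W1p_loc p G u Du" using assms(1) unfolding weak_solution_def by blast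
  then have "Lp_on p (cball 0 R) u" using assms(2) by (simp add: in_W1p_loc_def Lp_loc_on_def)
  then have "u \<in> borel_measurable (lebesgue_on (cball 0 R))" by (simp add: Lp_on_def)
  then show ?thesis by (rule measurable_restrict_mono) (use assms(3) in auto)
qed

text \<open>Let m1 and m3 be the suprema of w = \<tau> u on the smallest and the largest ball. The
  nonnegative function m3 - w is at least m3 - m1 on the smallest ball, hence at least lam (m3 - m1)
  on the middle one, which rearranges to the claim. Any \<open>lam\<close> below the Harnack factor
  will do because m3 - m1 is nonnegative.\<close>

lemma weak_solution_three_balls:
  fixes G :: "(real^'n) set" and u :: "real^'n \<Rightarrow> real" and p a0 a1 b1 \<tau> lam :: real
  assumes p: "p > real CARD('n)" and a: "a0 > 0" "a1 \<ge> 0" "b1 \<ge> 0"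
    and G: "open G" and r: "0 < r1" "r1 < r2" "r2 < r3" and sub: "cball 0 r3 \<subseteq> G"
    and str: "structural_assumptions p a0 a1 b1 G A B" and sol: "weak_solution p G A B u"
    and \<tau>: "\<tau> = 1 \<or> \<tau> = - 1" and lam: "0 < lam" "lam < 1"
      "lam \<le> harnack_factor (real CARD('n)) p a0 a1 b1 r1 r2 r3"
  shows "sup_on_ball (\<lambda>x. \<tau> * u x) r2 \<le>
    ereal lam * sup_on_ball (\<lambda>x. \<tau> * u x) r1 + ereal (1 - lam) * sup_on_ball (\<lambda>x. \<tau> * u x) r3"
proof (cases "sup_on_ball (\<lambda>x. \<tau> * u x) r3 = \<infinity>")
  \<comment> \<open>An infinite summand makes the right side infinite.\<close>
  case True
  then show ?thesis using lam by simp
next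
  case False
  define w where "w x = \<tau> * u x" for x
  have wm: "w \<in> borel_measurable (lebesgue_on (ball 0 r))" if "r \<le> r3" for r
    unfolding w_def using weak_solution_measurable[OF sol sub that]
    by (intro borel_measurable_times borel_measurable_const)
  obtain m3 where m3: "sup_on_ball w r3 = ereal m3"
    using False sup_on_ball_neq_MInf[of r3 w] r unfolding w_def[symmetric]
    by (cases "sup_on_ball w r3") auto
  have w3: "AE x in lborel. x \<in> ball 0 r3 \<longrightarrow> w x \<le> m3"
    using sup_on_ball_AE[of r3 w] by (simp add: m3)
  have "sup_on_ball w r1 \<le> ereal m3"
  proof (rule sup_on_ball_le[OF wm])
    show "AE x in lborel. x \<in> ball 0 r1 \<longrightarrow> ereal (w x) \<le> ereal m3"
      using w3 by eventually_elim (use r in auto)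
  qed (use r in simp)
  then obtain m1 where m1: "sup_on_ball w r1 = ereal m1" "m1 \<le> m3"
    using sup_on_ball_neq_MInf[of r1 w] r by (cases "sup_on_ball w r1") auto
  have w1: "AE x in lborel. x \<in> ball 0 r1 \<longrightarrow> w x \<le> m1"
    using sup_on_ball_AE[of r1 w] by (simp add: m1)
  have "AE x in lborel. x \<in> ball 0 r2 \<longrightarrow>
    harnack_factor (real CARD('n)) p a0 a1 b1 r1 r2 r3 * (m3 - m1)
      \<le> m3 + (- \<tau>) * u x"
  proof (rule weak_solution_Harnack[OF p a G r sub str sol])
    show "AE x in lborel. x \<in> ball 0 r3 \<longrightarrow> 0 \<le> m3 + - \<tau> * u x"
      using w3 by eventually_elim (simp add: w_def)
    show "AE x in lborel. x \<in> ball 0 r1 \<longrightarrow> m3 - m1 \<le> m3 + - \<tau> * u x"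
      using w1 by eventually_elim (simp add: w_def)
  qed (use \<tau> m1 in auto)
  then have "AE x in lborel. x \<in> ball 0 r2 \<longrightarrow> ereal (w x) \<le> ereal (lam * m1 + (1 - lam) * m3)"
  proof eventually_elim
    case (elim x)
    have "lam * (m3 - m1) \<le>
      harnack_factor (real CARD('n)) p a0 a1 b1 r1 r2 r3 * (m3 - m1)"
      using lam(3) m1(2) by (intro mult_right_mono) auto
    with elim show ?case by (auto simp: w_def algebra_simps)
  qed
  then have "sup_on_ball w r2 \<le> ereal (lam * m1 + (1 - lam) * m3)"
    using r by (intro sup_on_ball_le[OF wm]) auto
  then show ?thesis unfolding w_def[symmetric] by (simp add: m1 m3)
qed

text \<open>Negation fails to distribute over an extended real sum with infinities of both signs;
  the conditions on \<open>s1\<close> and \<open>s3\<close> exclude such sums.\<close>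

lemma ereal_uminus_convex_le:
  fixes s1 s2 s3 :: ereal and lam :: real
  assumes "s2 \<le> ereal lam * s1 + ereal (1 - lam) * s3" "0 < lam" "lam < 1" "s1 \<noteq> - \<infinity>" "s3 \<noteq> - \<infinity>"
  shows "ereal lam * (- s1) + ereal (1 - lam) * (- s3) \<le> - s2"
  using assms by (cases s1; cases s2; cases s3) auto

text \<open>The order of the quantifiers expresses the dependence of the constants:
  \<open>C\<close>, \<open>\<Lambda>\<close> and \<open>lam\<close> precede the radii as well as G,
  A, B and u, and \<open>\<Lambda>\<close> and \<open>lam\<close> receive nothing but the three
  ratios. Suprema and infima are extended reals, so boundedness of u is not presupposed.\<close>

theorem theorem6p1:
  fixes p a\<^sub>0 a\<^sub>1 b\<^sub>1 n :: real
  assumes "CARD('n::finite) \<ge> 2" and "n = real CARD('n)" and "p > n"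
    and "0 < a\<^sub>0" and "a\<^sub>0 \<le> a\<^sub>1" and "0 < b\<^sub>1"
  shows
    "\<exists>C>0. \<exists>(\<Lambda> :: real \<Rightarrow> real \<Rightarrow> real \<Rightarrow> real) (lam :: real \<Rightarrow> real \<Rightarrow> real \<Rightarrow> real).
      \<forall>r\<^sub>1 r\<^sub>2 r\<^sub>3. 0 < r\<^sub>1 \<and> r\<^sub>1 < r\<^sub>2 \<and> r\<^sub>2 < r\<^sub>3 \<longrightarrow>
        \<Lambda> (r\<^sub>1 / r\<^sub>2) (r\<^sub>1 / r\<^sub>3) (r\<^sub>2 / r\<^sub>3) =
          ln ((r\<^sub>2 + r\<^sub>3) / (2 * r\<^sub>2)) powr (- 1 / p) * ((r\<^sub>2 + r\<^sub>3) / 2) powr (1 - n / p) *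
          (p_capacity p (ball (0 :: real^'n) ((r\<^sub>2 + r\<^sub>3) / 2)) (ball 0 r\<^sub>3) +
           p_capacity p (ball (0 :: real^'n) r\<^sub>1) (ball 0 r\<^sub>2) +
           r\<^sub>1 powr (n - p) - r\<^sub>3 powr (n - p)) powr (1 / p) \<and>
        lam (r\<^sub>1 / r\<^sub>2) (r\<^sub>1 / r\<^sub>3) (r\<^sub>2 / r\<^sub>3) =
          exp (- C * \<Lambda> (r\<^sub>1 / r\<^sub>2) (r\<^sub>1 / r\<^sub>3) (r\<^sub>2 / r\<^sub>3)) \<and>
        0 < lam (r\<^sub>1 / r\<^sub>2) (r\<^sub>1 / r\<^sub>3) (r\<^sub>2 / r\<^sub>3) \<and> lam (r\<^sub>1 / r\<^sub>2) (r\<^sub>1 / r\<^sub>3) (r\<^sub>2 / r\<^sub>3) < 1 \<and>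
        (\<forall>(G :: (real^'n) set) A B u.
          open G \<and> connected G \<and> 0 \<in> G \<and> cball 0 r\<^sub>3 \<subseteq> G \<and>
          structural_assumptions p a\<^sub>0 a\<^sub>1 b\<^sub>1 G A B \<and> weak_solution p G A B u \<longrightarrow>
            sup_on_ball u r\<^sub>2 \<le>
              ereal (lam (r\<^sub>1 / r\<^sub>2) (r\<^sub>1 / r\<^sub>3) (r\<^sub>2 / r\<^sub>3)) * sup_on_ball u r\<^sub>1 +
              ereal (1 - lam (r\<^sub>1 / r\<^sub>2) (r\<^sub>1 / r\<^sub>3) (r\<^sub>2 / r\<^sub>3)) * sup_on_ball u r\<^sub>3 \<and>
            inf_on_ball u r\<^sub>2 \<ge>
              ereal (lam (r\<^sub>1 / r\<^sub>2) (r\<^sub>1 / r\<^sub>3) (r\<^sub>2 / r\<^sub>3)) * inf_on_ball u r\<^sub>1 +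
              ereal (1 - lam (r\<^sub>1 / r\<^sub>2) (r\<^sub>1 / r\<^sub>3) (r\<^sub>2 / r\<^sub>3)) * inf_on_ball u r\<^sub>3)"
proof -
  have p: "p > real CARD('n)" "p > 1" "n > 0" using assms by auto
  define H where "H = harnack_const n p a\<^sub>0 a\<^sub>1 b\<^sub>1"
  have H: "H > 0" unfolding H_def using assms p by (intro harnack_const_pos) auto
  obtain c where c: "c > 0" "\<And>r1 r2 r3. 0 < r1 \<Longrightarrow> r1 < r2 \<Longrightarrow> r2 < r3 \<Longrightarrow>
    1 + 5 * ln ((r2 / r1) * ((r3 - r1) / (r3 - r2))) \<le>
    c * (((r2 + r3) / 2) powr (p - n) * (r1 powr (n - p) - r3 powr (n - p)) / ln ((r2 + r3) / (2 * r2))) powr (1 / p)"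
    using chain_length_bound[OF p(3) assms(3) p(2)] by blast
  \<comment> \<open>By homogeneity the radii may be divided by the largest one; they become y =
    r1/r3, z = r2/r3 and 1.\<close>
  define \<Lambda> where "\<Lambda> x y z = capacity_ratio TYPE('n) p y z 1" for x y z :: real
  \<comment> \<open>\<open>H\<close> is the cost of one ball and \<open>c\<close> bounds the number
    of balls per unit of \<open>\<Lambda>\<close>; their product is the constant \<open>C\<close> of
    the theorem.\<close>
  define lam where "lam x y z = exp (- (H * c) * \<Lambda> x y z)" for x y z
  have main:
    "\<Lambda> (r1 / r2) (r1 / r3) (r2 / r3) =
          ln ((r2 + r3) / (2 * r2)) powr (- 1 / p) * ((r2 + r3) / 2) powr (1 - n / p) *
          (p_capacity p (ball (0 :: real^'n) ((r2 + r3) / 2)) (ball 0 r3) +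
           p_capacity p (ball (0 :: real^'n) r1) (ball 0 r2) +
           r1 powr (n - p) - r3 powr (n - p)) powr (1 / p) \<and>
        lam (r1 / r2) (r1 / r3) (r2 / r3) =
          exp (- (H * c) * \<Lambda> (r1 / r2) (r1 / r3) (r2 / r3)) \<and>
        0 < lam (r1 / r2) (r1 / r3) (r2 / r3) \<and> lam (r1 / r2) (r1 / r3) (r2 / r3) < 1 \<and>
        (\<forall>(G :: (real^'n) set) A B u.
          open G \<and> connected G \<and> 0 \<in> G \<and> cball 0 r3 \<subseteq> G \<and>
          structural_assumptions p a\<^sub>0 a\<^sub>1 b\<^sub>1 G A B \<and> weak_solution p G A B u \<longrightarrow>
            sup_on_ball u r2 \<le>
              ereal (lam (r1 / r2) (r1 / r3) (r2 / r3)) * sup_on_ball u r1 +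
              ereal (1 - lam (r1 / r2) (r1 / r3) (r2 / r3)) * sup_on_ball u r3 \<and>
            inf_on_ball u r2 \<ge>
              ereal (lam (r1 / r2) (r1 / r3) (r2 / r3)) * inf_on_ball u r1 +
              ereal (1 - lam (r1 / r2) (r1 / r3) (r2 / r3)) * inf_on_ball u r3)"
    if r: "0 < r1" "r1 < r2" "r2 < r3" for r1 r2 r3
  proof -
    define l where "l = lam (r1 / r2) (r1 / r3) (r2 / r3)"
    have \<Lambda>: "\<Lambda> (r1 / r2) (r1 / r3) (r2 / r3) = capacity_ratio TYPE('n) p r1 r2 r3"
      using capacity_ratio_scale[OF r, of "1 / r3" p, where 'n='n] r p by (simp add: \<Lambda>_def)
    note ge = capacity_ratio_ge[OF r p(1)]
    have l: "0 < l" "l < 1"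
      using ge(2) H c(1) by (auto simp: l_def lam_def \<Lambda>)
    have "1 + 5 * ln ((r2 / r1) * ((r3 - r1) / (r3 - r2))) \<le> c * capacity_ratio TYPE('n) p r1 r2 r3"
      using order_trans[OF c(2)[OF r] mult_left_mono[OF ge(1)[folded assms(2)]]] c(1) assms(2) by simp
    then have "H * (1 + 5 * ln ((r2 / r1) * ((r3 - r1) / (r3 - r2)))) \<le> H * (c * capacity_ratio TYPE('n) p r1 r2 r3)"
      using H by (intro mult_left_mono) auto
    then have le: "l \<le> harnack_factor (real CARD('n)) p a\<^sub>0 a\<^sub>1 b\<^sub>1 r1 r2 r3"
      unfolding l_def lam_def \<Lambda> harnack_factor_def by (simp add: H_def assms(2) mult.assoc)
    have "sup_on_ball u r2 \<le> ereal l * sup_on_ball u r1 + ereal (1 - l) * sup_on_ball u r3 \<and>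
       inf_on_ball u r2 \<ge> ereal l * inf_on_ball u r1 + ereal (1 - l) * inf_on_ball u r3"
      if "open G" "cball 0 r3 \<subseteq> G" "structural_assumptions p a\<^sub>0 a\<^sub>1 b\<^sub>1 G A B" "weak_solution p G A B u"
      for G :: "(real^'n) set" and A B u
    proof
      have a: "a\<^sub>0 > 0" "a\<^sub>1 \<ge> 0" "b\<^sub>1 \<ge> 0" using assms by auto
      note tb = weak_solution_three_balls[OF p(1) a that(1) r that(2-4) _ l le]
      show "sup_on_ball u r2 \<le> ereal l * sup_on_ball u r1 + ereal (1 - l) * sup_on_ball u r3"
        using tb[of 1] by simp
      \<comment> \<open>The infimum of \<open>u\<close> is minus the supremum of \<open>- u\<close>,
        so the second inequality is the first one for \<tau> = -1.\<close>
      have "sup_on_ball (\<lambda>x. - u x) r2 \<le>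
          ereal l * sup_on_ball (\<lambda>x. - u x) r1 + ereal (1 - l) * sup_on_ball (\<lambda>x. - u x) r3"
        using tb[of "- 1"] by simp
      then show "inf_on_ball u r2 \<ge> ereal l * inf_on_ball u r1 + ereal (1 - l) * inf_on_ball u r3"
        unfolding inf_on_ball_eq using l r by (intro ereal_uminus_convex_le sup_on_ball_neq_MInf) auto
    qed
    moreover have "\<Lambda> (r1 / r2) (r1 / r3) (r2 / r3) =
        ln ((r2 + r3) / (2 * r2)) powr (- 1 / p) * ((r2 + r3) / 2) powr (1 - n / p) *
        (p_capacity p (ball (0 :: real^'n) ((r2 + r3) / 2)) (ball 0 r3) +
         p_capacity p (ball (0 :: real^'n) r1) (ball 0 r2) +
         r1 powr (n - p) - r3 powr (n - p)) powr (1 / p)"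
      using \<Lambda> unfolding capacity_ratio_def assms(2) .
    moreover have "l = exp (- (H * c) * \<Lambda> (r1 / r2) (r1 / r3) (r2 / r3))"
      by (simp only: l_def lam_def)
    ultimately show ?thesis using l unfolding l_def[symmetric] by blast
  qed
  have "H * c > 0" using H c(1) by simp
  then show ?thesis
    using main by blast
qed

end
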